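(* Let $\varphi$ be a continuous, nowhere-zero, complex-valued function on the unit circle $\Sigma=\{z\in\mathbb C:|z|=1\}$ with Fourier coefficients $\varphi_j$ (so $\varphi(z)=\sum_{j\in\mathbb Z}\varphi_jz^j$) satisfying $\sum_{j\in\mathbb Z}|j\varphi_j|<\infty$, and let $\#(\varphi)$ denote its winding number. For $n\in\mathbb Z$ let $\mathcal K_n$ be the integral operator on $L^2(\Sigma,dw)$, $$(\mathcal K_nf)(z)=\int_{|w|=1}\mathcal K_n(z,w)f(w)\,dw,\qquad \mathcal K_n(z,w)=\frac{1-z^n\varphi(z)w^{-n}\varphi(w)^{-1}}{2\pi i(z-w)}.$$ Let $S$ and $R$ be the matrices indexed by $i,j\in\mathbb Z$ with entries $$S(i,j)=\sum_{k\ge1}(\varphi^{-1})_{i+k}\varphi_{-j-k},\qquad R(i,j)=\sum_{k\le0}(\varphi^{-1})_{i+k}\varphi_{-j-k},$$ where $(\varphi^{-1})_l$ are the Fourier coefficients of $1/\varphi$. Let $S_n$ be the operator on $\ell^2(\{n,n+1,\dots\})$ with matrix $S(i,j)$, $i,j\ge n$, and $R_n$ the operator on $\ell^2(\{\dots,n-2,n-1\})$ with matrix $R(i,j)$, $i,j\le n-1$. Then for every $n\in\mathbb Z$, the operators $\mathcal K_n$, $S_n$, $R_n$ are trace class, and for $s\in\mathbb C$, $$\det(1-s\mathcal K_n)=(1+s)^{n+\#(\varphi)}\det(1-s^2S_n)\quad (s\neq-1),$$ $$\det(1-s\mathcal K_n)=(1-s)^{-n-\#(\varphi)}\det(1-s^2R_n)\quad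 (s\neq1).$$
   Context: Determinants are Fredholm determinants of trace-class perturbations of the identity. The unit circle is oriented counterclockwise. *)

theory Defs
  imports "HOL-Complex_Analysis.Complex_Analysis" "HOL-Combinatorics.Permutations"
begin

definition fcoef :: "(complex \<Rightarrow> complex) \<Rightarrow> int \<Rightarrow> complex" where
  "fcoef \<phi> j = (1 / (2 * pi)) * integral {0..2*pi} (\<lambda>\<theta>. \<phi> (cis \<theta>) * cis (- of_int j * \<theta>))"

definition windnum :: "(complex \<Rightarrow> complex) \<Rightarrow> int" where
  "windnum \<phi> = (THE k::int. winding_number (\<phi> \<circ> circlepath 0 1) 0 = of_int k)"

text \<open>Hilbert--Schmidt and trace-class matrices indexed by a set I of integers
  (operators on l2(I) given by their matrix in the standard basis).
  Trace class = product of two Hilbert--Schmidt operators.\<close>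
definition hilbert_schmidt :: "int set \<Rightarrow> (int \<Rightarrow> int \<Rightarrow> complex) \<Rightarrow> bool" where
  "hilbert_schmidt I A \<longleftrightarrow> (\<lambda>(i,j). (norm (A i j))\<^sup>2) summable_on (I \<times> I)"

definition trace_class :: "int set \<Rightarrow> (int \<Rightarrow> int \<Rightarrow> complex) \<Rightarrow> bool" where
  "trace_class I T \<longleftrightarrow> (\<exists>A B. hilbert_schmidt I A \<and> hilbert_schmidt I B \<and>
      (\<forall>i\<in>I. \<forall>j\<in>I. ((\<lambda>k. A i k * B k j) has_sum T i j) I))"

definition fin_det :: "int set \<Rightarrow> (int \<Rightarrow> int \<Rightarrow> complex) \<Rightarrow> complex" where
  "fin_det F T = (\<Sum>p\<in>{p. p permutes F}. of_int (sign p) * (\<Prod>i\<in>F. T i (p i)))"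

text \<open>Fredholm determinant det(1 + T) of a trace-class matrix T on l2(I):
  det(1+T) = sum over m of tr(Lambda^m T), the trace computed in the basis induced
  by the standard basis, i.e. the sum of all finite principal minors.\<close>
definition fredholm_det :: "int set \<Rightarrow> (int \<Rightarrow> int \<Rightarrow> complex) \<Rightarrow> complex" where
  "fredholm_det I T = infsum (\<lambda>F. fin_det F T) {F. finite F \<and> F \<subseteq> I}"

definition Kker :: "(complex \<Rightarrow> complex) \<Rightarrow> int \<Rightarrow> complex \<Rightarrow> complex \<Rightarrow> complex" where
  "Kker \<phi> n z w = (1 - z powi n * \<phi> z * w powi (-n) * inverse (\<phi> w)) / (2 * pi * \<i> * (z - w))"

text \<open>Matrix of the integral operator (K_n f)(z) = contour integral of K_n(z,w) f(w) dw on
  L2 of the unit circle (arclength measure), in the orthonormal basis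
  e_k(z) = z^k / sqrt(2 pi):  entry (j,k) = < K_n e_k, e_j >.\<close>
definition Kmat :: "(complex \<Rightarrow> complex) \<Rightarrow> int \<Rightarrow> int \<Rightarrow> int \<Rightarrow> complex" where
  "Kmat \<phi> n j k = (1 / (2 * pi)) * integral {0..2*pi} (\<lambda>\<theta>.
      cis (- of_int j * \<theta>) *
      contour_integral (circlepath 0 1) (\<lambda>w. Kker \<phi> n (cis \<theta>) w * w powi k))"

definition Smat :: "(complex \<Rightarrow> complex) \<Rightarrow> int \<Rightarrow> int \<Rightarrow> complex" where
  "Smat \<phi> i j = (\<Sum>m::nat. fcoef (\<lambda>z. inverse (\<phi> z)) (i + int m + 1) * fcoef \<phi> (- j - int m - 1))"

definition Rmat :: "(complex \<Rightarrow> complex) \<Rightarrow> int \<Rightarrow> int \<Rightarrow> complex" where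
  "Rmat \<phi> i j = (\<Sum>m::nat. fcoef (\<lambda>z. inverse (\<phi> z)) (i - int m) * fcoef \<phi> (- j + int m))"

end

theory Submission
  imports Defs "Jordan_Normal_Form.Determinant"
begin

text \<open>Let \<open>P\<^sub>m\<close> be the projection onto the indices \<open>\<ge> m\<close>, let \<open>T\<close> be the (Laurent) matrix of
  multiplication by \<open>\<phi>\<close>, and put \<open>R = T\<^sup>-\<^sup>1 P\<^sub>0 T\<close> and \<open>S = 1 - R\<close>. The matrix of \<open>\<K>\<^sub>n\<close> is conjugate by \<open>T\<close>
  to \<open>P\<^sub>n - R\<close>, a difference of idempotents with absolutely summable entries. From the identity
  \<open>(1 + s P\<^sub>n)(1 - s (P\<^sub>n - R)) = (1 - s\<^sup>2 P\<^sub>n S)(1 + s R)\<close> one reads off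
  \<open>det (1 - s \<K>\<^sub>n) = det (1 - s\<^sup>2 S\<^sub>n) \<cdot> det (T\<^sup>-\<^sup>1 (1 + s P\<^sub>0) T (1 + s P\<^sub>n)\<^sup>-\<^sup>1)\<close>, and the second identity is the
  same with \<open>P\<^sub>n, S, s\<close> replaced by \<open>1 - P\<^sub>n, R, -s\<close>. The last determinant is multiplicative in \<open>\<phi>\<close>.
  Writing \<open>\<phi> = c z\<^sup>w exp g\<^sub>+ exp g\<^sub>-\<close>, the factors \<open>exp g\<^sub>+\<close> and \<open>exp g\<^sub>-\<close> have triangular matrices and
  contribute \<open>1\<close>, while \<open>c z\<^sup>w\<close> contributes \<open>(1 + s)\<^bsup>n + w\<^esup>\<close>.

  The hypothesis on \<open>\<phi>\<close> makes every matrix in sight absolutely summable over all entries, so a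
  principal minor is bounded by the product of its row sums, and Fredholm determinants are limits of
  finite ones by dominated convergence.\<close>

section \<open>Determinants of finite matrices\<close>

text \<open>The determinant is defined by principal minors in one fixed basis, so invariance under
  conjugation by \<open>T\<close> has to be proved: it comes from det(1 + XY) = det(1 + YX), shown
  on finite boxes and passed to the limit. This requires products of infinite matrices with
  exchangeable sums, hence a ring of matrices with bounded row and column sums, containing the
  absolutely summable matrices as an ideal. The weight |j| of the hypothesis is the number of
  entries equal to plus or minus the j-th coefficient in the commutator of \<open>T\<close> with
  P_0; it makes P_n - R absolutely summable. It also says that the angular derivative of
  \<open>\<phi>\<close> has an absolutely convergent Fourier series. Closure of this class under
  inverse and exponential then avoids Wiener's lemma: C^1 functions have absolutely summable
  coefficients by Bessel's inequality, and the formula for the derivative upgrades this to the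
  weighted condition. For s not 0 the operator 1 + s P_n is an infinite-rank perturbation of the
  identity and has no determinant of its own; only its multiplicative commutator with
  \<open>T\<close> has one. Excluding s = -1, and s = 1 in the second identity, makes the factor
  invertible.\<close>

lemma fin_det_eq_det:
  assumes h: "bij_betw h {0..<n} F"
  shows "fin_det F T = det (mat n n (\<lambda>(a, b). T (h a) (h b)))"
proof -
  have inj: "inj_on h {0..<n}" and F: "F = h ` {0..<n}"
    using h by (auto simp: bij_betw_def)
  let ?m = "map_permutation {0..<n} h"
  have "det (mat n n (\<lambda>(a, b). T (h a) (h b))) =
      (\<Sum>p\<in>{p. p permutes {0..<n}}. of_int (sign p) * (\<Prod>i = 0..<n. T (h i) (h (p i))))"
    unfolding det_def
    by (auto intro!: sum.cong prod.cong simp: permutes_in_image)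
  also have "\<dots> = (\<Sum>p\<in>{p. p permutes F}. of_int (sign p) * (\<Prod>i\<in>F. T i (p i)))"
  proof (rule sum.reindex_bij_witness[where j = ?m and i = "map_permutation F (inv_into {0..<n} h)"])
    fix p assume "p \<in> {p. p permutes {0..<n}}"
    then have p: "p permutes {0..<n}" by simp
    show "map_permutation F (inv_into {0..<n} h) (?m p) = p"
      by (rule map_permutation_compose_inv[OF h p]) (use inj in auto)
    show "?m p \<in> {p. p permutes F}"
      using map_permutation_permutes[OF h p] by simp
    have "(\<Prod>i\<in>F. T i (?m p i)) = (\<Prod>i\<in>{0..<n}. T (h i) (?m p (h i)))"
      unfolding F by (subst prod.reindex[OF inj]) simp
    also have "\<dots> = (\<Prod>i\<in>{0..<n}. T (h i) (h (p i)))"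
      by (intro prod.cong refl) (simp add: map_permutation_apply[OF inj])
    finally show "of_int (sign (?m p)) * (\<Prod>i\<in>F. T i (?m p i)) =
        of_int (sign p) * (\<Prod>i = 0..<n. T (h i) (h (p i)))"
      using sign_map_permutation[OF inj p] by simp
  next
    fix p assume "p \<in> {p. p permutes F}"
    then have p: "p permutes F" by simp
    have h': "bij_betw (inv_into {0..<n} h) F {0..<n}"
      by (rule bij_betw_inv_into[OF h])
    show "map_permutation F (inv_into {0..<n} h) p \<in> {p. p permutes {0..<n}}"
      using map_permutation_permutes[OF h' p] by simp
    show "?m (map_permutation F (inv_into {0..<n} h) p) = p"
      by (rule map_permutation_compose_inv[OF h' p]) (use inj F f_inv_into_f in auto)
  qed
  finally show ?thesis by (simp add: fin_det_def)
qed

lemma fin_det_mult: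
  assumes "finite F"
  shows "fin_det F (\<lambda>i j. \<Sum>k\<in>F. A i k * B k j) = fin_det F A * fin_det F B"
proof -
  obtain h where h: "bij_betw h {0..<card F} F"
    using ex_bij_betw_nat_finite[OF assms] by blast
  let ?M = "\<lambda>T. mat (card F) (card F) (\<lambda>(a, b). T (h a) (h b))"
  have "?M (\<lambda>i j. \<Sum>k\<in>F. A i k * B k j) = ?M A * ?M B"
    by (rule eq_matI) (auto simp: scalar_prod_def sum.reindex_bij_betw[OF h, symmetric])
  then show ?thesis
    unfolding fin_det_eq_det[OF h] by (simp add: det_mult[of _ "card F"])
qed

text \<open>Sylvester's identity: the block matrix \<open>?M\<close> with rows (1, X) and (-Y, 1)
  factors into block triangular matrices in two ways, one exposing 1 + YX on the diagonal and the
  other 1 + XY.\<close>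

lemma det_one_plus_mult_commute:
  fixes X Y :: "complex mat"
  assumes X: "X \<in> carrier_mat n n" and Y: "Y \<in> carrier_mat n n"
  shows "det (1\<^sub>m n + X * Y) = det (1\<^sub>m n + Y * X)"
proof -
  let ?I = "1\<^sub>m n :: complex mat" and ?Z = "0\<^sub>m n n :: complex mat"
  let ?M = "four_block_mat ?I X (- Y) ?I"
  have XY: "X * Y \<in> carrier_mat n n" "Y * X \<in> carrier_mat n n" "X * - Y \<in> carrier_mat n n"
    using X Y by auto
  have 1: "?M = four_block_mat ?I ?Z (- Y) ?I * four_block_mat ?I X ?Z (?I + Y * X)"
    using X Y by (subst mult_four_block_mat[of _ n n _ n _ n _ _ n _ n])
      (auto intro!: arg_cong2[where f = "four_block_mat _"] simp: add_uminus_minus_mat)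
  have 2: "?M = four_block_mat (?I + X * Y) X ?Z ?I * four_block_mat ?I ?Z (- Y) ?I"
    using X Y by (subst mult_four_block_mat[of _ n n _ n _ n _ _ n _ n]) auto
  have d: "det (four_block_mat ?I ?Z (- Y) ?I) = 1"
    using Y by (subst det_four_block_mat_upper_right_zero[of _ n]) auto
  have "det ?M = det (?I + Y * X)"
    unfolding 1 using X Y XY
    by (subst det_mult[of _ "n + n"]) (auto simp: d det_four_block_mat_lower_left_zero[of _ n])
  moreover have "det ?M = det (?I + X * Y)"
    unfolding 2 using X Y XY
    by (subst det_mult[of _ "n + n"]) (auto simp: d det_four_block_mat_lower_left_zero[of _ n])
  ultimately show ?thesis by simp
qed

lemma fin_det_one_plus_mult_commute:
  assumes "finite F"
  shows "fin_det F (\<lambda>i j. of_bool (i = j) + (\<Sum>k\<in>F. A i k * B k j)) =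
         fin_det F (\<lambda>i j. of_bool (i = j) + (\<Sum>k\<in>F. B i k * A k j))"
proof -
  obtain h where h: "bij_betw h {0..<card F} F"
    using ex_bij_betw_nat_finite[OF assms] by blast
  let ?M = "\<lambda>T. mat (card F) (card F) (\<lambda>(a, b). T (h a) (h b))"
  have inj: "h a = h b \<longleftrightarrow> a = b" if "a < card F" "b < card F" for a b
    using h that by (auto simp: bij_betw_def inj_on_def)
  have *: "?M (\<lambda>i j. of_bool (i = j) + (\<Sum>k\<in>F. A i k * B k j)) = 1\<^sub>m (card F) + ?M A * ?M B" for A B
    by (rule eq_matI) (auto simp: scalar_prod_def sum.reindex_bij_betw[OF h, symmetric] inj)
  show ?thesis
    unfolding fin_det_eq_det[OF h] * by (rule det_one_plus_mult_commute) auto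
qed

text \<open>Choosing \<open>T\<close> or the identity in each factor of the product gives a sum over
  subsets \<open>G\<close>; the identity factors force \<open>p\<close> to fix \<open>F - G\<close>,
  so \<open>p\<close> permutes \<open>G\<close>. This ties ordinary determinants of 1 + T to the sum
  of principal minors in \<open>fredholm_det\<close>.\<close>

lemma fin_det_one_plus:
  assumes F: "finite F"
  shows "fin_det F (\<lambda>i j. of_bool (i = j) + T i j) = (\<Sum>G\<in>Pow F. fin_det G T)"
proof -
  have fp: "finite {p. p permutes F}" by (rule finite_permutations[OF F])
  have "fin_det F (\<lambda>i j. of_bool (i = j) + T i j) =
      (\<Sum>p\<in>{p. p permutes F}. \<Sum>G\<in>Pow F. of_int (sign p) *
        ((\<Prod>i\<in>G. T i (p i)) * (\<Prod>i\<in>F - G. of_bool (i = p i))))"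
    unfolding fin_det_def
    by (simp add: add.commute[of "of_bool _"] prod_add[OF F] sum_distrib_left)
  also have "\<dots> = (\<Sum>G\<in>Pow F. \<Sum>p\<in>{p. p permutes F}. of_int (sign p) *
        ((\<Prod>i\<in>G. T i (p i)) * (\<Prod>i\<in>F - G. of_bool (i = p i))))"
    by (rule sum.swap)
  also have "\<dots> = (\<Sum>G\<in>Pow F. fin_det G T)"
  proof (rule sum.cong[OF refl])
    fix G assume G: "G \<in> Pow F"
    have "(\<Sum>p\<in>{p. p permutes G}. of_int (sign p) * (\<Prod>i\<in>G. T i (p i))) =
      (\<Sum>p\<in>{p. p permutes F}. of_int (sign p) *
        ((\<Prod>i\<in>G. T i (p i)) * (\<Prod>i\<in>F - G. of_bool (i = p i))))"
    proof (rule sum.mono_neutral_cong_left[OF fp])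
      show "{p. p permutes G} \<subseteq> {p. p permutes F}"
        using G by (auto intro: permutes_subset)
      show "\<forall>p\<in>{p. p permutes F} - {p. p permutes G}. of_int (sign p) *
        ((\<Prod>i\<in>G. T i (p i)) * (\<Prod>i\<in>F - G. of_bool (i = p i))) = 0"
      proof
        fix p assume "p \<in> {p. p permutes F} - {p. p permutes G}"
        then have p: "p permutes F" "\<not> p permutes G" by auto
        have "\<exists>i\<in>F - G. p i \<noteq> i"
        proof (rule ccontr)
          assume "\<not> (\<exists>i\<in>F - G. p i \<noteq> i)"
          then have "p permutes G"
            using permutes_superset[OF p(1)] by blast
          with p(2) show False by simp
        qed
        then obtain i where "i \<in> F - G" "p i \<noteq> i" by blast
        then have "(\<Prod>i\<in>F - G. of_bool (i = p i)) = (0::complex)"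
          using F by (intro prod_zero) (auto intro!: bexI[of _ i])
        then show "of_int (sign p) * ((\<Prod>i\<in>G. T i (p i)) * (\<Prod>i\<in>F - G. of_bool (i = p i))) = 0"
          by simp
      qed
      fix p assume "p \<in> {p. p permutes G}"
      then have "\<And>i. i \<notin> G \<Longrightarrow> p i = i" by (auto simp: permutes_def)
      then have "(\<Prod>i\<in>F - G. of_bool (i = p i)) = (1::complex)"
        by (intro prod.neutral) auto
      then show "of_int (sign p) * (\<Prod>i\<in>G. T i (p i)) =
        of_int (sign p) * ((\<Prod>i\<in>G. T i (p i)) * (\<Prod>i\<in>F - G. of_bool (i = p i)))"
        by simp
    qed
    then show "(\<Sum>p\<in>{p. p permutes F}. of_int (sign p) *
        ((\<Prod>i\<in>G. T i (p i)) * (\<Prod>i\<in>F - G. of_bool (i = p i)))) = fin_det G T"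
      by (simp add: fin_det_def)
  qed
  finally show ?thesis .
qed

lemma fin_det_cong:
  assumes "\<And>i j. i \<in> F \<Longrightarrow> j \<in> F \<Longrightarrow> A i j = B i j"
  shows "fin_det F A = fin_det F B"
  unfolding fin_det_def
  by (intro sum.cong refl arg_cong2[where f = "(*)"] prod.cong assms)
     (auto simp: permutes_in_image)

lemma fin_det_zero_row:
  assumes "finite F" "i \<in> F" "\<And>j. j \<in> F \<Longrightarrow> T i j = 0"
  shows "fin_det F T = 0"
proof -
  have "(\<Prod>i\<in>F. T i (p i)) = 0" if "p permutes F" for p
    using assms that by (intro prod_zero) (auto intro!: bexI[of _ i] simp: permutes_in_image)
  then show ?thesis by (simp add: fin_det_def)
qed

lemma fin_det_strictly_lower_triangular:
  assumes "finite F" "F \<noteq> {}" "\<And>i j. i \<le> j \<Longrightarrow> T i j = 0"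
  shows "fin_det F T = 0"
  by (rule fin_det_zero_row[OF assms(1) Min_in[OF assms(1,2)]])
     (use assms in auto)

lemma fin_det_strictly_upper_triangular:
  assumes "finite F" "F \<noteq> {}" "\<And>i j. j \<le> i \<Longrightarrow> T i j = 0"
  shows "fin_det F T = 0"
  by (rule fin_det_zero_row[OF assms(1) Max_in[OF assms(1,2)]])
     (use assms in auto)

text \<open>Permutations are among all maps from \<open>F\<close> to \<open>F\<close>, and the sum
  over all maps of the products of absolute entries factors into row sums. The bound is
  multiplicative in \<open>F\<close>, so it can be summed over all finite \<open>F\<close>.\<close>

lemma norm_fin_det_le:
  assumes F: "finite F" and r: "\<And>i. i \<in> F \<Longrightarrow> (\<Sum>j\<in>F. norm (T i j)) \<le> r i"
  shows "norm (fin_det F T) \<le> prod r F"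
proof -
  have fp: "finite {p. p permutes F}" by (rule finite_permutations[OF F])
  have "norm (fin_det F T) \<le> (\<Sum>p\<in>{p. p permutes F}. \<Prod>i\<in>F. norm (T i (p i)))"
    unfolding fin_det_def
    by (rule order.trans[OF norm_sum]) (auto intro!: sum_mono simp: norm_mult prod_norm sign_def)
  also have "\<dots> \<le> (\<Sum>p\<in>PiE F (\<lambda>_. F). \<Prod>i\<in>F. norm (T i (p i)))"
  proof -
    \<comment> \<open>Members of \<open>PiE\<close> are undefined outside \<open>F\<close>, whereas
      permutations are the identity there; hence the restriction.\<close>
    have inj: "inj_on (\<lambda>p. restrict p F) {p. p permutes F}"
    proof (rule inj_onI)
      fix p q assume pq: "p \<in> {p. p permutes F}" "q \<in> {p. p permutes F}" "restrict p F = restrict q F"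
      show "p = q"
      proof
        fix x show "p x = q x"
          using pq(1,2) fun_cong[OF pq(3), of x] by (cases "x \<in> F") (auto simp: permutes_def)
      qed
    qed
    have "(\<Sum>p\<in>{p. p permutes F}. \<Prod>i\<in>F. norm (T i (p i))) =
        (\<Sum>p\<in>(\<lambda>p. restrict p F) ` {p. p permutes F}. \<Prod>i\<in>F. norm (T i (p i)))"
      by (subst sum.reindex[OF inj]) simp
    also have "\<dots> \<le> (\<Sum>p\<in>PiE F (\<lambda>_. F). \<Prod>i\<in>F. norm (T i (p i)))"
      by (intro sum_mono2 finite_PiE F prod_nonneg) (auto simp: permutes_in_image)
    finally show ?thesis .
  qed
  also have "\<dots> = (\<Prod>i\<in>F. \<Sum>j\<in>F. norm (T i j))"
    by (rule prod_sum_PiE[symmetric]) (use F in auto)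
  also have "\<dots> \<le> prod r F"
    by (intro prod_mono) (auto intro: sum_nonneg r)
  finally show ?thesis .
qed

section \<open>Matrices with absolutely summable rows and columns\<close>

no_notation Infinite_Set_Sum.abs_summable_on (infix "abs'_summable'_on" 50)

lemma has_sum_finite_sum:
  fixes f :: "'i \<Rightarrow> 'a \<Rightarrow> 'b::topological_comm_monoid_add"
  assumes "finite F" "\<And>j. j \<in> F \<Longrightarrow> (f j has_sum s j) A"
  shows "((\<lambda>k. \<Sum>j\<in>F. f j k) has_sum (\<Sum>j\<in>F. s j)) A"
  using assms
proof (induction F)
  case (insert x F)
  have "((\<lambda>k. f x k + (\<Sum>j\<in>F. f j k)) has_sum (s x + (\<Sum>j\<in>F. s j))) A"
    by (rule has_sum_add) (use insert in auto)
  with insert.hyps show ?case by simp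
qed simp

text \<open>Finite partial sums are bounded because the \<open>infsum\<close> of a divergent row
  would be 0 and would pass any nonnegative bound.\<close>

definition row_bounded :: "real \<Rightarrow> (int \<Rightarrow> int \<Rightarrow> complex) \<Rightarrow> bool" where
  "row_bounded c A \<longleftrightarrow> (\<forall>i F. finite F \<longrightarrow> (\<Sum>j\<in>F. norm (A i j)) \<le> c)"

definition infmat_mult :: "(int \<Rightarrow> int \<Rightarrow> complex) \<Rightarrow> (int \<Rightarrow> int \<Rightarrow> complex) \<Rightarrow> int \<Rightarrow> int \<Rightarrow> complex" where
  "infmat_mult A B i j = (\<Sum>\<^sub>\<infinity>k. A i k * B k j)"

lemma row_bounded_nonneg: "row_bounded c A \<Longrightarrow> 0 \<le> c"
  unfolding row_bounded_def by (drule spec, drule spec[of _ "{}"]) simp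

lemma row_boundedD: "row_bounded c A \<Longrightarrow> finite F \<Longrightarrow> (\<Sum>j\<in>F. norm (A i j)) \<le> c"
  by (auto simp: row_bounded_def)

lemma row_bounded_entry: "row_bounded c A \<Longrightarrow> norm (A i j) \<le> c"
  using row_boundedD[of c A "{j}" i] by simp

lemma abs_summable_bounded_sums:
  fixes u :: "'a \<Rightarrow> 'b::banach"
  assumes "\<And>F. finite F \<Longrightarrow> (\<Sum>k\<in>F. norm (u k)) \<le> c"
  shows "u abs_summable_on UNIV" "(\<Sum>\<^sub>\<infinity>k. norm (u k)) \<le> c"
proof -
  show 1: "u abs_summable_on UNIV"
    by (rule nonneg_bdd_above_summable_on) (use assms in \<open>auto intro: bdd_aboveI[of _ c]\<close>)
  show "(\<Sum>\<^sub>\<infinity>k. norm (u k)) \<le> c"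
    by (rule infsum_le_finite_sums[OF 1]) (use assms in auto)
qed

lemma abs_summable_mult_bounded:
  fixes u v :: "'a \<Rightarrow> complex"
  assumes "u abs_summable_on A" "\<And>k. k \<in> A \<Longrightarrow> norm (v k) \<le> c"
  shows "(\<lambda>k. u k * v k) abs_summable_on A"
proof (rule Infinite_Sum.abs_summable_on_comparison_test'[where g = "\<lambda>k. norm (u k) * c"])
  show "(\<lambda>k. norm (u k) * c) summable_on A"
    by (rule summable_on_cmult_left[OF assms(1)])
  show "norm (u k * v k) \<le> norm (u k) * c" if "k \<in> A" for k
    using assms(2)[OF that] by (simp add: norm_mult mult_left_mono)
qed

text \<open>The finite sum over \<open>j\<close> is exchanged with the sum over \<open>k\<close>.
  The same estimate serves bounded rows, dominated rows and convolutions.\<close>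

lemma sum_norm_row_mult_le:
  fixes u :: "'a \<Rightarrow> complex" and B :: "'a \<Rightarrow> 'b \<Rightarrow> complex"
  assumes u: "\<And>F. finite F \<Longrightarrow> (\<Sum>k\<in>F. norm (u k)) \<le> r"
    and B: "\<And>k F. finite F \<Longrightarrow> (\<Sum>j\<in>F. norm (B k j)) \<le> d"
    and F: "finite F"
  shows "(\<Sum>j\<in>F. norm (\<Sum>\<^sub>\<infinity>k. u k * B k j)) \<le> r * d"
proof -
  note us = abs_summable_bounded_sums[OF u]
  have Be: "norm (B k j) \<le> d" for k j using B[of "{j}" k] by simp
  have d: "0 \<le> d" using B[of "{}"] by simp
  have s: "(\<lambda>k. u k * B k j) abs_summable_on UNIV" for j
    by (rule abs_summable_mult_bounded[OF us(1) Be])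
  have sF: "((\<lambda>k. \<Sum>j\<in>F. norm (u k * B k j)) has_sum (\<Sum>j\<in>F. \<Sum>\<^sub>\<infinity>k. norm (u k * B k j))) UNIV"
    by (intro has_sum_finite_sum F has_sum_infsum s)
  have "(\<Sum>j\<in>F. norm (\<Sum>\<^sub>\<infinity>k. u k * B k j)) \<le> (\<Sum>j\<in>F. \<Sum>\<^sub>\<infinity>k. norm (u k * B k j))"
    by (intro sum_mono norm_infsum_bound s)
  also have "\<dots> = (\<Sum>\<^sub>\<infinity>k. \<Sum>j\<in>F. norm (u k * B k j))"
    using sF by (rule infsumI[symmetric])
  also have "\<dots> = (\<Sum>\<^sub>\<infinity>k. norm (u k) * (\<Sum>j\<in>F. norm (B k j)))"
    by (simp add: norm_mult sum_distrib_left)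
  also have "\<dots> \<le> (\<Sum>\<^sub>\<infinity>k. norm (u k) * d)"
  proof (rule infsum_mono)
    show "(\<lambda>k. norm (u k) * d) summable_on UNIV"
      by (intro summable_on_cmult_left us)
    show "(\<lambda>k. norm (u k) * (\<Sum>j\<in>F. norm (B k j))) summable_on UNIV"
      unfolding sum_distrib_left norm_mult[symmetric]
      using sF by (rule has_sum_imp_summable)
  qed (intro mult_left_mono B F, simp)
  also have "\<dots> = (\<Sum>\<^sub>\<infinity>k. norm (u k)) * d"
    by (intro infsum_cmult_left us)
  also have "\<dots> \<le> r * d"
    by (intro mult_right_mono us d)
  finally show ?thesis .
qed

lemma row_bounded_infmat_mult:
  assumes "row_bounded c A" "row_bounded d B"
  shows "row_bounded (c * d) (infmat_mult A B)"
  unfolding row_bounded_def infmat_mult_def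
  by (intro allI impI sum_norm_row_mult_le row_boundedD[OF assms(1)] row_boundedD[OF assms(2)])

lemma row_bounded_add:
  assumes "row_bounded c A" "row_bounded d B"
  shows "row_bounded (c + d) (\<lambda>i j. A i j + B i j)"
  unfolding row_bounded_def
proof (intro allI impI)
  fix i and F :: "int set" assume F: "finite F"
  have "(\<Sum>j\<in>F. norm (A i j + B i j)) \<le> (\<Sum>j\<in>F. norm (A i j) + norm (B i j))"
    by (intro sum_mono norm_triangle_ineq)
  also have "\<dots> \<le> c + d"
    unfolding sum.distrib by (intro add_mono row_boundedD[OF assms(1)] row_boundedD[OF assms(2)] F)
  finally show "(\<Sum>j\<in>F. norm (A i j + B i j)) \<le> c + d" .
qed

lemma row_bounded_diagonal:
  assumes "\<And>i. norm (d i) \<le> c"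
  shows "row_bounded c (\<lambda>i j. if i = j then d i else 0)"
    and "row_bounded c (\<lambda>i j. if j = i then d j else 0)"
proof -
  have c: "0 \<le> c" using order.trans[OF norm_ge_zero assms[of 0]] .
  have *: "row_bounded c D" if D: "\<And>i j. norm (D i j) = (if i = j then norm (d i) else 0)" for D
    unfolding row_bounded_def D using assms c by simp
  show "row_bounded c (\<lambda>i j. if i = j then d i else 0)" "row_bounded c (\<lambda>i j. if j = i then d j else 0)"
    by (rule *, simp)+
qed

lemma infmat_mult_transpose:
  "(\<lambda>i j. infmat_mult A B j i) = infmat_mult (\<lambda>i j. B j i) (\<lambda>i j. A j i)"
  by (simp add: infmat_mult_def mult.commute fun_eq_iff)

text \<open>Matrices with uniformly bounded \<open>\<ell>\<^sup>1\<close>-norms of rows and columns; by Schur's test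
  they act boundedly on \<open>\<ell>\<^sup>2(\<int>)\<close>.\<close>

typedef bmat = "{A :: int \<Rightarrow> int \<Rightarrow> complex. \<exists>c. row_bounded c A \<and> row_bounded c (\<lambda>i j. A j i)}"
  morphisms entry Bmat
proof (rule exI, rule CollectI, rule exI, rule conjI)
  show "row_bounded 0 (\<lambda>_ _. 0)" "row_bounded 0 (\<lambda>_ _. 0)" by (simp_all add: row_bounded_def)
qed

setup_lifting type_definition_bmat

lemma row_bounded_mono: "row_bounded c A \<Longrightarrow> c \<le> d \<Longrightarrow> row_bounded d A"
  unfolding row_bounded_def by (meson order.trans)

lemma bmatI:
  assumes "row_bounded c A" "row_bounded d (\<lambda>i j. A j i)"
  shows "\<exists>c. row_bounded c A \<and> row_bounded c (\<lambda>i j. A j i)"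
  using row_bounded_mono[OF assms(1), of "max c d"] row_bounded_mono[OF assms(2), of "max c d"] by auto

lemma bmat_bounded:
  obtains c where "row_bounded c (entry X)" "row_bounded c (\<lambda>i j. entry X j i)"
  using entry[of X] by auto

lemma summable_bmat_mult: "(\<lambda>k. entry X i k * entry Y k j) abs_summable_on UNIV"
proof -
  obtain c where c: "row_bounded c (entry X)" by (rule bmat_bounded)
  obtain d where d: "row_bounded d (entry Y)" by (rule bmat_bounded)
  show ?thesis
    by (rule abs_summable_mult_bounded[OF abs_summable_bounded_sums(1)[OF row_boundedD[OF c]]])
       (auto intro: row_bounded_entry[OF d])
qed

lemma infsum_single:
  fixes f :: "'a \<Rightarrow> 'b::{comm_monoid_add, t2_space}"
  assumes "\<And>k. k \<noteq> i \<Longrightarrow> f k = 0"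
  shows "infsum f UNIV = f i"
proof -
  have "infsum f UNIV = infsum f {i}"
    by (rule infsum_cong_neutral) (use assms in auto)
  then show ?thesis by simp
qed

lemma bmat_eqI: "(\<And>i j. entry X i j = entry Y i j) \<Longrightarrow> X = Y"
  by (simp add: entry_inject[symmetric] fun_eq_iff)

text \<open>With infinite matrix products as ring multiplication, operator identities become ring
  rewriting. The analytic part is associativity: the family over pairs (l, k) is absolutely summable
  because the rows of \<open>A\<close> and \<open>B\<close> have bounded sums and the entries of
  \<open>C\<close> are bounded.\<close>

instantiation bmat :: ring_1
begin

lift_definition zero_bmat :: bmat is "\<lambda>_ _. 0"
  by (rule exI[of _ 0]) (simp add: row_bounded_def)

lift_definition one_bmat :: bmat is "\<lambda>i j. if i = j then 1 else 0"
  by (intro exI[of _ 1] conjI row_bounded_diagonal) auto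

lift_definition plus_bmat :: "bmat \<Rightarrow> bmat \<Rightarrow> bmat" is "\<lambda>A B i j. A i j + B i j"
proof -
  fix A B :: "int \<Rightarrow> int \<Rightarrow> complex"
  assume "\<exists>c. row_bounded c A \<and> row_bounded c (\<lambda>i j. A j i)"
    and "\<exists>c. row_bounded c B \<and> row_bounded c (\<lambda>i j. B j i)"
  then obtain c d where "row_bounded c A" "row_bounded c (\<lambda>i j. A j i)"
    and "row_bounded d B" "row_bounded d (\<lambda>i j. B j i)" by blast
  then show "\<exists>c. row_bounded c (\<lambda>i j. A i j + B i j) \<and> row_bounded c (\<lambda>i j. A j i + B j i)"
    by (intro exI[of _ "c + d"] conjI row_bounded_add)
qed

lift_definition uminus_bmat :: "bmat \<Rightarrow> bmat" is "\<lambda>A i j. - A i j"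
  by (simp add: row_bounded_def)

lift_definition times_bmat :: "bmat \<Rightarrow> bmat \<Rightarrow> bmat" is infmat_mult
proof -
  fix A B :: "int \<Rightarrow> int \<Rightarrow> complex"
  assume "\<exists>c. row_bounded c A \<and> row_bounded c (\<lambda>i j. A j i)"
    and "\<exists>c. row_bounded c B \<and> row_bounded c (\<lambda>i j. B j i)"
  then obtain c d where "row_bounded c A" "row_bounded c (\<lambda>i j. A j i)"
    and "row_bounded d B" "row_bounded d (\<lambda>i j. B j i)" by blast
  then show "\<exists>c. row_bounded c (infmat_mult A B) \<and> row_bounded c (\<lambda>i j. infmat_mult A B j i)"
    by (intro bmatI[of "c * d" _ "d * c"]) (simp_all add: infmat_mult_transpose row_bounded_infmat_mult)
qed

definition minus_bmat :: "bmat \<Rightarrow> bmat \<Rightarrow> bmat" where "minus_bmat A B = A + - B"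

instance
proof
  fix A B C :: bmat
  have s: "(\<lambda>k. entry X i k * entry Y k j) summable_on UNIV" for X Y i j
    by (rule abs_summable_summable[OF summable_bmat_mult])
  show "A * B * C = A * (B * C)"
  proof (rule bmat_eqI)
    fix i j
    obtain a where a: "row_bounded a (entry A)" by (rule bmat_bounded)
    obtain b where b: "row_bounded b (entry B)" by (rule bmat_bounded)
    obtain c where c: "row_bounded c (entry C)" by (rule bmat_bounded)
    have as: "entry A i abs_summable_on UNIV"
      by (rule abs_summable_bounded_sums(1)[OF row_boundedD[OF a]])
    have bs: "(\<lambda>k. entry B l k * entry C k j) abs_summable_on UNIV" for l
      by (rule summable_bmat_mult)
    have bc: "(\<Sum>\<^sub>\<infinity>k. norm (entry B l k * entry C k j)) \<le> b * c" for l
    proof (rule abs_summable_bounded_sums(2))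
      fix F :: "int set" assume "finite F"
      have "(\<Sum>k\<in>F. norm (entry B l k * entry C k j)) \<le> (\<Sum>k\<in>F. norm (entry B l k) * c)"
        by (intro sum_mono) (auto simp: norm_mult intro!: mult_left_mono row_bounded_entry[OF c])
      also have "\<dots> \<le> b * c"
        unfolding sum_distrib_right[symmetric]
        by (intro mult_right_mono row_boundedD[OF b] row_bounded_nonneg[OF c] \<open>finite F\<close>)
      finally show "(\<Sum>k\<in>F. norm (entry B l k * entry C k j)) \<le> b * c" .
    qed
    have "(\<lambda>(l, k). entry A i l * entry B l k * entry C k j) abs_summable_on UNIV \<times> UNIV"
      unfolding Infinite_Sum.abs_summable_on_Sigma_iff
    proof (intro conjI ballI)
      show "(\<lambda>k. case (l, k) of (l, k) \<Rightarrow> entry A i l * entry B l k * entry C k j) abs_summable_on UNIV" for l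
        using summable_on_cmult_right[OF bs, of "norm (entry A i l)" l]
        by (simp add: norm_mult mult.assoc)
      show "(\<lambda>l. \<Sum>\<^sub>\<infinity>k. norm (case (l, k) of (l, k) \<Rightarrow> entry A i l * entry B l k * entry C k j)) abs_summable_on UNIV"
      proof (rule Infinite_Sum.abs_summable_on_comparison_test'[where g = "\<lambda>l. norm (entry A i l) * (b * c)"])
        show "(\<lambda>l. norm (entry A i l) * (b * c)) summable_on UNIV"
          by (intro summable_on_cmult_left as)
        fix l
        have "(\<Sum>\<^sub>\<infinity>k. norm (entry A i l * entry B l k * entry C k j)) =
            norm (entry A i l) * (\<Sum>\<^sub>\<infinity>k. norm (entry B l k * entry C k j))"
          by (subst infsum_cmult_right[symmetric]) (use bs in \<open>auto simp: norm_mult mult.assoc\<close>)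
        then show "norm (\<Sum>\<^sub>\<infinity>k. norm (case (l, k) of (l, k) \<Rightarrow> entry A i l * entry B l k * entry C k j))
            \<le> norm (entry A i l) * (b * c)"
          using bc[of l] by (simp add: infsum_nonneg mult_left_mono)
      qed
    qed
    then have sw: "(\<lambda>(l, k). entry A i l * entry B l k * entry C k j) summable_on UNIV \<times> UNIV"
      by (rule abs_summable_summable)
    have "entry (A * B * C) i j = (\<Sum>\<^sub>\<infinity>k. (\<Sum>\<^sub>\<infinity>l. entry A i l * entry B l k) * entry C k j)"
      by (simp add: times_bmat.rep_eq infmat_mult_def)
    also have "\<dots> = (\<Sum>\<^sub>\<infinity>k. \<Sum>\<^sub>\<infinity>l. entry A i l * entry B l k * entry C k j)"
      by (intro infsum_cong infsum_cmult_left[symmetric] s)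
    also have "\<dots> = (\<Sum>\<^sub>\<infinity>l. \<Sum>\<^sub>\<infinity>k. entry A i l * entry B l k * entry C k j)"
      by (rule infsum_swap_banach[symmetric]) (use sw in simp)
    also have "\<dots> = (\<Sum>\<^sub>\<infinity>l. entry A i l * (\<Sum>\<^sub>\<infinity>k. entry B l k * entry C k j))"
      unfolding mult.assoc by (intro infsum_cong infsum_cmult_right s)
    also have "\<dots> = entry (A * (B * C)) i j"
      by (simp add: times_bmat.rep_eq infmat_mult_def)
    finally show "entry (A * B * C) i j = entry (A * (B * C)) i j" .
  qed
  have single: "infsum f UNIV = f i" if "\<And>k. k \<noteq> i \<Longrightarrow> f k = 0" for f :: "int \<Rightarrow> complex" and i
    by (rule infsum_single) (rule that)
  show "1 * A = A"
  proof (rule bmat_eqI)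
    fix i j
    show "entry (1 * A) i j = entry A i j"
      unfolding times_bmat.rep_eq one_bmat.rep_eq infmat_mult_def
      by (subst single[of i]) simp_all
  qed
  show "A * 1 = A"
  proof (rule bmat_eqI)
    fix i j
    show "entry (A * 1) i j = entry A i j"
      unfolding times_bmat.rep_eq one_bmat.rep_eq infmat_mult_def
      by (subst single[of j]) simp_all
  qed
  show "(A + B) * C = A * C + B * C"
  proof (rule bmat_eqI)
    fix i j
    show "entry ((A + B) * C) i j = entry (A * C + B * C) i j"
      unfolding times_bmat.rep_eq plus_bmat.rep_eq infmat_mult_def distrib_right
      by (rule infsum_add[OF s s])
  qed
  show "A * (B + C) = A * B + A * C"
  proof (rule bmat_eqI)
    fix i j
    show "entry (A * (B + C)) i j = entry (A * B + A * C) i j"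
      unfolding times_bmat.rep_eq plus_bmat.rep_eq infmat_mult_def distrib_left
      by (rule infsum_add[OF s s])
  qed
  show "A + B + C = A + (B + C)" "A + B = B + A"
    by (rule bmat_eqI, simp add: plus_bmat.rep_eq)+
  show "0 + A = A"
    by (rule bmat_eqI) (simp add: plus_bmat.rep_eq zero_bmat.rep_eq)
  show "- A + A = 0"
    by (rule bmat_eqI) (simp add: plus_bmat.rep_eq zero_bmat.rep_eq uminus_bmat.rep_eq)
  show "A - B = A + - B" by (fact minus_bmat_def)
  have "entry 0 0 0 \<noteq> entry 1 0 0" by (simp add: zero_bmat.rep_eq one_bmat.rep_eq)
  then show "(0::bmat) \<noteq> 1" by auto
qed

end

lemma entry_simps [simp]:
  "entry 0 i j = 0" "entry 1 i j = of_bool (i = j)"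
  "entry (X + Y) i j = entry X i j + entry Y i j"
  "entry (- X) i j = - entry X i j"
  by (simp_all add: zero_bmat.rep_eq one_bmat.rep_eq plus_bmat.rep_eq uminus_bmat.rep_eq)

lemma entry_diff [simp]: "entry (X - Y) i j = entry X i j - entry Y i j"
  unfolding minus_bmat_def entry_simps by simp

lemma entry_mult: "entry (X * Y) i j = (\<Sum>\<^sub>\<infinity>k. entry X i k * entry Y k j)"
  by (simp add: times_bmat.rep_eq infmat_mult_def)

text \<open>One family covers the diagonal matrices of the argument: \<open>step_mat 1 0 n\<close>
  is the projection P_n, \<open>step_mat 0 1 n\<close> is 1 - P_n,
  \<open>step_mat (1 + s) 1 n\<close> is 1 + s P_n, and \<open>step_mat c c n\<close> is the scalar
  c.\<close>

lift_definition step_mat :: "complex \<Rightarrow> complex \<Rightarrow> int \<Rightarrow> bmat"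
  is "\<lambda>p q n i j. if i = j then if n \<le> i then p else q else 0"
proof -
  fix p q :: complex and n :: int
  show "\<exists>c. row_bounded c (\<lambda>i j. if i = j then if n \<le> i then p else q else 0) \<and>
      row_bounded c (\<lambda>i j. if j = i then if n \<le> j then p else q else 0)"
    by (intro exI[of _ "max (norm p) (norm q)"] conjI row_bounded_diagonal) auto
qed

lemma entry_step_mat: "entry (step_mat p q n) i j = (if i = j then if n \<le> i then p else q else 0)"
  by (simp add: step_mat.rep_eq)

lemma entry_step_mat_mult: "entry (step_mat p q n * X) i j = (if n \<le> i then p else q) * entry X i j"
proof -
  have "(\<Sum>\<^sub>\<infinity>k. entry (step_mat p q n) i k * entry X k j) =
      (\<Sum>\<^sub>\<infinity>k\<in>{i}. (if n \<le> i then p else q) * entry X k j)"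
    by (rule infsum_cong_neutral) (auto simp: entry_step_mat)
  then show ?thesis by (simp add: entry_mult)
qed

lemma entry_mult_step_mat: "entry (X * step_mat p q n) i j = entry X i j * (if n \<le> j then p else q)"
proof -
  have "(\<Sum>\<^sub>\<infinity>k. entry X i k * entry (step_mat p q n) k j) =
      (\<Sum>\<^sub>\<infinity>k\<in>{j}. entry X i k * (if n \<le> j then p else q))"
    by (rule infsum_cong_neutral) (auto simp: entry_step_mat)
  then show ?thesis by (simp add: entry_mult)
qed

lemma step_mat_mult: "step_mat p q n * step_mat p' q' n = step_mat (p * p') (q * q') n"
  by (rule bmat_eqI) (auto simp: entry_step_mat entry_step_mat_mult)

lemma step_mat_1: "step_mat 1 1 n = 1"
  by (rule bmat_eqI) (simp add: entry_step_mat)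

text \<open>Stronger than trace class and dependent on the basis, but a two-sided ideal of
  \<open>bmat\<close> whose members carry summable row sums, the explicit majorants for all
  minors.\<close>

definition nuclear :: "bmat \<Rightarrow> bool" where
  "nuclear X \<longleftrightarrow> (\<lambda>(i, j). norm (entry X i j)) summable_on UNIV"

definition row_dominated :: "(int \<Rightarrow> real) \<Rightarrow> (int \<Rightarrow> int \<Rightarrow> complex) \<Rightarrow> bool" where
  "row_dominated r T \<longleftrightarrow> (\<forall>i F. finite F \<longrightarrow> (\<Sum>j\<in>F. norm (T i j)) \<le> r i)"

lemma row_dominatedD: "row_dominated r T \<Longrightarrow> finite F \<Longrightarrow> (\<Sum>j\<in>F. norm (T i j)) \<le> r i"
  by (auto simp: row_dominated_def)

lemma row_dominated_nonneg: "row_dominated r T \<Longrightarrow> 0 \<le> r i"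
  using row_dominatedD[of r T "{}"] by simp

lemma abs_summable_row_dominated:
  assumes T: "row_dominated r T" and r: "r summable_on UNIV"
  shows "(\<lambda>(i, j). norm (T i j)) summable_on UNIV"
proof -
  have s: "(\<lambda>j. norm (T i j)) summable_on UNIV" "(\<Sum>\<^sub>\<infinity>j. norm (T i j)) \<le> r i" for i
    using abs_summable_bounded_sums[OF row_dominatedD[OF T]] by auto
  have "(\<lambda>(i, j). norm (T i j)) summable_on UNIV \<times> UNIV"
  proof (rule summable_on_SigmaI[where g = "\<lambda>i. \<Sum>\<^sub>\<infinity>j. norm (T i j)"])
    show "(\<lambda>i. \<Sum>\<^sub>\<infinity>j. norm (T i j)) summable_on UNIV"
      by (rule summable_on_comparison_test[OF r]) (use s in \<open>auto simp: infsum_nonneg\<close>)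
  qed (use s in auto)
  then show ?thesis by simp
qed

lemma row_dominated_abs_summable:
  assumes "(\<lambda>(i, j). norm (T i j)) summable_on UNIV"
  obtains r where "row_dominated r T" "r summable_on UNIV"
proof
  have s: "(\<lambda>(i, j). norm (T i j)) summable_on UNIV \<times> UNIV" using assms by simp
  have si: "(\<lambda>j. norm (T i j)) summable_on UNIV" for i
    using summable_on_SigmaD1[OF s, of i] by simp
  show "(\<lambda>i. \<Sum>\<^sub>\<infinity>j. norm (T i j)) summable_on UNIV"
    using summable_on_SigmaD[OF s] si by simp
  show "row_dominated (\<lambda>i. \<Sum>\<^sub>\<infinity>j. norm (T i j)) T"
    unfolding row_dominated_def by (auto intro!: finite_sum_le_infsum si)
qed

lemma nuclear_row_dominated:
  assumes "nuclear X"
  obtains r where "row_dominated r (entry X)" "r summable_on UNIV"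
  using assms row_dominated_abs_summable unfolding nuclear_def by blast

lemma nuclearI: "row_dominated r (entry X) \<Longrightarrow> r summable_on UNIV \<Longrightarrow> nuclear X"
  unfolding nuclear_def by (rule abs_summable_row_dominated)

lemma nuclear_add:
  assumes "nuclear X" "nuclear Y"
  shows "nuclear (X + Y)"
proof -
  have "(\<lambda>p. norm (entry X (fst p) (snd p)) + norm (entry Y (fst p) (snd p))) summable_on UNIV"
    using summable_on_add[OF assms[unfolded nuclear_def case_prod_unfold]] .
  then show ?thesis
    unfolding nuclear_def case_prod_unfold
    by (rule summable_on_comparison_test) (auto intro: norm_triangle_ineq)
qed

lemma nuclear_uminus: "nuclear (- X) \<longleftrightarrow> nuclear X"
  by (simp add: nuclear_def case_prod_unfold)

lemma row_dominated_mult: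
  assumes "row_dominated r (entry X)" "row_bounded c (entry Y)"
  shows "row_dominated (\<lambda>i. r i * c) (entry (X * Y))"
  unfolding row_dominated_def entry_mult
  by (intro allI impI sum_norm_row_mult_le row_dominatedD[OF assms(1)] row_boundedD[OF assms(2)])

lemma nuclear_mult_right:
  assumes "nuclear X" shows "nuclear (X * Y)"
proof -
  obtain r where r: "row_dominated r (entry X)" "r summable_on UNIV"
    using assms by (rule nuclear_row_dominated)
  obtain c where c: "row_bounded c (entry Y)" by (rule bmat_bounded)
  show ?thesis
    by (rule nuclearI[OF row_dominated_mult[OF r(1) c]]) (intro summable_on_cmult_left r)
qed

lift_definition transp :: "bmat \<Rightarrow> bmat" is "\<lambda>A i j. A j i" by auto

lemma entry_transp [simp]: "entry (transp X) i j = entry X j i"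
  by (simp add: transp.rep_eq)

lemma transp_mult: "transp (X * Y) = transp Y * transp X"
  by (rule bmat_eqI) (simp add: entry_mult mult.commute)

lemma nuclear_transp: "nuclear (transp X) \<longleftrightarrow> nuclear X"
proof -
  have "(\<lambda>(i, j). norm (entry X i j)) summable_on UNIV \<times> UNIV \<longleftrightarrow>
      (\<lambda>(i, j). norm (entry X j i)) summable_on UNIV \<times> UNIV"
    by (subst summable_on_swap) (simp add: case_prod_unfold)
  then show ?thesis by (simp add: nuclear_def)
qed

lemma nuclear_mult_left: "nuclear X \<Longrightarrow> nuclear (Y * X)"
  by (metis nuclear_mult_right nuclear_transp transp_mult)

section \<open>Determinants of nuclear perturbations of the identity\<close>

lemma fin_det_transpose:
  assumes "finite F"
  shows "fin_det F (\<lambda>i j. T j i) = fin_det F T"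
proof -
  obtain h where h: "bij_betw h {0..<card F} F"
    using ex_bij_betw_nat_finite[OF assms] by blast
  let ?M = "\<lambda>T. mat (card F) (card F) (\<lambda>(a, b). T (h a) (h b))"
  have "?M (\<lambda>i j. T j i) = transpose_mat (?M T)"
    by (rule eq_matI) auto
  then show ?thesis
    unfolding fin_det_eq_det[OF h] by (simp add: det_transpose[of _ "card F"])
qed

lemma fredholm_det_transpose: "fredholm_det I (\<lambda>i j. T j i) = fredholm_det I T"
  unfolding fredholm_det_def by (rule infsum_cong, rule fin_det_transpose) simp

lemma fredholm_det_cong:
  assumes "\<And>i j. i \<in> I \<Longrightarrow> j \<in> I \<Longrightarrow> A i j = B i j"
  shows "fredholm_det I A = fredholm_det I B"
  unfolding fredholm_det_def by (intro infsum_cong fin_det_cong assms) auto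

text \<open>A minor containing an index outside \<open>J\<close> has a zero row. This passes from
  operators on all integers to their compressions to a half-line or a box.\<close>

lemma fredholm_det_zero_rows:
  assumes "J \<subseteq> I" "\<And>i j. i \<in> I - J \<Longrightarrow> T i j = 0"
  shows "fredholm_det I T = fredholm_det J T"
  unfolding fredholm_det_def
proof (rule infsum_cong_neutral)
  fix F assume "F \<in> {F. finite F \<and> F \<subseteq> I} - {F. finite F \<and> F \<subseteq> J}"
  then obtain i where "finite F" "i \<in> F" "i \<in> I - J" by auto
  then show "fin_det F T = 0"
    using assms(2) by (intro fin_det_zero_row)
qed (use assms(1) in auto)

lemma fredholm_det_finite:
  assumes "finite F"
  shows "fredholm_det F T = fin_det F (\<lambda>i j. of_bool (i = j) + T i j)"
proof -
  have "{G. finite G \<and> G \<subseteq> F} = Pow F" using assms finite_subset by auto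
  then show ?thesis
    by (simp add: fredholm_det_def fin_det_one_plus[OF assms] assms)
qed

text \<open>Enlarging \<open>X\<close> to all subsets of its union turns the sum into the product of
  the factors \<open>r i + 1\<close>, each at most \<open>exp (r i)\<close>.\<close>

lemma sum_prod_le_exp:
  fixes r :: "int \<Rightarrow> real"
  assumes r: "r summable_on UNIV" "\<And>i. 0 \<le> r i" and X: "finite X" "\<And>F. F \<in> X \<Longrightarrow> finite F"
  shows "(\<Sum>F\<in>X. prod r F) \<le> exp (infsum r UNIV)"
proof -
  have U: "finite (\<Union>X)" using X by auto
  have "(\<Sum>F\<in>X. prod r F) \<le> (\<Sum>F\<in>Pow (\<Union>X). prod r F)"
    by (rule sum_mono2) (use U r in \<open>auto intro: prod_nonneg\<close>)
  also have "\<dots> = (\<Prod>i\<in>\<Union>X. r i + 1)"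
    by (simp add: prod_add[OF U])
  also have "\<dots> \<le> (\<Prod>i\<in>\<Union>X. exp (r i))"
    by (rule prod_mono) (use r in \<open>auto simp: add.commute intro: exp_ge_add_one_self add_nonneg_nonneg\<close>)
  also have "\<dots> = exp (\<Sum>i\<in>\<Union>X. r i)"
    by (rule exp_sum[OF U, symmetric])
  also have "(\<Sum>i\<in>\<Union>X. r i) \<le> infsum r UNIV"
    by (rule finite_sum_le_infsum) (use r U in auto)
  finally show ?thesis by simp
qed

lemma summable_on_prod:
  fixes r :: "int \<Rightarrow> real"
  assumes "r summable_on UNIV" "\<And>i. 0 \<le> r i"
  shows "prod r summable_on {F. finite F \<and> F \<subseteq> I}"
proof (rule nonneg_bdd_above_summable_on)
  show "bdd_above (sum (prod r) ` {X. X \<subseteq> {F. finite F \<and> F \<subseteq> I} \<and> finite X})"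
    by (rule bdd_aboveI[of _ "exp (infsum r UNIV)"]) (use sum_prod_le_exp[OF assms] in auto)
qed (use assms in \<open>auto intro: prod_nonneg\<close>)

lemma row_dominated_LIMSEQ:
  assumes T: "\<And>N. row_dominated r (T N)" and lim: "\<And>i j. (\<lambda>N. T N i j) \<longlonglongrightarrow> S i j"
  shows "row_dominated r S"
  unfolding row_dominated_def
proof (intro allI impI)
  fix i and F :: "int set" assume "finite F"
  have "(\<lambda>N. \<Sum>j\<in>F. norm (T N i j)) \<longlonglongrightarrow> (\<Sum>j\<in>F. norm (S i j))"
    by (intro tendsto_sum tendsto_norm lim)
  then show "(\<Sum>j\<in>F. norm (S i j)) \<le> r i"
    by (rule LIMSEQ_le_const2) (use row_dominatedD[OF T \<open>finite F\<close>] in auto)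
qed

text \<open>Dominated convergence: the minors of every \<open>T N\<close> are bounded by
  \<open>prod r F\<close>, which is summable over finite \<open>F\<close>, so the sum over minors
  converges uniformly in \<open>N\<close>, while each minor is a polynomial in finitely many
  entries.\<close>

lemma fredholm_det_LIMSEQ:
  assumes T: "\<And>N. row_dominated r (T N)" and lim: "\<And>i j. (\<lambda>N. T N i j) \<longlonglongrightarrow> S i j"
    and r: "r summable_on UNIV"
  shows "(\<lambda>N. fredholm_det I (T N)) \<longlonglongrightarrow> fredholm_det I S"
proof -
  let ?F = "{F. finite F \<and> F \<subseteq> I}"
  have S: "row_dominated r S" by (rule row_dominated_LIMSEQ[OF T lim])
  note pr = summable_on_prod[OF r row_dominated_nonneg[OF S], of I]
  have le: "norm (fin_det F A) \<le> prod r F" if "F \<in> ?F" "row_dominated r A" for F A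
    using that by (intro norm_fin_det_le row_dominatedD[OF that(2)]) auto
  have ul: "uniform_limit UNIV (\<lambda>X N. \<Sum>F\<in>X. fin_det F (T N)) (\<lambda>N. \<Sum>\<^sub>\<infinity>F\<in>?F. fin_det F (T N))
      (finite_subsets_at_top ?F)"
    by (rule Weierstrass_m_test_general[OF _ pr]) (rule le[OF _ T])
  have "(\<lambda>F. norm (fin_det F S)) summable_on ?F"
    by (rule summable_on_comparison_test[OF pr]) (use le[OF _ S] in auto)
  then have "(\<lambda>F. fin_det F S) summable_on ?F"
    by (rule abs_summable_summable)
  then have g: "((\<lambda>X. \<Sum>F\<in>X. fin_det F S) \<longlongrightarrow> (\<Sum>\<^sub>\<infinity>F\<in>?F. fin_det F S)) (finite_subsets_at_top ?F)"
    by (rule infsum_tendsto)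
  have f: "(\<lambda>N. \<Sum>F\<in>X. fin_det F (T N)) \<longlonglongrightarrow> (\<Sum>F\<in>X. fin_det F S)" for X
    unfolding fin_det_def by (intro tendsto_intros lim)
  show ?thesis
    unfolding fredholm_det_def
    by (rule swap_uniform_limit'[OF always_eventually g ul]) (use f in auto)
qed

text \<open>Takes the whole operator rather than its deviation from 1, so that multiplicativity and
  conjugation have their usual form. It is used for \<open>A - 1\<close> nuclear or strictly
  triangular.\<close>

definition Det :: "bmat \<Rightarrow> complex" where
  "Det A = fredholm_det UNIV (entry (A - 1))"

text \<open>The projection onto the indices from -N to N; the second factor keeps the indices
  strictly below \<open>int N + 1\<close>.\<close>

definition box :: "nat \<Rightarrow> bmat" where
  "box N = step_mat 1 0 (- int N) * step_mat 0 1 (int N + 1)"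

lemma entry_box_mult: "entry (box N * X) i j = (if i \<in> {- int N..int N} then entry X i j else 0)"
  by (auto simp: box_def mult.assoc entry_step_mat_mult)

lemma entry_mult_box: "entry (X * box N) i j = (if j \<in> {- int N..int N} then entry X i j else 0)"
  by (auto simp: box_def mult.assoc[symmetric] entry_mult_step_mat)

lemma infsum_box:
  assumes "\<And>k. k \<notin> {- int N..int N} \<Longrightarrow> f k = 0"
  shows "infsum f UNIV = (\<Sum>k\<in>{- int N..int N}. f k)"
proof -
  have "infsum f UNIV = infsum f {- int N..int N}"
    by (rule infsum_cong_neutral) (use assms in auto)
  then show ?thesis by simp
qed

lemma entry_cut_mult:
  "entry (box N * X * box N * Y) i j =
    (if i \<in> {- int N..int N} then \<Sum>k\<in>{- int N..int N}. entry X i k * entry Y k j else 0)"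
proof -
  have "entry (box N * X * box N * Y) i j =
      (\<Sum>k\<in>{- int N..int N}. entry (box N * X * box N) i k * entry Y k j)"
    unfolding entry_mult[of _ Y] by (rule infsum_box) (auto simp: entry_mult_box)
  then show ?thesis
    by (cases "i \<in> {- int N..int N}") (simp_all add: entry_mult_box entry_box_mult mult.assoc[of "box N"] del: atLeastAtMost_iff)
qed

lemma LIMSEQ_sum_box:
  assumes "f summable_on (UNIV :: int set)"
  shows "(\<lambda>N. \<Sum>k\<in>{- int N..int N}. f k) \<longlonglongrightarrow> infsum f UNIV"
proof -
  have "filterlim (\<lambda>N. {- int N..int N}) (finite_subsets_at_top UNIV) sequentially"
    unfolding filterlim_finite_subsets_at_top
  proof (intro allI impI)
    fix X :: "int set" assume "finite X \<and> X \<subseteq> UNIV"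
    then obtain m where m: "\<And>x. x \<in> X \<Longrightarrow> \<bar>x\<bar> \<le> m"
      by (metis Max_ge finite_imageI imageI)
    have "\<forall>\<^sub>F N in sequentially. nat m \<le> N" by (rule eventually_ge_at_top)
    then show "\<forall>\<^sub>F N in sequentially. finite {- int N..int N} \<and> X \<subseteq> {- int N..int N} \<and> {- int N..int N} \<subseteq> UNIV"
    proof eventually_elim
      case (elim N)
      have "x \<in> {- int N..int N}" if "x \<in> X" for x
        using m[OF that] elim by auto
      then show ?case by auto
    qed
  qed
  from filterlim_compose[OF infsum_tendsto[OF assms] this] show ?thesis .
qed

lemma LIMSEQ_if_box:
  assumes "f \<longlonglongrightarrow> l"
  shows "(\<lambda>N. if i \<in> {- int N..int N} then f N else 0) \<longlonglongrightarrow> (l::complex)"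
proof (rule Lim_transform_eventually[OF assms])
  have "\<forall>\<^sub>F N in sequentially. nat \<bar>i\<bar> \<le> N" by (rule eventually_ge_at_top)
  then show "\<forall>\<^sub>F N in sequentially. f N = (if i \<in> {- int N..int N} then f N else 0)"
    by eventually_elim auto
qed

lemma LIMSEQ_entry_cut_mult: "(\<lambda>N. entry (box N * X * box N * Y) i j) \<longlonglongrightarrow> entry (X * Y) i j"
  unfolding entry_cut_mult unfolding entry_mult
  by (intro LIMSEQ_if_box LIMSEQ_sum_box abs_summable_summable[OF summable_bmat_mult])

lemma row_dominated_le:
  assumes "row_dominated r T" "\<And>i j. norm (S i j) \<le> norm (T i j)"
  shows "row_dominated r S"
  unfolding row_dominated_def
proof (intro allI impI)
  fix i and F :: "int set" assume "finite F"
  have "(\<Sum>j\<in>F. norm (S i j)) \<le> (\<Sum>j\<in>F. norm (T i j))"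
    by (rule sum_mono[OF assms(2)])
  also have "\<dots> \<le> r i" by (rule row_dominatedD[OF assms(1) \<open>finite F\<close>])
  finally show "(\<Sum>j\<in>F. norm (S i j)) \<le> r i" .
qed

lemma row_dominated_cut:
  assumes "row_dominated r (entry X)"
  shows "row_dominated r (entry (box N * X * box N))"
  by (rule row_dominated_le[OF assms]) (auto simp: entry_mult_box entry_box_mult)

text \<open>Only \<open>X\<close> is cut: its row sums \<open>r i\<close> and a bound
  \<open>c\<close> for the rows of \<open>Y\<close> give the majorant \<open>r i * c\<close>
  independent of \<open>N\<close>, and rows outside the box vanish, so the approximating
  determinants are finite ones.\<close>

lemma LIMSEQ_det_cut_mult:
  assumes "nuclear X"
  shows "(\<lambda>N. fredholm_det UNIV (entry (box N * X * box N * Y))) \<longlonglongrightarrow> fredholm_det UNIV (entry (X * Y))"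
proof -
  obtain r where r: "row_dominated r (entry X)" "r summable_on UNIV"
    using assms by (rule nuclear_row_dominated)
  obtain c where c: "row_bounded c (entry Y)" by (rule bmat_bounded)
  show ?thesis
  proof (rule fredholm_det_LIMSEQ)
    show "row_dominated (\<lambda>i. r i * c) (entry (box N * X * box N * Y))" for N
      by (rule row_dominated_mult[OF row_dominated_cut[OF r(1)] c])
    show "(\<lambda>i. r i * c) summable_on UNIV"
      by (rule summable_on_cmult_left[OF r(2)])
  qed (rule LIMSEQ_entry_cut_mult)
qed

lemma fredholm_det_entry_transp: "fredholm_det I (entry (transp X)) = fredholm_det I (entry X)"
proof -
  have "entry (transp X) = (\<lambda>i j. entry X j i)" by (intro ext) simp
  then show ?thesis using fredholm_det_transpose[of I "entry X"] by argo
qed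

lemma fredholm_det_cut_mult:
  "fredholm_det UNIV (entry (box N * X * box N * Y)) =
   fin_det {- int N..int N} (\<lambda>i j. of_bool (i = j) + (\<Sum>k\<in>{- int N..int N}. entry X i k * entry Y k j))"
proof -
  have "fredholm_det UNIV (entry (box N * X * box N * Y)) =
      fredholm_det {- int N..int N} (entry (box N * X * box N * Y))"
    by (rule fredholm_det_zero_rows) (auto simp: entry_cut_mult)
  also have "\<dots> = fin_det {- int N..int N} (\<lambda>i j. of_bool (i = j) + entry (box N * X * box N * Y) i j)"
    by (rule fredholm_det_finite) simp
  also have "\<dots> = fin_det {- int N..int N} (\<lambda>i j. of_bool (i = j) + (\<Sum>k\<in>{- int N..int N}. entry X i k * entry Y k j))"
    by (rule fin_det_cong) (simp add: entry_cut_mult)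
  finally show ?thesis .
qed

text \<open>Sylvester's identity on each box, then the limit. The truncation lemma wants the nuclear
  factor on the left, so the determinant of \<open>Y * X\<close> is approached through its transpose
  \<open>transp X * transp Y\<close>.\<close>

lemma fredholm_det_mult_commute:
  assumes X: "nuclear X"
  shows "fredholm_det UNIV (entry (X * Y)) = fredholm_det UNIV (entry (Y * X))"
proof (rule LIMSEQ_unique)
  show "(\<lambda>N. fredholm_det UNIV (entry (box N * X * box N * Y))) \<longlonglongrightarrow> fredholm_det UNIV (entry (X * Y))"
    by (rule LIMSEQ_det_cut_mult[OF X])
  have "fredholm_det UNIV (entry (box N * transp X * box N * transp Y)) =
      fredholm_det UNIV (entry (box N * X * box N * Y))" for N
  proof -
    let ?F = "{- int N..int N}"
    have "fredholm_det UNIV (entry (box N * X * box N * Y)) =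
        fin_det ?F (\<lambda>i j. of_bool (i = j) + (\<Sum>k\<in>?F. entry Y i k * entry X k j))"
      unfolding fredholm_det_cut_mult by (rule fin_det_one_plus_mult_commute) simp
    also have "\<dots> = fin_det ?F (\<lambda>i j. of_bool (j = i) + (\<Sum>k\<in>?F. entry Y j k * entry X k i))"
      by (rule fin_det_transpose[symmetric]) simp
    also have "\<dots> = fin_det ?F (\<lambda>i j. of_bool (i = j) + (\<Sum>k\<in>?F. entry (transp X) i k * entry (transp Y) k j))"
      by (rule fin_det_cong) (auto simp: mult.commute)
    finally show ?thesis unfolding fredholm_det_cut_mult by simp
  qed
  moreover have "(\<lambda>N. fredholm_det UNIV (entry (box N * transp X * box N * transp Y))) \<longlonglongrightarrow>
      fredholm_det UNIV (entry (transp X * transp Y))"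
    by (rule LIMSEQ_det_cut_mult) (simp add: nuclear_transp X)
  ultimately show "(\<lambda>N. fredholm_det UNIV (entry (box N * X * box N * Y))) \<longlonglongrightarrow> fredholm_det UNIV (entry (Y * X))"
    by (simp add: transp_mult[symmetric] fredholm_det_entry_transp)
qed

text \<open>The deviation from 1 of the conjugate is U (A - 1) V, and \<open>U\<close> can be moved
  cyclically to the right because (A - 1) V is nuclear; \<open>U\<close> and \<open>V\<close> are
  only bounded.\<close>

lemma Det_conj:
  assumes A: "nuclear (A - 1)" and VU: "V * U = 1" and UV: "U * V = 1"
  shows "Det (U * A * V) = Det A"
proof -
  have "U * A * V - 1 = U * ((A - 1) * V)"
    by (simp add: algebra_simps UV)
  then have "Det (U * A * V) = fredholm_det UNIV (entry (((A - 1) * V) * U))"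
    unfolding Det_def by (simp add: fredholm_det_mult_commute[OF nuclear_mult_right[OF A]])
  then show ?thesis by (simp add: Det_def mult.assoc VU)
qed

lemma fredholm_det_cut_product:
  fixes A B :: bmat and N :: nat
  defines "A' \<equiv> box N * A * box N" and "B' \<equiv> box N * B * box N"
  shows "fredholm_det UNIV (entry (A' + B' + A' * B')) =
    fredholm_det UNIV (entry A') * fredholm_det UNIV (entry B')"
proof -
  let ?F = "{- int N..int N}"
  have e: "entry A' i j = (if i \<in> ?F \<and> j \<in> ?F then entry A i j else 0)"
    "entry B' i j = (if i \<in> ?F \<and> j \<in> ?F then entry B i j else 0)" for i j
    by (simp_all add: A'_def B'_def entry_mult_box entry_box_mult)
  have AB: "entry (A' * B') i j = (\<Sum>k\<in>?F. entry A' i k * entry B' k j)" for i j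
    unfolding entry_mult by (rule infsum_box) (auto simp: e)
  have red: "fredholm_det UNIV (entry X) = fin_det ?F (\<lambda>i j. of_bool (i = j) + entry X i j)"
    if "\<And>i j. i \<notin> ?F \<Longrightarrow> entry X i j = 0" for X
    using fredholm_det_zero_rows[of ?F UNIV "entry X"] that by (simp add: fredholm_det_finite)
  have "fredholm_det UNIV (entry (A' + B' + A' * B')) =
      fin_det ?F (\<lambda>i j. of_bool (i = j) + entry (A' + B' + A' * B') i j)"
    by (rule red) (auto simp: e AB)
  also have "\<dots> = fin_det ?F (\<lambda>i j. \<Sum>k\<in>?F. (of_bool (i = k) + entry A' i k) * (of_bool (k = j) + entry B' k j))"
  proof (rule fin_det_cong)
    fix i j assume ij: "i \<in> ?F" "j \<in> ?F"
    have "(\<Sum>k\<in>?F. (of_bool (i = k) + entry A' i k) * (of_bool (k = j) + entry B' k j)) =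
        (\<Sum>k\<in>?F. (if i = k then of_bool (i = j) else 0)) + (\<Sum>k\<in>?F. (if k = j then entry A' i k else 0)) +
        (\<Sum>k\<in>?F. (if i = k then entry B' k j else 0)) + (\<Sum>k\<in>?F. entry A' i k * entry B' k j)"
      unfolding sum.distrib[symmetric] by (rule sum.cong) (auto simp: algebra_simps)
    also have "\<dots> = of_bool (i = j) + entry A' i j + entry B' i j + entry (A' * B') i j"
      unfolding AB using ij by (simp only: sum.delta sum.delta' finite_atLeastAtMost_int if_True)
    finally show "of_bool (i = j) + entry (A' + B' + A' * B') i j =
        (\<Sum>k\<in>?F. (of_bool (i = k) + entry A' i k) * (of_bool (k = j) + entry B' k j))"
      by simp
  qed
  also have "\<dots> = fin_det ?F (\<lambda>i j. of_bool (i = j) + entry A' i j) * fin_det ?F (\<lambda>i j. of_bool (i = j) + entry B' i j)"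
    by (rule fin_det_mult) simp
  also have "\<dots> = fredholm_det UNIV (entry A') * fredholm_det UNIV (entry B')"
    by (subst (1 2) red) (auto simp: e)
  finally show ?thesis .
qed

text \<open>Multiplicativity on boxes passes to the limit. Both deviations are truncated, because
  the finite product rule concerns (1 + X')(1 + Y') with X' and Y' supported on the same
  box.\<close>

lemma Det_mult:
  assumes A: "nuclear (A - 1)" and B: "nuclear (B - 1)"
  shows "Det (A * B) = Det A * Det B"
proof -
  define X Y where "X = A - 1" and "Y = B - 1"
  have nX: "nuclear X" and nY: "nuclear Y" using A B by (auto simp: X_def Y_def)
  let ?c = "\<lambda>N Z. box N * Z * box N"
  obtain r where r: "row_dominated r (entry X)" "r summable_on UNIV"
    using nX by (rule nuclear_row_dominated)
  obtain s where s: "row_dominated s (entry Y)" "s summable_on UNIV"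
    using nY by (rule nuclear_row_dominated)
  obtain c where c: "row_bounded c (entry Y)" by (rule bmat_bounded)
  \<comment> \<open>The left truncation of \<open>Y\<close> is absorbed by the right one of
    \<open>X\<close>, so only columns are cut further; the bound and the limit both reduce to the
    product \<open>?c N X * Y\<close>.\<close>
  have cY: "entry (?c N X * ?c N Y) i j = (if j \<in> {- int N..int N} then entry (?c N X * Y) i j else 0)" for N i j
    unfolding entry_cut_mult
    by (auto simp: entry_mult_box entry_box_mult intro!: sum.cong)
  have dom: "row_dominated (\<lambda>i. r i + s i + r i * c) (entry (?c N X + ?c N Y + ?c N X * ?c N Y))" for N
    unfolding row_dominated_def
  proof (intro allI impI)
    fix i and F :: "int set" assume F: "finite F"
    have "(\<Sum>j\<in>F. norm (entry (?c N X + ?c N Y + ?c N X * ?c N Y) i j)) \<le>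
        (\<Sum>j\<in>F. norm (entry (?c N X) i j) + norm (entry (?c N Y) i j) + norm (entry (?c N X * Y) i j))"
    proof (rule sum_mono)
      fix j
      have "norm (entry (?c N X * ?c N Y) i j) \<le> norm (entry (?c N X * Y) i j)"
        unfolding cY by simp
      then show "norm (entry (?c N X + ?c N Y + ?c N X * ?c N Y) i j) \<le>
          norm (entry (?c N X) i j) + norm (entry (?c N Y) i j) + norm (entry (?c N X * Y) i j)"
        unfolding entry_simps by (meson norm_triangle_mono norm_triangle_ineq order.trans add_mono)
    qed
    also have "\<dots> \<le> r i + s i + r i * c"
      unfolding sum.distrib
      by (intro add_mono row_dominatedD[OF row_dominated_cut[OF r(1)]]
          row_dominatedD[OF row_dominated_cut[OF s(1)]]
          row_dominatedD[OF row_dominated_mult[OF row_dominated_cut[OF r(1)] c]] F)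
    finally show "(\<Sum>j\<in>F. norm (entry (?c N X + ?c N Y + ?c N X * ?c N Y) i j)) \<le> r i + s i + r i * c" .
  qed
  have lim1: "(\<lambda>N. entry (?c N Z) i j) \<longlonglongrightarrow> entry Z i j" for Z i j
    using LIMSEQ_entry_cut_mult[of Z 1] by simp
  have "(\<lambda>N. fredholm_det UNIV (entry (?c N X + ?c N Y + ?c N X * ?c N Y))) \<longlonglongrightarrow>
      fredholm_det UNIV (entry (X + Y + X * Y))"
  proof (rule fredholm_det_LIMSEQ[OF dom])
    show "(\<lambda>N. entry (?c N X + ?c N Y + ?c N X * ?c N Y) i j) \<longlonglongrightarrow> entry (X + Y + X * Y) i j" for i j
      unfolding entry_simps cY by (intro tendsto_add lim1 LIMSEQ_if_box LIMSEQ_entry_cut_mult)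
    show "(\<lambda>i. r i + s i + r i * c) summable_on UNIV"
      by (intro summable_on_add summable_on_cmult_left r s)
  qed
  moreover have "(\<lambda>N. fredholm_det UNIV (entry (?c N Z))) \<longlonglongrightarrow> fredholm_det UNIV (entry Z)" if "nuclear Z" for Z
    using LIMSEQ_det_cut_mult[OF that, of 1] by simp
  then have "(\<lambda>N. fredholm_det UNIV (entry (?c N X)) * fredholm_det UNIV (entry (?c N Y))) \<longlonglongrightarrow>
      fredholm_det UNIV (entry X) * fredholm_det UNIV (entry Y)"
    using nX nY by (intro tendsto_mult)
  ultimately have "fredholm_det UNIV (entry (X + Y + X * Y)) = fredholm_det UNIV (entry X) * fredholm_det UNIV (entry Y)"
    unfolding fredholm_det_cut_product by (rule LIMSEQ_unique)
  moreover have "A * B - 1 = X + Y + X * Y"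
    by (simp add: X_def Y_def algebra_simps)
  ultimately show ?thesis by (simp only: Det_def X_def[symmetric] Y_def[symmetric])
qed

text \<open>In a nonempty finite index set the row of the least index vanishes, so only the empty
  minor, equal to 1, survives.\<close>

lemma Det_strictly_lower_triangular:
  assumes "\<And>i j. i \<le> j \<Longrightarrow> entry (A - 1) i j = 0"
  shows "Det A = 1"
proof -
  have "Det A = (\<Sum>\<^sub>\<infinity>F\<in>{{}}. fin_det F (entry (A - 1)))"
    unfolding Det_def fredholm_det_def
    by (rule infsum_cong_neutral) (auto intro!: fin_det_strictly_lower_triangular assms)
  then show ?thesis by (simp add: fin_det_def)
qed

lemma Det_strictly_upper_triangular:
  assumes "\<And>i j. j \<le> i \<Longrightarrow> entry (A - 1) i j = 0"
  shows "Det A = 1"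
proof -
  have "Det A = (\<Sum>\<^sub>\<infinity>F\<in>{{}}. fin_det F (entry (A - 1)))"
    unfolding Det_def fredholm_det_def
    by (rule infsum_cong_neutral) (auto intro!: fin_det_strictly_upper_triangular assms)
  then show ?thesis by (simp add: fin_det_def)
qed

section \<open>Toeplitz matrices and projections\<close>

text \<open>The guard makes the map total on coefficient sequences. For summable \<open>a\<close>
  this is the doubly infinite Laurent matrix of multiplication by the function with coefficients
  \<open>a\<close>.\<close>

lift_definition toep :: "(int \<Rightarrow> complex) \<Rightarrow> bmat"
  is "\<lambda>a i j. if a abs_summable_on UNIV then a (i - j) else 0"
proof -
  fix a :: "int \<Rightarrow> complex"
  let ?T = "\<lambda>i j. if a abs_summable_on UNIV then a (i - j) else 0"
  show "\<exists>c. row_bounded c ?T \<and> row_bounded c (\<lambda>i j. ?T j i)"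
  proof (cases "a abs_summable_on UNIV")
    case True
    have le: "(\<Sum>j\<in>F. norm (a (g j))) \<le> (\<Sum>\<^sub>\<infinity>m. norm (a m))" if "finite F" "inj g" for F and g :: "int \<Rightarrow> int"
    proof -
      have "(\<Sum>j\<in>F. norm (a (g j))) = (\<Sum>m\<in>g ` F. norm (a m))"
        using that by (subst sum.reindex) (auto intro: inj_on_subset)
      also have "\<dots> \<le> (\<Sum>\<^sub>\<infinity>m. norm (a m))"
        by (rule finite_sum_le_infsum[OF True]) (use that in auto)
      finally show ?thesis .
    qed
    have "row_bounded (\<Sum>\<^sub>\<infinity>m. norm (a m)) (\<lambda>i j. a (i - j))"
      unfolding row_bounded_def by (intro allI impI le) (auto simp: inj_def)
    moreover have "row_bounded (\<Sum>\<^sub>\<infinity>m. norm (a m)) (\<lambda>i j. a (j - i))"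
      unfolding row_bounded_def by (intro allI impI le) (auto simp: inj_def)
    ultimately show ?thesis using True by auto
  next
    case False
    then show ?thesis by (auto simp: row_bounded_def intro: exI[of _ 0])
  qed
qed

lemma entry_toep: "a abs_summable_on UNIV \<Longrightarrow> entry (toep a) i j = a (i - j)"
  by (simp add: toep.rep_eq)

definition conv :: "(int \<Rightarrow> complex) \<Rightarrow> (int \<Rightarrow> complex) \<Rightarrow> int \<Rightarrow> complex" where
  "conv a b m = (\<Sum>\<^sub>\<infinity>k. a (m - k) * b k)"

lemma sum_norm_le_infsum:
  assumes "u abs_summable_on UNIV" "finite F"
  shows "(\<Sum>k\<in>F. norm (u k)) \<le> (\<Sum>\<^sub>\<infinity>k. norm (u k))"
  by (rule finite_sum_le_infsum[OF assms(1)]) (use assms in auto)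

lemma abs_summable_conv:
  assumes a: "a abs_summable_on UNIV" and b: "b abs_summable_on UNIV"
  shows "conv a b abs_summable_on UNIV"
proof (rule abs_summable_bounded_sums(1))
  fix F :: "int set" assume F: "finite F"
  have "(\<Sum>m\<in>F. norm (\<Sum>\<^sub>\<infinity>k. b k * a (m - k))) \<le> (\<Sum>\<^sub>\<infinity>k. norm (b k)) * (\<Sum>\<^sub>\<infinity>k. norm (a k))"
  proof (rule sum_norm_row_mult_le[OF _ _ F])
    fix k and G :: "int set" assume "finite G"
    have "(\<Sum>j\<in>G. norm (a (j - k))) = (\<Sum>m\<in>(\<lambda>j. j - k) ` G. norm (a m))"
      by (subst sum.reindex) (auto simp: inj_on_def)
    also have "\<dots> \<le> (\<Sum>\<^sub>\<infinity>k. norm (a k))"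
      by (rule sum_norm_le_infsum[OF a]) (use \<open>finite G\<close> in auto)
    finally show "(\<Sum>j\<in>G. norm (a (j - k))) \<le> (\<Sum>\<^sub>\<infinity>k. norm (a k))" .
  qed (rule sum_norm_le_infsum[OF b])
  then show "(\<Sum>m\<in>F. norm (conv a b m)) \<le> (\<Sum>\<^sub>\<infinity>k. norm (b k)) * (\<Sum>\<^sub>\<infinity>k. norm (a k))"
    by (simp add: conv_def mult.commute)
qed

lemma toep_mult:
  assumes a: "a abs_summable_on UNIV" and b: "b abs_summable_on UNIV"
  shows "toep a * toep b = toep (conv a b)"
proof (rule bmat_eqI)
  fix i j
  have "entry (toep a * toep b) i j = (\<Sum>\<^sub>\<infinity>k. a (i - k) * b (k - j))"
    by (simp add: entry_mult entry_toep a b)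
  also have "\<dots> = (\<Sum>\<^sub>\<infinity>l. a (i - (l + j)) * b (l + j - j))"
    by (rule infsum_reindex_bij_betw[symmetric]) (rule bij_betwI[of _ _ _ "\<lambda>k. k - j"], auto)
  also have "\<dots> = entry (toep (conv a b)) i j"
    by (simp add: entry_toep[OF abs_summable_conv[OF a b]] conv_def algebra_simps)
  finally show "entry (toep a * toep b) i j = entry (toep (conv a b)) i j" .
qed

definition delta :: "int \<Rightarrow> int \<Rightarrow> complex" where
  "delta k m = of_bool (m = k)"

lemma abs_summable_finite_support:
  assumes "finite F" "\<And>m. m \<notin> F \<Longrightarrow> f m = 0"
  shows "(f :: int \<Rightarrow> complex) abs_summable_on UNIV"
  by (rule finite_nonzero_values_imp_summable_on) (use assms in \<open>auto intro: finite_subset[OF _ assms(1)]\<close>)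

lemma abs_summable_delta: "delta k abs_summable_on UNIV"
  by (rule abs_summable_finite_support[of "{k}"]) (auto simp: delta_def)

lemma toep_delta_0: "toep (delta 0) = 1"
  by (rule bmat_eqI) (simp add: entry_toep[OF abs_summable_delta], simp add: delta_def)

text \<open>\<open>bmat\<close> carries only a ring structure; these central diagonal matrices play
  the role of complex scalars.\<close>

abbreviation sc :: "complex \<Rightarrow> bmat" where "sc c \<equiv> step_mat c c 0"

lemma entry_sc_mult [simp]: "entry (sc c * X) i j = c * entry X i j"
  by (simp add: entry_step_mat_mult)

lemma sc_commute: "X * sc c = sc c * X"
  by (rule bmat_eqI) (simp add: entry_mult_step_mat)

lemma sc_left_commute: "X * (sc c * Y) = sc c * (X * Y)"
  by (metis mult.assoc sc_commute)

lemma sc_mult: "sc c * sc d = sc (c * d)"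
  by (rule step_mat_mult)

lemma nuclear_finite_support:
  assumes "finite F" "\<And>i j. (i, j) \<notin> F \<Longrightarrow> entry X i j = 0"
  shows "nuclear X"
  unfolding nuclear_def
  by (rule finite_nonzero_values_imp_summable_on, rule finite_subset[OF _ assms(1)]) (use assms(2) in force)

lemma nuclear_step_mat_diff: "nuclear (step_mat p q m - step_mat p q n)"
  by (rule nuclear_finite_support[of "(\<lambda>i. (i, i)) ` {min m n..max m n}"])
     (auto simp: entry_step_mat)

text \<open>The entry at (i, j) is plus or minus a(i - j) when 0 separates \<open>i\<close> from
  \<open>j\<close>, and 0 otherwise. Each difference m = i - j occurs |m| times, so the total of
  absolute values is the weighted sum in \<open>wa\<close>.\<close>

lemma nuclear_toep_commutator:
  assumes a: "a abs_summable_on UNIV" and wa: "(\<lambda>j. norm (of_int j * a j)) summable_on UNIV"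
  shows "nuclear (toep a * step_mat 1 0 0 - step_mat 1 0 0 * toep a)"
proof -
  \<comment> \<open>\<open>D m\<close> collects the columns \<open>j\<close> for which
    \<open>j\<close> and \<open>j + m\<close> lie on opposite sides of the step at 0.\<close>
  define D where "D m = {-m..<0} \<union> {0..<-m}" for m :: int
  let ?K = "toep a * step_mat 1 0 0 - step_mat 1 0 0 * toep a"
  let ?g = "\<lambda>(m, j). (j + m, j) :: int \<times> int"
  have K: "entry ?K i j = a (i - j) * ((if 0 \<le> j then 1 else 0) - (if 0 \<le> i then 1 else 0))" for i j
    by (simp add: entry_step_mat_mult entry_mult_step_mat entry_toep[OF a] algebra_simps)
  have "(\<lambda>(m, j). norm (a m)) summable_on Sigma UNIV D"
  proof (rule summable_on_SigmaI)
    fix m :: int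
    have "card (D m) = nat \<bar>m\<bar>"
      unfolding D_def by (cases "0 \<le> m") auto
    then have "((\<lambda>j. norm (a m)) has_sum norm (of_int m * a m)) (D m)"
      by (intro has_sum_finiteI) (auto simp: D_def norm_mult)
    then show "((\<lambda>y. case (m, y) of (m, j) \<Rightarrow> norm (a m)) has_sum norm (of_int m * a m)) (D m)" by simp
  qed (use wa in auto)
  also have "?this \<longleftrightarrow> ((\<lambda>(i, j). norm (entry ?K i j)) \<circ> ?g) summable_on Sigma UNIV D"
    by (rule summable_on_cong) (auto simp: K D_def simp del: entry_diff)
  also have "\<dots> \<longleftrightarrow> (\<lambda>(i, j). norm (entry ?K i j)) summable_on (?g ` Sigma UNIV D)"
    by (rule summable_on_reindex[symmetric]) (auto simp: inj_on_def)
  also have "\<dots> \<longleftrightarrow> (\<lambda>(i, j). norm (entry ?K i j)) summable_on UNIV"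
  proof (rule summable_on_cong_neutral)
    fix x assume "x \<in> UNIV - ?g ` Sigma UNIV D"
    then obtain i j where x: "x = (i, j)" and *: "(i, j) \<notin> ?g ` Sigma UNIV D" by (cases x) auto
    have "j \<notin> D (i - j)"
      using * by (force simp: image_iff)
    then have "entry ?K i j = 0" by (auto simp: K D_def simp del: entry_diff)
    then show "(case x of (i, j) \<Rightarrow> norm (entry ?K i j)) = 0" by (simp add: x)
  qed auto
  finally show ?thesis by (simp add: nuclear_def)
qed

text \<open>\<open>B\<close> times the commutator is the case n = 0; moving the step from 0 to
  \<open>n\<close> changes only finitely many diagonal entries.\<close>

lemma nuclear_step_minus_conj:
  assumes A: "nuclear (A * step_mat 1 0 0 - step_mat 1 0 0 * A)" and BA: "B * A = 1"
  shows "nuclear (step_mat 1 0 n - B * step_mat 1 0 0 * A)"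
proof -
  have "B * (A * step_mat 1 0 0 - step_mat 1 0 0 * A) = step_mat 1 0 0 - B * step_mat 1 0 0 * A"
    by (simp add: right_diff_distrib mult.assoc[symmetric] BA)
  then have "step_mat 1 0 n - B * step_mat 1 0 0 * A =
      B * (A * step_mat 1 0 0 - step_mat 1 0 0 * A) + (step_mat 1 0 n - step_mat 1 0 0)"
    by simp
  then show ?thesis
    by (simp only: nuclear_add nuclear_mult_left[OF A] nuclear_step_mat_diff)
qed

text \<open>For n = 0 and \<open>B\<close> inverse to \<open>A\<close> this is the determinant of
  the multiplicative commutator of \<open>B\<close> with E = 1 + (q - 1) P_0. The offset
  \<open>n\<close> sits in the last factor alone, so that commutators with offset 0 can be
  multiplied on from the left.\<close>

definition Wdet :: "complex \<Rightarrow> int \<Rightarrow> bmat \<Rightarrow> bmat \<Rightarrow> complex" where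
  "Wdet q n A B = Det (B * step_mat q 1 0 * A * step_mat (1 / q) 1 n)"

lemma step_mat_eq_sc: "step_mat q 1 n = 1 + sc (q - 1) * step_mat 1 0 n"
  by (rule bmat_eqI) (auto simp: entry_step_mat)

lemma step_mat_inverse:
  assumes "p \<noteq> 0" "q \<noteq> 0"
  shows "step_mat p q n * step_mat (1 / p) (1 / q) n = 1" "step_mat (1 / p) (1 / q) n * step_mat p q n = 1"
  using assms by (simp_all add: step_mat_mult step_mat_1)

lemma step_mat_inverse1:
  assumes "q \<noteq> 0"
  shows "step_mat q 1 n * step_mat (1 / q) 1 n = 1" "step_mat (1 / q) 1 n * step_mat q 1 n = 1"
  using step_mat_inverse[of q 1 n] assms by simp_all

lemma nuclear_Wdet:
  assumes A: "nuclear (A * step_mat 1 0 0 - step_mat 1 0 0 * A)" and BA: "B * A = 1" and q: "q \<noteq> 0"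
  shows "nuclear (B * step_mat q 1 0 * A * step_mat (1 / q) 1 n - 1)"
proof -
  have "B * step_mat q 1 0 * A - step_mat q 1 n = - (sc (q - 1) * (step_mat 1 0 n - B * step_mat 1 0 0 * A))"
    unfolding step_mat_eq_sc[of q] by (simp add: algebra_simps BA sc_left_commute)
  then have "nuclear (B * step_mat q 1 0 * A - step_mat q 1 n)"
    by (simp only: nuclear_uminus nuclear_mult_left nuclear_step_minus_conj[OF A BA])
  moreover have "B * step_mat q 1 0 * A * step_mat (1 / q) 1 n - 1 =
      (B * step_mat q 1 0 * A - step_mat q 1 n) * step_mat (1 / q) 1 n"
    by (simp only: left_diff_distrib step_mat_inverse1[OF q])
  ultimately show ?thesis by (simp only: nuclear_mult_right)
qed

text \<open>Inserting A' B' = 1 and the inverse pair of step matrices at 0 splits the commutator of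
  a product into a conjugate of the first commutator, with the same determinant, and the second
  commutator.\<close>

lemma Wdet_mult:
  assumes A: "nuclear (A * step_mat 1 0 0 - step_mat 1 0 0 * A)" "B * A = 1"
    and A': "nuclear (A' * step_mat 1 0 0 - step_mat 1 0 0 * A')" "B' * A' = 1" "A' * B' = 1"
    and q: "q \<noteq> 0"
  shows "Wdet q n (A * A') (B' * B) = Wdet q 0 A B * Wdet q n A' B'"
proof -
  let ?E = "step_mat q 1 0" and ?E' = "step_mat (1 / q) 1 0" and ?F = "step_mat (1 / q) 1 n"
  have "(B' * (B * ?E * A * ?E') * A') * (B' * ?E * A' * ?F) =
      B' * B * ?E * A * (?E' * (A' * B') * ?E) * A' * ?F"
    by (simp only: mult.assoc)
  also have "\<dots> = B' * B * ?E * (A * A') * ?F"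
    by (simp add: A' step_mat_inverse1[OF q] mult.assoc)
  finally have eq: "B' * B * ?E * (A * A') * ?F = (B' * (B * ?E * A * ?E') * A') * (B' * ?E * A' * ?F)" ..
  have n1: "nuclear (B * ?E * A * ?E' - 1)" by (rule nuclear_Wdet[OF A q])
  have "B' * (B * ?E * A * ?E') * A' - 1 = B' * (B * ?E * A * ?E' - 1) * A'"
    by (simp add: right_diff_distrib left_diff_distrib A')
  then have n2: "nuclear (B' * (B * ?E * A * ?E') * A' - 1)"
    by (simp only: nuclear_mult_left nuclear_mult_right n1)
  have "Wdet q n (A * A') (B' * B) = Det (B' * (B * ?E * A * ?E') * A') * Det (B' * ?E * A' * ?F)"
    unfolding Wdet_def eq by (rule Det_mult[OF n2 nuclear_Wdet[OF A'(1,2) q]])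
  also have "Det (B' * (B * ?E * A * ?E') * A') = Det (B * ?E * A * ?E')"
    by (rule Det_conj[OF n1 A'(3,2)])
  finally show ?thesis by (simp add: Wdet_def)
qed

section \<open>Commutator determinants of monomials and of triangular matrices\<close>

lemma fin_det_diagonal:
  assumes F: "finite F" and T: "\<And>i j. i \<noteq> j \<Longrightarrow> T i j = 0"
  shows "fin_det F T = (\<Prod>i\<in>F. T i i)"
proof -
  have "fin_det F T = (\<Sum>p\<in>{id}. of_int (sign p) * (\<Prod>i\<in>F. T i (p i)))"
    unfolding fin_det_def
  proof (rule sum.mono_neutral_right[OF finite_permutations[OF F]])
    show "{id} \<subseteq> {p. p permutes F}" by (simp add: permutes_id)
    show "\<forall>p\<in>{p. p permutes F} - {id}. of_int (sign p) * (\<Prod>i\<in>F. T i (p i)) = 0"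
    proof
      fix p assume p: "p \<in> {p. p permutes F} - {id}"
      then obtain i where "p i \<noteq> i" by (auto simp: fun_eq_iff)
      with p have "i \<in> F" "T i (p i) = 0" by (auto simp: permutes_def T)
      then show "of_int (sign p) * (\<Prod>i\<in>F. T i (p i)) = 0"
        using F by (auto simp: prod_zero_iff)
    qed
  qed
  then show ?thesis by simp
qed

text \<open>The product is diagonal and differs from 1 only at the |n - m| indices between the two
  steps, where its entry is \<open>q\<close> if m < n and \<open>1 / q\<close> if n < m.\<close>

lemma Det_step_mat_quotient:
  assumes q: "q \<noteq> 0"
  shows "Det (step_mat q 1 m * step_mat (1 / q) 1 n) = q powi (n - m)"
proof -
  let ?X = "step_mat q 1 m * step_mat (1 / q) 1 n"
  let ?I = "{min m n..<max m n}"
  have e: "entry ?X i j = (if i = j then (if m \<le> i then q else 1) * (if n \<le> i then 1 / q else 1) else 0)" for i j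
    by (simp add: entry_step_mat_mult entry_step_mat)
  have "Det ?X = fredholm_det ?I (entry (?X - 1))"
    unfolding Det_def by (rule fredholm_det_zero_rows) (use q in \<open>auto simp: e\<close>)
  also have "\<dots> = fin_det ?I (entry ?X)"
    by (subst fredholm_det_finite) (auto intro!: fin_det_cong)
  also have "\<dots> = (\<Prod>i\<in>?I. entry ?X i i)"
    by (rule fin_det_diagonal) (auto simp: e)
  also have "\<dots> = (\<Prod>i\<in>?I. if m \<le> n then q else 1 / q)"
    by (rule prod.cong) (auto simp: e)
  also have "\<dots> = q powi (n - m)"
    by (auto simp: power_int_def divide_inverse min_def max_def)
  finally show ?thesis .
qed

text \<open>Multiplication by z^k sends basis index j to j + k, so pulling a step at 0 back through
  it puts the step at -k; the constants cancel. In the matrix product only l = i + k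
  contributes.\<close>

lemma toep_shift_conj:
  assumes c: "c \<noteq> 0"
  shows "toep (\<lambda>m. 1 / c * delta (- k) m) * step_mat p q 0 * toep (\<lambda>m. c * delta k m) = step_mat p q (- k)"
proof (rule bmat_eqI)
  fix i j
  have s: "(\<lambda>m. c * delta k m) abs_summable_on UNIV" for c k
    by (rule abs_summable_finite_support[of "{k}"]) (auto simp: delta_def)
  have "entry (toep (\<lambda>m. 1 / c * delta (- k) m) * step_mat p q 0 * toep (\<lambda>m. c * delta k m)) i j =
      (\<Sum>\<^sub>\<infinity>l. 1 / c * delta (- k) (i - l) * (if 0 \<le> l then p else q) * (c * delta k (l - j)))"
    unfolding entry_mult[of "toep _ * _"] by (simp only: entry_mult_step_mat entry_toep[OF s])
  also have "\<dots> = 1 / c * delta (- k) (i - (i + k)) * (if 0 \<le> i + k then p else q) * (c * delta k (i + k - j))"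
    by (rule infsum_single) (auto simp: delta_def)
  also have "\<dots> = entry (step_mat p q (- k)) i j"
    using c by (auto simp: delta_def entry_step_mat)
  finally show "entry (toep (\<lambda>m. 1 / c * delta (- k) m) * step_mat p q 0 * toep (\<lambda>m. c * delta k m)) i j =
      entry (step_mat p q (- k)) i j" .
qed

lemma Wdet_shift:
  assumes "c \<noteq> 0" "q \<noteq> 0"
  shows "Wdet q n (toep (\<lambda>m. c * delta k m)) (toep (\<lambda>m. 1 / c * delta (- k) m)) = q powi (n + k)"
  unfolding Wdet_def toep_shift_conj[OF assms(1)] Det_step_mat_quotient[OF assms(2)] by simp

lemma entry_mult_lower:
  assumes "\<And>i j. i < j \<Longrightarrow> entry X i j = 0" "\<And>i j. i < j \<Longrightarrow> entry Y i j = 0"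
  shows "i < j \<Longrightarrow> entry (X * Y) i j = 0" and "entry (X * Y) i i = entry X i i * entry Y i i"
proof -
  show "entry (X * Y) i j = 0" if "i < j"
  proof -
    have "(\<lambda>k. entry X i k * entry Y k j) = (\<lambda>_. 0)"
      using assms that by (intro ext, case_tac "i < k") auto
    then show ?thesis by (simp only: entry_mult infsum_0_simp)
  qed
  show "entry (X * Y) i i = entry X i i * entry Y i i"
    unfolding entry_mult
  proof (rule infsum_single)
    fix k assume "k \<noteq> i"
    then show "entry X i k * entry Y k i = 0"
      using assms by (cases "i < k") auto
  qed
qed

text \<open>Diagonals of triangular matrices multiply entrywise, and both steps stand at 0. The
  diagonal entry of the commutator is therefore B_ii A_ii times a step value and its inverse, that
  is 1, and the commutator is unipotent.\<close>

lemma Wdet_lower_triangular: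
  assumes A: "\<And>i j. i < j \<Longrightarrow> entry A i j = 0" and B: "\<And>i j. i < j \<Longrightarrow> entry B i j = 0"
    and BA: "B * A = 1" and q: "q \<noteq> 0"
  shows "Wdet q 0 A B = 1"
  unfolding Wdet_def
proof (rule Det_strictly_lower_triangular)
  fix i j :: int assume ij: "i \<le> j"
  let ?X = "B * step_mat q 1 0"
  have X: "entry ?X i j = 0" if "i < j" for i j using B that by (simp add: entry_mult_step_mat)
  have "entry (B * A) i i = entry B i i * entry A i i"
    by (rule entry_mult_lower(2)[OF B A])
  then have 1: "entry B i i * entry A i i = 1" by (simp add: BA)
  have 2: "entry (?X * A) i i = entry ?X i i * entry A i i"
    by (rule entry_mult_lower(2)[OF X A])
  have 3: "entry (?X * A) i j = 0" if "i \<noteq> j"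
    by (rule entry_mult_lower(1)[OF X A]) (use ij that in auto)
  show "entry (?X * A * step_mat (1 / q) 1 0 - 1) i j = 0"
  proof (cases "i = j")
    case True
    then show ?thesis
      using 1 2 q by (simp add: entry_mult_step_mat mult.commute mult.left_commute)
  next
    case False
    then show ?thesis using 3 by (simp add: entry_mult_step_mat)
  qed
qed

lemma entry_mult_upper:
  assumes "\<And>i j. j < i \<Longrightarrow> entry X i j = 0" "\<And>i j. j < i \<Longrightarrow> entry Y i j = 0"
  shows "j < i \<Longrightarrow> entry (X * Y) i j = 0" and "entry (X * Y) i i = entry X i i * entry Y i i"
proof -
  show "entry (X * Y) i j = 0" if "j < i"
  proof -
    have "(\<lambda>k. entry X i k * entry Y k j) = (\<lambda>_. 0)"
      using assms that by (intro ext, case_tac "k < i") auto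
    then show ?thesis by (simp only: entry_mult infsum_0_simp)
  qed
  show "entry (X * Y) i i = entry X i i * entry Y i i"
    unfolding entry_mult
  proof (rule infsum_single)
    fix k assume "k \<noteq> i"
    then show "entry X i k * entry Y k i = 0"
      using assms by (cases "k < i") auto
  qed
qed

lemma Wdet_upper_triangular:
  assumes A: "\<And>i j. j < i \<Longrightarrow> entry A i j = 0" and B: "\<And>i j. j < i \<Longrightarrow> entry B i j = 0"
    and BA: "B * A = 1" and q: "q \<noteq> 0"
  shows "Wdet q 0 A B = 1"
  unfolding Wdet_def
proof (rule Det_strictly_upper_triangular)
  fix i j :: int assume ij: "j \<le> i"
  let ?X = "B * step_mat q 1 0"
  have X: "entry ?X i j = 0" if "j < i" for i j using B that by (simp add: entry_mult_step_mat)
  have "entry (B * A) i i = entry B i i * entry A i i"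
    by (rule entry_mult_upper(2)[OF B A])
  then have 1: "entry B i i * entry A i i = 1" by (simp add: BA)
  have 2: "entry (?X * A) i i = entry ?X i i * entry A i i"
    by (rule entry_mult_upper(2)[OF X A])
  have 3: "entry (?X * A) i j = 0" if "i \<noteq> j"
    by (rule entry_mult_upper(1)[OF X A]) (use ij that in auto)
  show "entry (?X * A * step_mat (1 / q) 1 0 - 1) i j = 0"
  proof (cases "i = j")
    case True
    then show ?thesis
      using 1 2 q by (simp add: entry_mult_step_mat mult.commute mult.left_commute)
  next
    case False
    then show ?thesis using 3 by (simp add: entry_mult_step_mat)
  qed
qed

section \<open>Determinants linking two idempotents\<close>

lemma Det_eq_fredholm_det:
  assumes "\<And>i j. i \<notin> J \<Longrightarrow> entry X i j = 0"
  shows "Det (1 - sc c * X) = fredholm_det J (\<lambda>i j. - c * entry X i j)"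
proof -
  have "entry (1 - sc c * X - 1) = (\<lambda>i j. - c * entry X i j)" by (intro ext) simp
  then have "Det (1 - sc c * X) = fredholm_det UNIV (\<lambda>i j. - c * entry X i j)"
    unfolding Det_def by simp
  also have "\<dots> = fredholm_det J (\<lambda>i j. - c * entry X i j)"
    by (rule fredholm_det_zero_rows) (use assms in auto)
  finally show ?thesis .
qed

text \<open>For idempotents \<open>p\<close> and \<open>c\<close>, the difference \<open>p + c - 1\<close> is linked to the product \<open>p c\<close> by
  \<open>(1 + s p)(1 - s (p + c - 1)) = (1 - s\<^sup>2 p c)(1 + s (1 - c))\<close>.\<close>

lemma idempotent_factorization:
  assumes p: "p * p = p" and c: "c * c = c"
  shows "(1 + sc s * p) * (1 - sc s * (p + c - 1)) = (1 - sc (s\<^sup>2) * (p * c)) * (1 + sc s * (1 - c))"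
proof -
  define t where "t = sc s"
  have t: "p * t = t * p" "c * t = t * c" "p * (t * x) = t * (p * x)" "c * (t * x) = t * (c * x)" for x
    by (simp_all only: t_def sc_commute sc_left_commute)
  have pc: "p * (p * x) = p * x" "c * (c * x) = c * x" for x
    by (simp_all add: mult.assoc[symmetric] p c)
  have tt: "sc (s\<^sup>2) = t * t"
    by (simp only: t_def sc_mult power2_eq_square)
  show ?thesis
    unfolding tt t_def[symmetric]
    by (simp add: mult.assoc distrib_left distrib_right left_diff_distrib right_diff_distrib t p c pc)
qed

text \<open>In the factorization neither 1 + s p nor 1 + s (1 - c) need be a nuclear perturbation of
  1. The left factor is therefore brought across by conjugation with its inverse \<open>E\<close>,
  and multiplicativity is applied to the two groups that are.\<close>

lemma Det_idempotents:
  assumes p: "p * p = p" and c: "c * c = c" and k: "nuclear (p + c - 1)"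
    and E: "(1 + sc s * p) * E = 1" "E * (1 + sc s * p) = 1"
  shows "Det (1 - sc s * (p + c - 1)) = Det (1 - sc (s\<^sup>2) * (p * c)) * Det ((1 + sc s * (1 - c)) * E)"
proof -
  let ?F = "1 + sc s * p"
  let ?K = "1 - sc s * (p + c - 1)"
  have "p * (p + c - 1) = p * c"
    by (simp add: right_diff_distrib distrib_left p)
  then have n: "nuclear (p * c)"
    using nuclear_mult_left[OF k, of p] by simp
  then have n1: "nuclear (1 - sc (s\<^sup>2) * (p * c) - 1)"
    by (simp add: nuclear_uminus nuclear_mult_left)
  have "(1 + sc s * (1 - c)) * E - 1 = (1 + sc s * (1 - c) - ?F) * E"
    by (simp only: left_diff_distrib[of _ ?F] E)
  also have "1 + sc s * (1 - c) - ?F = - (sc s * (p + c - 1))"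
    by (simp add: algebra_simps)
  finally have n2: "nuclear ((1 + sc s * (1 - c)) * E - 1)"
    by (simp only: nuclear_uminus nuclear_mult_left k nuclear_mult_right)
  have nK: "nuclear (?K - 1)"
    by (simp add: nuclear_uminus nuclear_mult_left k)
  have "Det ?K = Det (?F * ?K * E)"
    by (rule Det_conj[OF nK E(2,1), symmetric])
  also have "\<dots> = Det ((1 - sc (s\<^sup>2) * (p * c)) * ((1 + sc s * (1 - c)) * E))"
    by (simp only: idempotent_factorization[OF p c] mult.assoc)
  also have "\<dots> = Det (1 - sc (s\<^sup>2) * (p * c)) * Det ((1 + sc s * (1 - c)) * E)"
    by (rule Det_mult[OF n1 n2])
  finally show ?thesis .
qed

text \<open>Both products are, up to sign, the nuclear difference P_n - R multiplied from the left
  by P_n or 1 - P_n. This yields the trace class property on the half-lines.\<close>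

lemma nuclear_complement_products:
  assumes R: "nuclear (step_mat 1 0 n - R)" and RS: "R + S = 1"
  shows "nuclear (step_mat 1 0 n * S)" and "nuclear (step_mat 0 1 n * R)"
proof -
  have S: "S = 1 - R" using RS by (simp add: eq_diff_eq add.commute)
  have "step_mat 1 0 n * (step_mat 1 0 n - R) = step_mat 1 0 n * S"
    by (simp add: S right_diff_distrib step_mat_mult)
  then show "nuclear (step_mat 1 0 n * S)" using nuclear_mult_left[OF R] by metis
  have "step_mat 0 1 n * (step_mat 1 0 n - R) = - (step_mat 0 1 n * R)"
    by (rule bmat_eqI) (simp add: entry_step_mat_mult entry_step_mat)
  then show "nuclear (step_mat 0 1 n * R)" using nuclear_mult_left[OF R] nuclear_uminus by metis
qed

lemma conj_step_sum:
  assumes "B * A = 1"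
  shows "B * step_mat 1 0 0 * A + B * step_mat 0 1 0 * A = 1"
proof -
  have "step_mat 1 0 0 + step_mat 0 1 0 = 1"
    by (rule bmat_eqI) (simp add: entry_step_mat)
  moreover have "B * step_mat 1 0 0 * A + B * step_mat 0 1 0 * A = B * (step_mat 1 0 0 + step_mat 0 1 0) * A"
    by (simp only: distrib_left distrib_right)
  ultimately show ?thesis by (simp add: assms)
qed

lemma step_mat_idem: "step_mat 1 0 n * step_mat 1 0 n = step_mat 1 0 n"
  "step_mat 0 1 n * step_mat 0 1 n = step_mat 0 1 n"
  by (simp_all add: step_mat_mult)

lemma Det_projections:
  fixes A B :: bmat and n :: int
  defines "S \<equiv> B * step_mat 0 1 0 * A" and "R \<equiv> B * step_mat 1 0 0 * A"
  assumes A: "nuclear (A * step_mat 1 0 0 - step_mat 1 0 0 * A)" and BA: "B * A = 1" "A * B = 1"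
  shows "s \<noteq> -1 \<Longrightarrow> Det (1 - sc s * (step_mat 1 0 n - R)) =
      fredholm_det {n..} (\<lambda>i j. - (s\<^sup>2) * entry S i j) * Wdet (1 + s) n A B"
    and "s \<noteq> 1 \<Longrightarrow> Det (1 - sc s * (step_mat 1 0 n - R)) =
      fredholm_det {..n-1} (\<lambda>i j. - (s\<^sup>2) * entry R i j) * Wdet (1 / (1 - s)) n A B"
proof -
  let ?P = "step_mat 1 0 n" and ?Q = "step_mat 0 1 n"
  have cancel: "B * X * A * (B * Y * A) = B * (X * Y) * A" for X Y
    by (metis BA(2) mult.assoc mult.right_neutral)
  have SS: "S * S = S" "R * R = R"
    unfolding S_def R_def cancel step_mat_idem by simp_all
  have split: "step_mat 1 0 m + step_mat 0 1 m = 1" for m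
    by (rule bmat_eqI) (simp add: entry_step_mat)
  have RS: "R + S = 1" unfolding R_def S_def by (rule conj_step_sum[OF BA(1)])
  have R1: "R = 1 - S" "S = 1 - R" using RS by (simp_all add: algebra_simps)
  have K: "nuclear (?P - R)"
    unfolding R_def by (rule nuclear_step_minus_conj[OF A BA(1)])
  show "Det (1 - sc s * (step_mat 1 0 n - R)) =
      fredholm_det {n..} (\<lambda>i j. - (s\<^sup>2) * entry S i j) * Wdet (1 + s) n A B" if "s \<noteq> -1"
  proof -
    have q: "1 + s \<noteq> 0" using that by (simp add: add_eq_0_iff)
    have K1: "?P - R = ?P + S - 1" by (simp add: R1(1))
    have F: "1 + sc s * ?P = step_mat (1 + s) 1 n"
      by (simp add: step_mat_eq_sc)
    have "1 + sc s * (1 - S) = B * step_mat (1 + s) 1 0 * A"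
      unfolding R1(1)[symmetric] R_def step_mat_eq_sc by (simp add: algebra_simps BA sc_left_commute)
    then have W: "Det ((1 + sc s * (1 - S)) * step_mat (1 / (1 + s)) 1 n) = Wdet (1 + s) n A B"
      by (simp add: Wdet_def)
    have "Det (1 - sc (s\<^sup>2) * (?P * S)) = fredholm_det {n..} (\<lambda>i j. - (s\<^sup>2) * entry (?P * S) i j)"
      by (rule Det_eq_fredholm_det) (simp add: entry_step_mat_mult)
    also have "\<dots> = fredholm_det {n..} (\<lambda>i j. - (s\<^sup>2) * entry S i j)"
      by (rule fredholm_det_cong) (simp add: entry_step_mat_mult)
    finally show ?thesis
      unfolding K1 W[symmetric]
      using Det_idempotents[OF step_mat_idem(1) SS(1) K[unfolded K1], of s "step_mat (1 / (1 + s)) 1 n"]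
      by (simp add: F step_mat_inverse1[OF q])
  qed
  show "Det (1 - sc s * (step_mat 1 0 n - R)) =
      fredholm_det {..n-1} (\<lambda>i j. - (s\<^sup>2) * entry R i j) * Wdet (1 / (1 - s)) n A B" if "s \<noteq> 1"
  proof -
    have q: "1 - s \<noteq> 0" using that by simp
    have P: "?P = 1 - ?Q" using split[of n] by (simp add: algebra_simps)
    have sc: "sc (- s) = - sc s"
      by (rule bmat_eqI) (simp add: entry_step_mat)
    have QR: "?Q + R - 1 = - (?P - R)" by (simp add: P)
    have K1: "sc s * (?P - R) = sc (- s) * (?Q + R - 1)"
      unfolding sc QR by (simp only: minus_mult_minus)
    from QR have K2: "nuclear (?Q + R - 1)" by (simp only: nuclear_uminus K)
    have F: "1 + sc (- s) * step_mat 0 1 m = step_mat 1 (1 - s) m" for m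
      by (rule bmat_eqI) (auto simp: entry_step_mat)
    have "1 + sc (- s) * (1 - R) = B * (1 + sc (- s) * step_mat 0 1 0) * A"
      unfolding R1(2)[symmetric] S_def by (simp add: distrib_left distrib_right BA sc_left_commute mult.assoc)
    also have "\<dots> = B * step_mat 1 (1 - s) 0 * A" by (simp only: F)
    \<comment> \<open>Extracting the scalar 1 - s turns a step acting below 0 into one acting above
      0, with q = 1 / (1 - s). The scalar then joins the last factor, which becomes
      \<open>step_mat (1 / q) 1 n\<close>, so the same \<open>Wdet\<close> appears as in the first
      identity.\<close>
    also have "step_mat 1 (1 - s) 0 = sc (1 - s) * step_mat (1 / (1 - s)) 1 0"
      using q by (simp add: step_mat_mult)
    finally have "(1 + sc (- s) * (1 - R)) * step_mat 1 (1 / (1 - s)) n =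
        B * step_mat (1 / (1 - s)) 1 0 * A * (sc (1 - s) * step_mat 1 (1 / (1 - s)) n)"
      by (simp add: sc_left_commute sc_commute mult.assoc)
    also have "sc (1 - s) * step_mat 1 (1 / (1 - s)) n = step_mat (1 - s) 1 n"
      using q by (intro bmat_eqI) (auto simp: entry_step_mat)
    finally have W: "Det ((1 + sc (- s) * (1 - R)) * step_mat 1 (1 / (1 - s)) n) = Wdet (1 / (1 - s)) n A B"
      by (simp add: Wdet_def)
    have "Det (1 - sc (s\<^sup>2) * (?Q * R)) = fredholm_det {..n-1} (\<lambda>i j. - (s\<^sup>2) * entry (?Q * R) i j)"
      by (rule Det_eq_fredholm_det) (simp add: entry_step_mat_mult)
    also have "\<dots> = fredholm_det {..n-1} (\<lambda>i j. - (s\<^sup>2) * entry R i j)"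
      by (rule fredholm_det_cong) (simp add: entry_step_mat_mult)
    finally show ?thesis
      unfolding K1 W[symmetric]
      using Det_idempotents[OF step_mat_idem(2) SS(2) K2, of "- s" "step_mat 1 (1 / (1 - s)) n"]
        step_mat_inverse[of 1 "1 - s" n] q
      by (simp add: F)
  qed
qed

section \<open>Absolutely convergent Laurent series on the circle\<close>

lemma abs_summable_cmult:
  "(a :: int \<Rightarrow> complex) abs_summable_on UNIV \<Longrightarrow> (\<lambda>j. c * a j) abs_summable_on UNIV"
  by (simp add: norm_mult summable_on_cmult_right)

lemma abs_summable_le:
  fixes a :: "int \<Rightarrow> complex"
  assumes "M summable_on UNIV" "\<And>j. norm (a j) \<le> M j"
  shows "a abs_summable_on UNIV"
  by (rule summable_on_comparison_test[OF assms(1)]) (use assms(2) in auto)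

lemma abs_summable_add:
  fixes a b :: "int \<Rightarrow> complex"
  assumes "a abs_summable_on UNIV" "b abs_summable_on UNIV"
  shows "(\<lambda>j. a j + b j) abs_summable_on UNIV"
  by (rule abs_summable_le[OF summable_on_add[OF assms]]) (rule norm_triangle_ineq)

lemma has_integral_infsum:
  fixes f :: "int \<Rightarrow> real \<Rightarrow> complex"
  assumes cont: "\<And>j. continuous_on {l..u} (f j)"
    and le: "\<And>j x. x \<in> {l..u} \<Longrightarrow> norm (f j x) \<le> M j" and M: "M summable_on UNIV"
  shows "((\<lambda>j. integral {l..u} (f j)) has_sum integral {l..u} (\<lambda>x. \<Sum>\<^sub>\<infinity>j. f j x)) UNIV"
    and "continuous_on {l..u} (\<lambda>x. \<Sum>\<^sub>\<infinity>j. f j x)"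
proof -
  have ul: "uniform_limit {l..u} (\<lambda>X x. \<Sum>j\<in>X. f j x) (\<lambda>x. \<Sum>\<^sub>\<infinity>j. f j x) (finite_subsets_at_top UNIV)"
    by (rule Weierstrass_m_test_general[OF _ M]) (rule le)
  have c: "continuous_on {l..u} (\<lambda>x. \<Sum>j\<in>X. f j x)" for X
    by (intro continuous_on_sum cont)
  show "continuous_on {l..u} (\<lambda>x. \<Sum>\<^sub>\<infinity>j. f j x)"
    by (rule uniform_limit_theorem[OF always_eventually ul]) (use c in auto)
  obtain I J where I: "\<And>X. ((\<lambda>x. \<Sum>j\<in>X. f j x) has_integral I X) {l..u}"
    and J: "((\<lambda>x. \<Sum>\<^sub>\<infinity>j. f j x) has_integral J) {l..u}" and lim: "(I \<longlongrightarrow> J) (finite_subsets_at_top UNIV)"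
    by (rule uniform_limit_integral[OF ul c]) auto
  have "I X = (\<Sum>j\<in>X. integral {l..u} (f j))" if "finite X" for X
    using integral_unique[OF I[of X]] that
    by (simp add: integral_sum integrable_continuous_real cont)
  then have "((\<lambda>X. \<Sum>j\<in>X. integral {l..u} (f j)) \<longlongrightarrow> J) (finite_subsets_at_top UNIV)"
    by (intro Lim_transform_eventually[OF lim] eventually_finite_subsets_at_top_weakI) auto
  then show "((\<lambda>j. integral {l..u} (f j)) has_sum integral {l..u} (\<lambda>x. \<Sum>\<^sub>\<infinity>j. f j x)) UNIV"
    unfolding has_sum_def integral_unique[OF J] .
qed

definition laurent :: "(int \<Rightarrow> complex) \<Rightarrow> complex \<Rightarrow> complex" where
  "laurent a z = (\<Sum>\<^sub>\<infinity>j. a j * z powi j)"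

lemma norm_powi_sphere [simp]: "(z::complex) \<in> sphere 0 1 \<Longrightarrow> norm (z powi j) = 1"
  by (simp add: norm_power_int)

lemma cis_in_sphere [simp]: "cis t \<in> sphere 0 1"
  by simp

lemma sphere_cis:
  assumes "z \<in> sphere 0 1"
  obtains t where "0 \<le> t" "t \<le> 2 * pi" "z = cis t"
proof
  show "0 \<le> Arg2pi z" "Arg2pi z \<le> 2 * pi" using Arg2pi[of z] by auto
  show "z = cis (Arg2pi z)" using Arg2pi[of z] assms by (simp add: cis_conv_exp is_Arg_def)
qed

lemma laurent_has_sum:
  assumes "a abs_summable_on UNIV" "z \<in> sphere 0 1"
  shows "((\<lambda>j. a j * z powi j) has_sum laurent a z) UNIV"
  unfolding laurent_def
  by (rule has_sum_infsum, rule abs_summable_summable, rule abs_summable_mult_bounded[OF assms(1), of _ 1])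
     (use assms in simp)

lemma continuous_on_laurent:
  assumes "a abs_summable_on UNIV"
  shows "continuous_on (sphere 0 1) (laurent a)"
proof -
  have ul: "uniform_limit (sphere 0 1) (\<lambda>X z. \<Sum>j\<in>X. a j * z powi j) (laurent a) (finite_subsets_at_top UNIV)"
    unfolding laurent_def
    by (rule Weierstrass_m_test_general[OF _ assms]) (simp add: norm_mult norm_power_int)
  have "continuous_on (sphere 0 1) (\<lambda>z. \<Sum>j\<in>X. a j * z powi j)" for X
    by (intro continuous_intros) auto
  then show ?thesis
    by (intro uniform_limit_theorem[OF always_eventually ul]) auto
qed

lemma continuous_on_circle:
  assumes "continuous_on (sphere 0 1) f"
  shows "continuous_on A (\<lambda>t. f (cis t))"
  by (rule continuous_on_compose2[OF assms]) (auto intro!: continuous_intros simp: cis_conv_exp)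

lemma has_vector_derivative_cis:
  "((\<lambda>t. cis (of_int k * t)) has_vector_derivative (\<i> * of_int k * cis (of_int k * t))) (at t within A)"
  unfolding has_vector_derivative_def
  by (rule derivative_eq_intros refl)+ (auto simp: scaleR_conv_of_real algebra_simps)

lemma cis_2pi_int: "cis (of_int k * (2 * pi)) = 1"
  by (metis cis_multiple_2pi mult.commute Ints_of_int)

lemma integral_cis:
  "integral {0..2*pi} (\<lambda>t. cis (of_int k * t)) = (if k = 0 then 2 * pi else 0)"
proof (cases "k = 0")
  case False
  have "((\<lambda>t. cis (of_int k * t)) has_integral
      (cis (of_int k * (2*pi)) / (\<i> * of_int k) - cis (of_int k * 0) / (\<i> * of_int k))) {0..2*pi}"
  proof (rule fundamental_theorem_of_calculus)
    fix t :: real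
    have "((\<lambda>t. cis (of_int k * t) / (\<i> * of_int k)) has_vector_derivative
        (\<i> * of_int k * cis (of_int k * t)) / (\<i> * of_int k)) (at t within {0..2*pi})"
      by (rule has_vector_derivative_divide[OF has_vector_derivative_cis])
    then show "((\<lambda>t. cis (of_int k * t) / (\<i> * of_int k)) has_vector_derivative
        cis (of_int k * t)) (at t within {0..2*pi})"
      using False by simp
  qed simp
  with False show ?thesis
    by (simp add: integral_unique cis_2pi_int)
qed (simp add: scaleR_conv_of_real)

lemma has_sum_integral_laurent:
  assumes a: "a abs_summable_on UNIV" and f: "continuous_on (sphere 0 1) f"
  shows "((\<lambda>k. a k * integral {l..u} (\<lambda>t. f (cis t) * cis (of_int k * t))) has_sum
    integral {l..u} (\<lambda>t. f (cis t) * laurent a (cis t))) UNIV"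
proof -
  have "compact (f ` sphere 0 1)"
    by (rule compact_continuous_image[OF f]) simp
  then obtain c where c: "\<And>z. z \<in> sphere 0 1 \<Longrightarrow> norm (f z) \<le> c"
    by (meson bounded_iff compact_imp_bounded imageI)
  note cf = continuous_on_circle[OF f]
  let ?f = "\<lambda>k t. a k * (f (cis t) * cis (of_int k * t))"
  have "((\<lambda>k. integral {l..u} (?f k)) has_sum integral {l..u} (\<lambda>t. \<Sum>\<^sub>\<infinity>k. ?f k t)) UNIV"
  proof (rule has_integral_infsum(1))
    show "continuous_on {l..u} (?f k)" for k
      by (intro continuous_intros cf)
    show "norm (?f k t) \<le> norm (a k) * c" for k t
      using c[of "cis t"] by (simp add: norm_mult mult_left_mono)
    show "(\<lambda>k. norm (a k) * c) summable_on UNIV"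
      by (rule summable_on_cmult_left[OF a])
  qed
  moreover have "(\<Sum>\<^sub>\<infinity>k. ?f k t) = f (cis t) * laurent a (cis t)" for t
    unfolding laurent_def
    by (subst infsum_cmult_right[symmetric], rule has_sum_imp_summable[OF laurent_has_sum[OF a]])
       (auto simp: cis_power_int mult.left_commute)
  ultimately show ?thesis by simp
qed

lemma fcoef_laurent:
  assumes "a abs_summable_on UNIV"
  shows "fcoef (laurent a) j = a j"
proof -
  have "((\<lambda>k. a k * integral {0..2*pi} (\<lambda>t. cis t powi (-j) * cis (of_int k * t))) has_sum
      integral {0..2*pi} (\<lambda>t. cis t powi (-j) * laurent a (cis t))) UNIV"
    by (rule has_sum_integral_laurent[OF assms]) (auto intro!: continuous_intros)
  moreover have "cis t powi (-j) * cis (of_int k * t) = cis (of_int (k - j) * t)" for k t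
    by (simp add: cis_power_int cis_mult algebra_simps)
  ultimately have "((\<lambda>k. a k * (if k = j then 2 * pi else 0)) has_sum
      integral {0..2*pi} (\<lambda>t. cis t powi (-j) * laurent a (cis t))) UNIV"
    by (simp only: integral_cis) simp
  moreover have "((\<lambda>k. a k * (if k = j then 2 * pi else 0)) has_sum a j * (2 * pi)) UNIV"
    by (rule has_sum_finite_neutralI[of "{j}"]) auto
  ultimately have "integral {0..2*pi} (\<lambda>t. cis t powi (-j) * laurent a (cis t)) = a j * (2 * pi)"
    by (rule has_sum_unique)
  moreover have "(\<lambda>t. laurent a (cis t) * cis (- of_int j * t)) = (\<lambda>t. cis t powi (-j) * laurent a (cis t))"
    by (simp add: cis_power_int mult.commute)
  ultimately show ?thesis
    unfolding fcoef_def by (simp only:) simp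
qed

lemma fcoef_cong: "(\<And>z. z \<in> sphere 0 1 \<Longrightarrow> f z = g z) \<Longrightarrow> fcoef f = fcoef g"
  by (simp add: fcoef_def fun_eq_iff)

lemma laurent_inject:
  assumes "a abs_summable_on UNIV" "b abs_summable_on UNIV"
    and "\<And>z. z \<in> sphere 0 1 \<Longrightarrow> laurent a z = laurent b z"
  shows "a = b"
  using fcoef_laurent[OF assms(1)] fcoef_laurent[OF assms(2)] fcoef_cong[OF assms(3)] by auto

lemma laurent_conv:
  assumes a: "a abs_summable_on UNIV" and b: "b abs_summable_on UNIV" and z: "z \<in> sphere 0 1"
  shows "laurent (conv a b) z = laurent a z * laurent b z"
proof -
  have shift: "((\<lambda>m. norm (a (m - k))) has_sum (\<Sum>\<^sub>\<infinity>m. norm (a m))) UNIV" for k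
    by (subst has_sum_reindex_bij_betw[of "\<lambda>m. m + k" UNIV UNIV, symmetric])
       (auto intro!: bij_betwI[of _ _ _ "\<lambda>m. m - k"] simp: a)
  have zn: "norm (z powi m) = 1" for m using z by simp
  have z0: "z \<noteq> 0" using z by auto
  have sum: "(\<lambda>(k, m). a (m - k) * b k * z powi m) abs_summable_on UNIV \<times> UNIV"
  proof (rule summable_on_SigmaI)
    fix k
    show "((\<lambda>m. norm (case (k, m) of (k, m) \<Rightarrow> a (m - k) * b k * z powi m)) has_sum
        (\<Sum>\<^sub>\<infinity>m. norm (a m)) * norm (b k)) UNIV"
      using has_sum_cmult_left[OF shift[of k], of "norm (b k)"] by (simp add: norm_mult zn)
    show "(\<lambda>k. (\<Sum>\<^sub>\<infinity>m. norm (a m)) * norm (b k)) summable_on UNIV"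
      by (rule summable_on_cmult_right[OF b])
  qed simp
  have s1: "(\<lambda>k. a (m - k) * b k) summable_on UNIV" for m
  proof (rule abs_summable_summable)
    have "(\<lambda>k. norm (a (m - k))) summable_on UNIV"
      by (subst summable_on_reindex_bij_betw[of "\<lambda>k. m - k" UNIV UNIV])
         (auto intro!: bij_betwI[of _ _ _ "\<lambda>k. m - k"] simp: a)
    then show "(\<lambda>k. a (m - k) * b k) abs_summable_on UNIV"
      by (rule abs_summable_mult_bounded[where c = "\<Sum>\<^sub>\<infinity>k. norm (b k)"])
         (use sum_norm_le_infsum[OF b, of "{_}"] in simp)
  qed
  have "laurent (conv a b) z = (\<Sum>\<^sub>\<infinity>m. \<Sum>\<^sub>\<infinity>k. a (m - k) * b k * z powi m)"
    unfolding laurent_def conv_def by (intro infsum_cong infsum_cmult_left[symmetric] s1)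
  also have "\<dots> = (\<Sum>\<^sub>\<infinity>k. \<Sum>\<^sub>\<infinity>m. a (m - k) * b k * z powi m)"
    by (rule infsum_swap_banach[symmetric], rule abs_summable_summable, rule sum)
  also have "\<dots> = (\<Sum>\<^sub>\<infinity>k. laurent a z * (b k * z powi k))"
  proof (rule infsum_cong)
    fix k
    have "(\<Sum>\<^sub>\<infinity>m. a (m - k) * b k * z powi m) = (\<Sum>\<^sub>\<infinity>m. a (m + k - k) * b k * z powi (m + k))"
      by (rule infsum_reindex_bij_betw[symmetric]) (rule bij_betwI[of _ _ _ "\<lambda>m. m - k"], auto)
    also have "\<dots> = (\<Sum>\<^sub>\<infinity>m. a m * z powi m * (b k * z powi k))"
      using z0 by (intro infsum_cong) (simp add: power_int_add mult_ac)
    also have "\<dots> = laurent a z * (b k * z powi k)"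
      unfolding laurent_def
      by (rule infsum_cmult_left) (rule has_sum_imp_summable[OF laurent_has_sum[OF a z]])
    finally show "(\<Sum>\<^sub>\<infinity>m. a (m - k) * b k * z powi m) = laurent a z * (b k * z powi k)" .
  qed
  also have "\<dots> = laurent a z * laurent b z"
    unfolding laurent_def[of b]
    by (rule infsum_cmult_right) (rule has_sum_imp_summable[OF laurent_has_sum[OF b z]])
  finally show ?thesis .
qed

lemma laurent_add:
  assumes "a abs_summable_on UNIV" "b abs_summable_on UNIV" "z \<in> sphere 0 1"
  shows "laurent (\<lambda>j. a j + b j) z = laurent a z + laurent b z"
  using infsum_add[OF has_sum_imp_summable[OF laurent_has_sum[OF assms(1,3)]]
      has_sum_imp_summable[OF laurent_has_sum[OF assms(2,3)]]]
  by (simp add: laurent_def distrib_right)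

lemma laurent_cmult: "laurent (\<lambda>j. c * a j) z = c * laurent a z"
  unfolding laurent_def mult.assoc by (rule infsum_cmult_right')

lemma laurent_delta: "laurent (delta k) z = z powi k"
proof -
  have "laurent (delta k) z = delta k k * z powi k"
    unfolding laurent_def by (rule infsum_single) (simp add: delta_def)
  then show ?thesis by (simp add: delta_def)
qed

text \<open>On the circle \<open>cnj z\<close> equals the inverse of \<open>z\<close>, so
  real-linear functions are combinations of z and 1/z; sums and products stay in the class. This
  feeds the Stone-Weierstrass theorem.\<close>

lemma real_polynomial_laurent:
  assumes "real_polynomial_function (p :: complex \<Rightarrow> real)"
  shows "\<exists>a. a abs_summable_on UNIV \<and> (\<forall>z\<in>sphere 0 1. of_real (p z) = laurent a z)"
  using assms
proof induction
  case (linear f)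
  then interpret bounded_linear f .
  \<comment> \<open>The coefficients in f z = \<open>\<alpha>\<close> z + \<open>\<beta>\<close>
    \<open>cnj z\<close>, the general form of a real-linear map.\<close>
  define \<alpha> \<beta> :: complex where "\<alpha> = (f 1 - \<i> * f \<i>) / 2" and "\<beta> = (f 1 + \<i> * f \<i>) / 2"
  have s: "(\<lambda>j. \<alpha> * delta 1 j) abs_summable_on UNIV" "(\<lambda>j. \<beta> * delta (-1) j) abs_summable_on UNIV"
    by (intro abs_summable_cmult abs_summable_delta)+
  have "of_real (f z) = laurent (\<lambda>j. \<alpha> * delta 1 j + \<beta> * delta (-1) j) z" if z: "z \<in> sphere 0 1" for z
  proof -
    have "z = Re z *\<^sub>R 1 + Im z *\<^sub>R \<i>" by (simp add: complex_eq_iff)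
    then have "f z = Re z * f 1 + Im z * f \<i>" by (metis add scaleR real_scaleR_def)
    moreover have iz: "inverse z = cnj z"
      using z by (simp add: inverse_complex_def complex_eq_iff cmod_power2[symmetric])
    moreover from iz have "z powi (-1) = cnj z" by (simp add: power_int_minus)
    ultimately show ?thesis
      unfolding laurent_add[OF s z] laurent_cmult laurent_delta
      by (simp add: \<alpha>_def \<beta>_def complex_eq_iff) (simp add: field_simps)
  qed
  then show ?case
    by (intro exI[of _ "\<lambda>j. \<alpha> * delta 1 j + \<beta> * delta (-1) j"] conjI ballI abs_summable_add[OF s])
next
  case (const c)
  show ?case
    by (rule exI[of _ "\<lambda>j. of_real c * delta 0 j"])
       (simp add: laurent_cmult laurent_delta abs_summable_cmult[OF abs_summable_delta])
next
  case (add f g)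
  then obtain a b where ab: "a abs_summable_on UNIV" "b abs_summable_on UNIV"
    "\<forall>z\<in>sphere 0 1. of_real (f z) = laurent a z" "\<forall>z\<in>sphere 0 1. of_real (g z) = laurent b z" by blast
  then show ?case
    by (intro exI[of _ "\<lambda>j. a j + b j"] conjI abs_summable_add) (auto simp: laurent_add)
next
  case (mult f g)
  then obtain a b where ab: "a abs_summable_on UNIV" "b abs_summable_on UNIV"
    "\<forall>z\<in>sphere 0 1. of_real (f z) = laurent a z" "\<forall>z\<in>sphere 0 1. of_real (g z) = laurent b z" by blast
  then show ?case
    by (intro exI[of _ "conv a b"] conjI abs_summable_conv) (auto simp: laurent_conv)
qed

lemma laurent_dense:
  assumes "continuous_on (sphere 0 1) (f :: complex \<Rightarrow> complex)" "0 < e"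
  obtains a where "a abs_summable_on UNIV" "\<And>z. z \<in> sphere 0 1 \<Longrightarrow> norm (f z - laurent a z) < e"
proof -
  obtain g where g: "polynomial_function g" "\<And>z. z \<in> sphere 0 1 \<Longrightarrow> norm (f z - g z) < e"
    using Stone_Weierstrass_polynomial_function[OF compact_sphere assms] by blast
  have "real_polynomial_function (Re \<circ> g)" "real_polynomial_function (Im \<circ> g)"
    using g(1) bounded_linear_Re bounded_linear_Im by (auto simp: polynomial_function_def)
  then obtain a b where a: "a abs_summable_on UNIV" "\<And>z. z \<in> sphere 0 1 \<Longrightarrow> of_real (Re (g z)) = laurent a z"
    and b: "b abs_summable_on UNIV" "\<And>z. z \<in> sphere 0 1 \<Longrightarrow> of_real (Im (g z)) = laurent b z"
    using real_polynomial_laurent[of "Re \<circ> g"] real_polynomial_laurent[of "Im \<circ> g"] by auto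
  note b' = abs_summable_cmult[OF b(1), of \<i>]
  show ?thesis
  proof
    show "(\<lambda>j. a j + \<i> * b j) abs_summable_on UNIV"
      by (rule abs_summable_add[OF a(1) b'])
    fix z :: complex assume z: "z \<in> sphere 0 1"
    have "laurent (\<lambda>j. a j + \<i> * b j) z = g z"
      by (simp only: laurent_add[OF a(1) b' z] laurent_cmult a(2)[OF z, symmetric] b(2)[OF z, symmetric])
         (simp add: complex_eq_iff)
    then show "norm (f z - laurent (\<lambda>j. a j + \<i> * b j) z) < e" using g(2)[OF z] by simp
  qed
qed

text \<open>\<open>f\<close> integrates to 0 against every absolutely convergent Laurent series;
  approximating \<open>cnj f\<close> uniformly by such series gives a vanishing integral of
  |f|^2.\<close>

lemma fcoef_zero_imp_zero:
  assumes f: "continuous_on (sphere 0 1) f" and zero: "\<And>j. fcoef f j = 0" and z: "z \<in> sphere 0 1"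
  shows "f z = 0"
proof -
  let ?I = "integral {0..2*pi}"
  note cf = continuous_on_circle[OF f, of "{0..2*pi}"]
  have orth: "?I (\<lambda>t. f (cis t) * laurent a (cis t)) = 0" if a: "a abs_summable_on UNIV" for a
  proof -
    have "?I (\<lambda>t. f (cis t) * cis (of_int k * t)) = 0" for k
      using zero[of "- k"] by (simp add: fcoef_def)
    then have "((\<lambda>k::int. 0) has_sum ?I (\<lambda>t. f (cis t) * laurent a (cis t))) UNIV"
      using has_sum_integral_laurent[OF a f, of 0 "2*pi"] by simp
    then show ?thesis using has_sum_unique[OF _ has_sum_0_simp] by blast
  qed
  have "compact (f ` sphere 0 1)"
    by (rule compact_continuous_image[OF f]) simp
  then obtain c where c: "\<And>z. z \<in> sphere 0 1 \<Longrightarrow> norm (f z) \<le> c"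
    by (meson bounded_iff compact_imp_bounded imageI)
  have c0: "0 \<le> c" using c[of 1] norm_ge_zero[of "f 1"] by (simp del: norm_ge_zero)
  have le: "norm (?I (\<lambda>t. f (cis t) * cnj (f (cis t)))) \<le> e" if "e > 0" for e
  proof -
    \<comment> \<open>Chosen so that the error c d 2 pi equals e c / (c + 1), at most e; the summand
      1 guards against c = 0.\<close>
    define d where "d = e / (2 * pi * (c + 1))"
    have d: "0 < d" using that c0 by (simp add: d_def)
    have "continuous_on (sphere 0 1) (\<lambda>z. cnj (f z))" by (intro continuous_intros f)
    then obtain a where a: "a abs_summable_on UNIV" "\<And>z. z \<in> sphere 0 1 \<Longrightarrow> norm (cnj (f z) - laurent a z) < d"
      using laurent_dense d by blast
    note ca = continuous_on_circle[OF continuous_on_laurent[OF a(1)], of "{0..2*pi}"]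
    have "?I (\<lambda>t. f (cis t) * cnj (f (cis t))) =
        ?I (\<lambda>t. f (cis t) * cnj (f (cis t))) - ?I (\<lambda>t. f (cis t) * laurent a (cis t))"
      by (simp add: orth[OF a(1)])
    also have "\<dots> = ?I (\<lambda>t. f (cis t) * cnj (f (cis t)) - f (cis t) * laurent a (cis t))"
      by (rule integral_diff[symmetric]) (intro integrable_continuous_real continuous_intros cf ca)+
    also have "norm \<dots> \<le> c * d * (2 * pi - 0)"
    proof (rule integral_bound)
      fix t
      have "norm (f (cis t) * (cnj (f (cis t)) - laurent a (cis t))) \<le> c * d"
        unfolding norm_mult by (intro mult_mono c less_imp_le[OF a(2)]) (use c0 in auto)
      then show "norm (f (cis t) * cnj (f (cis t)) - f (cis t) * laurent a (cis t)) \<le> c * d"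
        by (simp add: right_diff_distrib)
    qed (auto intro!: continuous_intros cf ca)
    also have "\<dots> = e * (c / (c + 1))" using c0 by (simp add: d_def)
    also have "\<dots> \<le> e * 1" using that c0 by (intro mult_left_mono) auto
    finally show ?thesis by simp
  qed
  have "?I (\<lambda>t. f (cis t) * cnj (f (cis t))) = of_real (?I (\<lambda>t. (norm (f (cis t)))\<^sup>2))"
    unfolding complex_norm_square[symmetric]
    by (rule integral_unique, rule has_integral_linear[OF integrable_integral bounded_linear_of_real, unfolded o_def])
       (intro integrable_continuous_real continuous_intros cf)
  then have "norm (of_real (?I (\<lambda>t. (norm (f (cis t)))\<^sup>2)) :: complex) \<le> 0"
    using le by (metis field_le_epsilon add_0)
  then have "?I (\<lambda>t. (norm (f (cis t)))\<^sup>2) = 0" by simp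
  then have "\<forall>t\<in>{0..2*pi}. (norm (f (cis t)))\<^sup>2 = 0"
    by (subst (asm) integral_eq_0_iff) (auto intro!: continuous_intros cf)
  moreover obtain t where "0 \<le> t" "t \<le> 2 * pi" "z = cis t" using z by (rule sphere_cis)
  ultimately show ?thesis by auto
qed

lemma fcoef_diff:
  assumes "continuous_on (sphere 0 1) f" "continuous_on (sphere 0 1) g"
  shows "fcoef (\<lambda>z. f z - g z) j = fcoef f j - fcoef g j"
proof -
  have c: "(\<lambda>t. h (cis t) * cis (- of_int j * t)) integrable_on {0..2*pi}" if "continuous_on (sphere 0 1) h" for h
    by (intro integrable_continuous_real continuous_intros continuous_on_circle that)
  show ?thesis
    unfolding fcoef_def left_diff_distrib
    by (subst integral_diff[OF c c]) (use assms in \<open>auto simp: right_diff_distrib\<close>)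
qed

text \<open>The difference of the two sides is continuous and has vanishing Fourier coefficients.
  Summability makes the inversion pointwise rather than in the mean.\<close>

lemma laurent_fcoef:
  assumes f: "continuous_on (sphere 0 1) f" and s: "fcoef f abs_summable_on UNIV" and z: "z \<in> sphere 0 1"
  shows "laurent (fcoef f) z = f z"
proof -
  have "f z - laurent (fcoef f) z = 0"
    by (rule fcoef_zero_imp_zero[OF _ _ z])
       (auto simp: fcoef_diff f continuous_on_laurent s fcoef_laurent intro!: continuous_intros)
  then show ?thesis by simp
qed

section \<open>Differentiable functions and exponentials\<close>

text \<open>The Fourier coefficients of the derivative in the angle \<open>t\<close> of z =
  \<open>cis t\<close>.\<close>

definition dcoef :: "(int \<Rightarrow> complex) \<Rightarrow> int \<Rightarrow> complex" where
  "dcoef a j = \<i> * of_int j * a j"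

text \<open>The weighted Wiener class in which the theorem places \<open>\<phi>\<close>. The weight
  vanishes at 0, so the zeroth coefficient is added separately when plain summability is
  derived.\<close>

definition wsummable :: "(int \<Rightarrow> complex) \<Rightarrow> bool" where
  "wsummable a \<longleftrightarrow> (\<lambda>j. norm (of_int j * a j)) summable_on UNIV"

lemma abs_summable_dcoef: "wsummable a \<Longrightarrow> dcoef a abs_summable_on UNIV"
  by (simp add: wsummable_def dcoef_def norm_mult)

lemma wsummable_dcoef: "dcoef a abs_summable_on UNIV \<Longrightarrow> wsummable a"
  by (simp add: wsummable_def dcoef_def norm_mult)

lemma wsummable_imp_abs_summable:
  assumes "wsummable a" shows "a abs_summable_on UNIV"
proof (rule abs_summable_le)
  show "(\<lambda>j. norm (of_int j * a j) + norm (a j * delta 0 j)) summable_on UNIV"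
    using assms abs_summable_finite_support[of "{0}" "\<lambda>j. a j * delta 0 j"]
    by (intro summable_on_add) (auto simp: wsummable_def delta_def)
  fix j
  show "norm (a j) \<le> norm (of_int j * a j) + norm (a j * delta 0 j)"
  proof (cases "j = 0")
    case False
    then have "1 * norm (a j) \<le> \<bar>of_int j\<bar> * norm (a j)"
      by (intro mult_right_mono) auto
    with False show ?thesis by (simp add: norm_mult delta_def)
  qed (simp add: delta_def)
qed

lemma laurent_FTC:
  assumes a: "wsummable a" and "l \<le> u"
  shows "integral {l..u} (\<lambda>t. laurent (dcoef a) (cis t)) = laurent a (cis u) - laurent a (cis l)"
proof -
  note as = wsummable_imp_abs_summable[OF a]
  have i: "dcoef a k * integral {l..u} (\<lambda>t. 1 * cis (of_int k * t)) =
      a k * cis u powi k - a k * cis l powi k" for k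
  proof (cases "k = 0")
    case False
    have "((\<lambda>t. \<i> * of_int k * cis (of_int k * t)) has_integral
        cis (of_int k * u) - cis (of_int k * l)) {l..u}"
      by (rule fundamental_theorem_of_calculus[OF \<open>l \<le> u\<close>]) (rule has_vector_derivative_cis)
    then have "\<i> * of_int k * integral {l..u} (\<lambda>t. cis (of_int k * t)) = cis (of_int k * u) - cis (of_int k * l)"
      by (simp add: integral_unique flip: integral_mult_right)
    then show ?thesis
      by (simp add: dcoef_def cis_power_int mult_ac right_diff_distrib[symmetric])
  qed (simp add: dcoef_def)
  have "((\<lambda>k. a k * cis u powi k - a k * cis l powi k) has_sum
      integral {l..u} (\<lambda>t. 1 * laurent (dcoef a) (cis t))) UNIV"
    unfolding i[symmetric]
    by (rule has_sum_integral_laurent[OF abs_summable_dcoef[OF a]]) (rule continuous_on_const)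
  moreover have "((\<lambda>k. a k * cis u powi k - a k * cis l powi k) has_sum
      laurent a (cis u) - laurent a (cis l)) UNIV"
    using has_sum_add[OF laurent_has_sum[OF as] has_sum_uminusI[OF laurent_has_sum[OF as]], of "cis u" "cis l"]
    by simp
  ultimately show ?thesis using has_sum_unique by fastforce
qed

text \<open>The derivative series is first integrated termwise, then the integral is differentiated;
  this replaces differentiation under the sum.\<close>

lemma laurent_has_vector_derivative:
  assumes a: "wsummable a"
  shows "((\<lambda>t. laurent a (cis t)) has_vector_derivative laurent (dcoef a) (cis t)) (at t)"
proof -
  let ?l = "t - 1" and ?u = "t + 1"
  have c: "continuous_on {?l..?u} (\<lambda>t. laurent (dcoef a) (cis t))"
    by (rule continuous_on_circle[OF continuous_on_laurent[OF abs_summable_dcoef[OF a]]])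
  have "((\<lambda>x. integral {?l..x} (\<lambda>t. laurent (dcoef a) (cis t))) has_vector_derivative
      laurent (dcoef a) (cis t)) (at t within {?l..?u})"
    by (rule integral_has_vector_derivative[OF c]) simp
  moreover have "at t within {?l..?u} = at t"
    by (rule at_within_interior) simp
  ultimately have "((\<lambda>x. integral {?l..x} (\<lambda>t. laurent (dcoef a) (cis t)) + laurent a (cis ?l))
      has_vector_derivative laurent (dcoef a) (cis t)) (at t)"
    by (simp add: has_vector_derivative_add_const)
  then show ?thesis
    by (rule has_vector_derivative_transform_within_open[of _ _ _ "{?l<..<?u}"])
       (auto simp: laurent_FTC[OF a])
qed

section \<open>Fourier coefficients of continuously differentiable functions\<close>

lemma fcoef_has_integral:
  assumes "continuous_on (sphere 0 1) f"
  shows "((\<lambda>t. f (cis t) * cis (- of_int j * t)) has_integral 2 * pi * fcoef f j) {0..2*pi}"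
proof -
  have "(\<lambda>t. f (cis t) * cis (- of_int j * t)) integrable_on {0..2*pi}"
    by (intro integrable_continuous_real continuous_intros continuous_on_circle assms)
  then show ?thesis by (simp add: fcoef_def integrable_integral)
qed

lemma fcoef_derivative:
  assumes f': "continuous_on (sphere 0 1) f'"
    and f: "continuous_on (sphere 0 1) f"
    and d: "\<And>t. ((\<lambda>t. f (cis t)) has_vector_derivative f' (cis t)) (at t)"
  shows "fcoef f' j = \<i> * of_int j * fcoef f j"
proof -
  let ?e = "\<lambda>t. cis (of_int (- j) * t)"
  have "((\<lambda>t. f (cis t) * (\<i> * of_int (-j) * ?e t) + f' (cis t) * ?e t) has_integral
      f (cis (2*pi)) * ?e (2*pi) - f (cis 0) * ?e 0) {0..2*pi}"
  proof (rule fundamental_theorem_of_calculus)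
    show "((\<lambda>t. f (cis t) * ?e t) has_vector_derivative
        f (cis t) * (\<i> * of_int (-j) * ?e t) + f' (cis t) * ?e t) (at t within {0..2*pi})" for t
      by (rule has_vector_derivative_mult[OF has_vector_derivative_at_within[OF d] has_vector_derivative_cis])
  qed simp
  moreover have "((\<lambda>t. (\<i> * of_int (-j)) * (f (cis t) * cis (- of_int j * t)) + f' (cis t) * cis (- of_int j * t)) has_integral
      (\<i> * of_int (-j)) * (2 * pi * fcoef f j) + 2 * pi * fcoef f' j) {0..2*pi}"
    by (intro has_integral_add has_integral_mult_right fcoef_has_integral f f')
  ultimately have "f (cis (2*pi)) * ?e (2*pi) - f (cis 0) * ?e 0 =
      (\<i> * of_int (-j)) * (2 * pi * fcoef f j) + 2 * pi * fcoef f' j"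
    by (intro has_integral_unique[of _ _ "{0..2*pi}"]) (simp_all add: mult_ac)
  moreover have "?e (2*pi) = 1" by (rule cis_2pi_int)
  ultimately have "2 * pi * fcoef f' j = 2 * pi * (\<i> * of_int j * fcoef f j)"
    by simp
  then show ?thesis by simp
qed

lemma Bessel_inequality:
  assumes f: "continuous_on (sphere 0 1) f"
  obtains M where "\<And>F. finite F \<Longrightarrow> (\<Sum>j\<in>F. (norm (fcoef f j))\<^sup>2) \<le> M"
proof
  fix F :: "int set" assume F: "finite F"
  let ?c = "fcoef f" and ?I = "{0..2*pi}"
  let ?N = "integral ?I (\<lambda>t. f (cis t) * cnj (f (cis t)))"
  let ?p = "\<lambda>t. \<Sum>j\<in>F. ?c j * cis (of_int j * t)"
  \<comment> \<open>The integrals \<open>1\<close> to \<open>4\<close> are the four terms in the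
    expansion of |f - p|^2, where p is the Fourier sum \<open>?p\<close> over
    \<open>F\<close>.\<close>
  have 1: "((\<lambda>t. f (cis t) * cnj (f (cis t))) has_integral ?N) ?I"
    by (intro integrable_integral integrable_continuous_real continuous_intros continuous_on_circle f)
  have 2: "((\<lambda>t. \<Sum>j\<in>F. cnj (?c j) * (f (cis t) * cis (- of_int j * t))) has_integral
      (\<Sum>j\<in>F. cnj (?c j) * (2 * pi * ?c j))) ?I"
    by (intro has_integral_sum F has_integral_mult_right fcoef_has_integral f)
  have 3: "((\<lambda>t. \<Sum>j\<in>F. ?c j * cnj (f (cis t) * cis (- of_int j * t))) has_integral
      (\<Sum>j\<in>F. ?c j * cnj (2 * pi * ?c j))) ?I"
    by (intro has_integral_sum F has_integral_mult_right has_integral_cnj[unfolded o_def, THEN iffD2] fcoef_has_integral f)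
  have 4: "((\<lambda>t. \<Sum>j\<in>F. \<Sum>k\<in>F. ?c j * cnj (?c k) * cis (of_int (j - k) * t)) has_integral
      (\<Sum>j\<in>F. \<Sum>k\<in>F. ?c j * cnj (?c k) * (if j - k = 0 then 2 * pi else 0))) ?I"
    unfolding integral_cis[symmetric]
    by (intro has_integral_sum F has_integral_mult_right integrable_integral integrable_continuous_real continuous_intros)
  have "((\<lambda>t. (f (cis t) - ?p t) * cnj (f (cis t) - ?p t)) has_integral
      ?N - (\<Sum>j\<in>F. cnj (?c j) * (2 * pi * ?c j)) - (\<Sum>j\<in>F. ?c j * cnj (2 * pi * ?c j)) +
      (\<Sum>j\<in>F. \<Sum>k\<in>F. ?c j * cnj (?c k) * (if j - k = 0 then 2 * pi else 0))) ?I"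
  proof (rule has_integral_eq[OF _ has_integral_add[OF has_integral_diff[OF has_integral_diff[OF 1 2] 3] 4]])
    fix t
    have p': "cnj (?p t) = (\<Sum>k\<in>F. cnj (?c k) * cis (- of_int k * t))"
      by (simp add: cis_cnj)
    have pp: "?p t * cnj (?p t) = (\<Sum>j\<in>F. \<Sum>k\<in>F. ?c j * cnj (?c k) * cis (of_int (j - k) * t))"
      unfolding p' sum_product
    proof (intro sum.cong refl)
      fix j k
      have "cis (of_int (j - k) * t) = cis (of_int j * t) * cis (- of_int k * t)"
        by (simp add: cis_mult algebra_simps)
      then show "?c j * cis (of_int j * t) * (cnj (?c k) * cis (- of_int k * t)) =
          ?c j * cnj (?c k) * cis (of_int (j - k) * t)" by simp
    qed
    have fp: "f (cis t) * cnj (?p t) = (\<Sum>j\<in>F. cnj (?c j) * (f (cis t) * cis (- of_int j * t)))"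
      unfolding p' by (simp add: sum_distrib_left mult_ac)
    have pf: "?p t * cnj (f (cis t)) = (\<Sum>j\<in>F. ?c j * cnj (f (cis t) * cis (- of_int j * t)))"
      unfolding sum_distrib_right by (intro sum.cong refl) (simp add: cis_cnj mult_ac)
    show "f (cis t) * cnj (f (cis t)) - (\<Sum>j\<in>F. cnj (?c j) * (f (cis t) * cis (- of_int j * t))) -
        (\<Sum>j\<in>F. ?c j * cnj (f (cis t) * cis (- of_int j * t))) +
        (\<Sum>j\<in>F. \<Sum>k\<in>F. ?c j * cnj (?c k) * cis (of_int (j - k) * t)) =
        (f (cis t) - ?p t) * cnj (f (cis t) - ?p t)"
      unfolding pp[symmetric] fp[symmetric] pf[symmetric] by (simp add: algebra_simps)
  qed
  also have "(\<Sum>j\<in>F. \<Sum>k\<in>F. ?c j * cnj (?c k) * (if j - k = 0 then 2 * pi else 0)) =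
      (\<Sum>j\<in>F. ?c j * cnj (2 * pi * ?c j))"
  proof (rule sum.cong[OF refl])
    fix j assume "j \<in> F"
    have "(\<Sum>k\<in>F. ?c j * cnj (?c k) * (if j - k = 0 then 2 * pi else 0)) =
        (\<Sum>k\<in>F. if j = k then ?c j * cnj (2 * pi * ?c j) else 0)"
      by (rule sum.cong) auto
    then show "(\<Sum>k\<in>F. ?c j * cnj (?c k) * (if j - k = 0 then 2 * pi else 0)) = ?c j * cnj (2 * pi * ?c j)"
      using F \<open>j \<in> F\<close> by simp
  qed
  finally have "((\<lambda>t. (f (cis t) - ?p t) * cnj (f (cis t) - ?p t)) has_integral
      ?N - (\<Sum>j\<in>F. cnj (?c j) * (2 * pi * ?c j))) ?I" by simp
  from has_integral_linear[OF this bounded_linear_Re]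
  have "0 \<le> Re (?N - (\<Sum>j\<in>F. cnj (?c j) * (2 * pi * ?c j)))"
    by (rule has_integral_nonneg) (unfold o_def complex_norm_square[symmetric], simp)
  also have "(\<Sum>j\<in>F. cnj (?c j) * (2 * pi * ?c j)) = of_real (2 * pi * (\<Sum>j\<in>F. (norm (?c j))\<^sup>2))"
    unfolding of_real_mult of_real_sum sum_distrib_left complex_norm_square
    by (intro sum.cong refl) (simp add: mult_ac)
  finally have "2 * pi * (\<Sum>j\<in>F. (norm (?c j))\<^sup>2) \<le> Re ?N" by simp
  then show "(\<Sum>j\<in>F. (norm (?c j))\<^sup>2) \<le> Re ?N / (2 * pi)"
    by (simp add: field_simps)
qed

lemma summable_on_inverse_square_int: "(\<lambda>j::int. 1 / (of_int j)\<^sup>2 :: real) summable_on UNIV"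
proof -
  have n: "(\<lambda>n::nat. 1 / (real n)\<^sup>2) summable_on UNIV"
    using inverse_power_summable[of 2, where 'a = real]
    by (intro summable_nonneg_imp_summable_on) (simp_all add: field_simps)
  have "(\<lambda>j::int. 1 / (of_int j)\<^sup>2 :: real) summable_on range int"
    by (subst summable_on_reindex) (use n in \<open>auto simp: o_def\<close>)
  moreover have "(\<lambda>j::int. 1 / (of_int j)\<^sup>2 :: real) summable_on range (\<lambda>n. - int n)"
    by (subst summable_on_reindex) (use n in \<open>auto simp: o_def inj_on_def\<close>)
  ultimately have "(\<lambda>j::int. 1 / (of_int j)\<^sup>2 :: real) summable_on (range int \<union> range (\<lambda>n. - int n))"
    by (rule summable_on_union)
  moreover have "range int \<union> range (\<lambda>n. - int n) = UNIV"
  proof -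
    have "j \<in> range int \<union> range (\<lambda>n. - int n)" for j :: int
      by (cases j rule: int_cases2) auto
    then show ?thesis by auto
  qed
  ultimately show ?thesis by simp
qed

text \<open>For j not 0, |f_j| = |f'_j| / |j| is at most 1/j^2 + |f'_j|^2, and the last term is
  summable by Bessel's inequality. The \<open>delta 0\<close> term covers j = 0.\<close>

lemma abs_summable_fcoef_C1:
  assumes f': "continuous_on (sphere 0 1) f'"
    and f: "continuous_on (sphere 0 1) f"
    and d: "\<And>t. ((\<lambda>t. f (cis t)) has_vector_derivative f' (cis t)) (at t)"
  shows "fcoef f abs_summable_on UNIV"
proof -
  obtain M where M: "\<And>F. finite F \<Longrightarrow> (\<Sum>j\<in>F. (norm (fcoef f' j))\<^sup>2) \<le> M"
    using Bessel_inequality[OF f'] by blast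
  have s: "(\<lambda>j. (norm (fcoef f' j))\<^sup>2) summable_on UNIV"
    using abs_summable_bounded_sums(1)[of "\<lambda>j. (norm (fcoef f' j))\<^sup>2" M] M by simp
  have "(\<lambda>j. fcoef f j * delta 0 j) abs_summable_on UNIV"
    by (rule abs_summable_finite_support[of "{0}"]) (auto simp: delta_def)
  then have "(\<lambda>j. norm (fcoef f j * delta 0 j) + (1 / (of_int j)\<^sup>2 + (norm (fcoef f' j))\<^sup>2)) summable_on UNIV"
    by (intro summable_on_add s summable_on_inverse_square_int)
  then show ?thesis
  proof (rule abs_summable_le)
    fix j
    show "norm (fcoef f j) \<le> norm (fcoef f j * delta 0 j) + (1 / (of_int j)\<^sup>2 + (norm (fcoef f' j))\<^sup>2)"
    proof (cases "j = 0")
      case False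
      define x y :: real where "x = 1 / \<bar>of_int j\<bar>" and "y = norm (fcoef f' j)"
      have "norm (fcoef f j) = x * y"
        using False by (simp add: x_def y_def fcoef_derivative[OF f' f d] norm_mult)
      also have "\<dots> \<le> x\<^sup>2 + y\<^sup>2"
      proof -
        have "0 \<le> x * y" by (simp add: x_def y_def)
        moreover have "2 * (x * y) \<le> x\<^sup>2 + y\<^sup>2" using sum_squares_bound[of x y] by simp
        ultimately show ?thesis by linarith
      qed
      finally show ?thesis using False by (simp add: x_def y_def power_divide delta_def)
    qed (simp add: delta_def)
  qed
qed

text \<open>A bootstrap: 1/f is C^1, so its coefficients are absolutely summable; its derivative
  -f'/f^2 is then a product of absolutely convergent series, which gives the weighted
  summability.\<close>

lemma inverse_laurent:
  assumes f: "continuous_on (sphere 0 1) f" and nz: "\<And>z. z \<in> sphere 0 1 \<Longrightarrow> f z \<noteq> 0"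
    and w: "wsummable (fcoef f)"
  shows "wsummable (fcoef (\<lambda>z. inverse (f z)))"
proof -
  let ?f' = "laurent (dcoef (fcoef f))"
  have s: "fcoef f abs_summable_on UNIV" by (rule wsummable_imp_abs_summable[OF w])
  have ci: "continuous_on (sphere 0 1) (\<lambda>z. inverse (f z))"
    by (intro continuous_intros f) (use nz in auto)
  have ci': "continuous_on (sphere 0 1) (\<lambda>z. - (inverse (f z) * ?f' z * inverse (f z)))"
    by (intro continuous_intros ci continuous_on_laurent abs_summable_dcoef w)
  have d: "((\<lambda>t. inverse (f (cis t))) has_vector_derivative
      - (inverse (f (cis t)) * ?f' (cis t) * inverse (f (cis t)))) (at t)" for t
  proof -
    have "((\<lambda>t. f (cis t)) has_vector_derivative ?f' (cis t)) (at t)"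
    using laurent_has_vector_derivative[OF w, of t] laurent_fcoef[OF f s] by simp
    from field_vector_diff_chain_at[OF this DERIV_inverse[OF nz]]
    show ?thesis
      by (simp add: o_def power2_eq_square mult_ac numeral_2_eq_2)
  qed
  let ?b = "fcoef (\<lambda>z. inverse (f z))"
  have b: "?b abs_summable_on UNIV" by (rule abs_summable_fcoef_C1[OF ci' ci d])
  note da = abs_summable_dcoef[OF w]
  let ?c = "\<lambda>j. -1 * conv (conv ?b (dcoef (fcoef f))) ?b j"
  have c: "?c abs_summable_on UNIV"
    by (intro abs_summable_cmult abs_summable_conv b da)
  have "dcoef ?b = fcoef (\<lambda>z. - (inverse (f z) * ?f' z * inverse (f z)))"
    by (simp add: fun_eq_iff dcoef_def fcoef_derivative[OF ci' ci d])
  also have "\<dots> = fcoef (laurent ?c)"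
    by (rule fcoef_cong)
       (simp only: laurent_cmult laurent_conv[OF abs_summable_conv[OF b da] b] laurent_conv[OF b da]
          laurent_fcoef[OF ci b], simp)
  also have "\<dots> = ?c" by (intro ext fcoef_laurent c)
  finally show ?thesis using c by (intro wsummable_dcoef) (simp only:)
qed

text \<open>The bootstrap of \<open>inverse_laurent\<close>, applied to F = exp g with F' = g' F.
  The last conclusion is this differential equation in coefficients; it determines the support of
  \<open>f\<close> without expanding the exponential.\<close>

lemma exp_laurent:
  assumes g: "wsummable g"
  obtains f where "wsummable f" "\<And>z. z \<in> sphere 0 1 \<Longrightarrow> laurent f z = exp (laurent g z)"
    "dcoef f = conv (dcoef g) f"
proof
  let ?F = "\<lambda>z. exp (laurent g z)" and ?g' = "laurent (dcoef g)"
  note gs = wsummable_imp_abs_summable[OF g] and gd = abs_summable_dcoef[OF g]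
  have cF: "continuous_on (sphere 0 1) ?F"
    by (intro continuous_intros continuous_on_laurent gs)
  have cF': "continuous_on (sphere 0 1) (\<lambda>z. ?g' z * ?F z)"
    by (intro continuous_intros cF continuous_on_laurent gd)
  have d: "((\<lambda>t. ?F (cis t)) has_vector_derivative ?g' (cis t) * ?F (cis t)) (at t)" for t
    using field_vector_diff_chain_at[OF laurent_has_vector_derivative[OF g] DERIV_exp] by (simp add: o_def)
  have s: "fcoef ?F abs_summable_on UNIV"
    by (rule abs_summable_fcoef_C1[OF cF' cF d])
  show lF: "laurent (fcoef ?F) z = exp (laurent g z)" if "z \<in> sphere 0 1" for z
    by (rule laurent_fcoef[OF cF s that])
  have cs: "conv (dcoef g) (fcoef ?F) abs_summable_on UNIV"
    by (rule abs_summable_conv[OF gd s])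
  show dc: "dcoef (fcoef ?F) = conv (dcoef g) (fcoef ?F)"
  proof
    fix j
    have "dcoef (fcoef ?F) j = fcoef (\<lambda>z. ?g' z * ?F z) j"
      by (simp add: dcoef_def fcoef_derivative[OF cF' cF d])
    also have "fcoef (\<lambda>z. ?g' z * ?F z) = fcoef (laurent (conv (dcoef g) (fcoef ?F)))"
      by (rule fcoef_cong) (simp add: laurent_conv[OF gd s] lF)
    finally show "dcoef (fcoef ?F) j = conv (dcoef g) (fcoef ?F) j"
      by (simp add: fcoef_laurent[OF cs])
  qed
  show "wsummable (fcoef ?F)"
    by (rule wsummable_dcoef) (simp only: dc cs)
qed

text \<open>The recursion forces the tail supremum \<open>M\<close> over \<open>j \<le> -N\<close> to satisfy \<open>N M \<le> C M\<close>;
  so \<open>f\<close> vanishes near \<open>-\<infinity>\<close>, and then by induction on all of \<open>j < 0\<close>.\<close>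

lemma recursion_support:
  fixes c f :: "int \<Rightarrow> complex"
  assumes c: "c abs_summable_on UNIV" and f: "f abs_summable_on UNIV"
    and c0: "\<And>m. m \<le> 0 \<Longrightarrow> c m = 0"
    and rec: "\<And>j. of_int j * f j = conv c f j"
  shows "j < 0 \<Longrightarrow> f j = 0"
proof -
  define C where "C = (\<Sum>\<^sub>\<infinity>m. norm (c m))"
  have C: "0 \<le> C" unfolding C_def by (rule infsum_nonneg) simp
  have cs: "(\<lambda>k. c (j - k)) abs_summable_on UNIV" "(\<Sum>\<^sub>\<infinity>k. norm (c (j - k))) = C" for j
  proof -
    have b: "bij_betw (\<lambda>k. j - k) UNIV UNIV" by (rule bij_betwI[of _ _ _ "\<lambda>k. j - k"]) auto
    show "(\<lambda>k. c (j - k)) abs_summable_on UNIV"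
      using summable_on_reindex_bij_betw[OF b, of "\<lambda>m. norm (c m)"] c by simp
    show "(\<Sum>\<^sub>\<infinity>k. norm (c (j - k))) = C"
      unfolding C_def by (rule infsum_reindex_bij_betw[OF b])
  qed
  have bound: "norm (of_int j * f j) \<le> C * M" if M: "\<And>k. k < j \<Longrightarrow> norm (f k) \<le> M" "0 \<le> M" for j M
  proof -
    have le: "norm (c (j - k) * f k) \<le> norm (c (j - k)) * M" for k
      using M c0[of "j - k"] by (cases "k < j") (auto simp: norm_mult intro: mult_left_mono)
    have s: "(\<lambda>k. norm (c (j - k)) * M) summable_on UNIV"
      by (rule summable_on_cmult_left[OF cs(1)])
    then have s': "(\<lambda>k. c (j - k) * f k) abs_summable_on UNIV"
      by (rule abs_summable_le) (rule le)
    have "norm (of_int j * f j) \<le> (\<Sum>\<^sub>\<infinity>k. norm (c (j - k) * f k))"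
      unfolding rec conv_def by (rule norm_infsum_bound[OF s'])
    also have "\<dots> \<le> (\<Sum>\<^sub>\<infinity>k. norm (c (j - k)) * M)"
      by (rule infsum_mono[OF s' s le])
    also have "\<dots> = C * M"
      by (subst infsum_cmult_left) (use cs in auto)
    finally show ?thesis .
  qed
  obtain N :: nat where N: "C < real N" using reals_Archimedean2 by blast
  define S where "S = (\<lambda>j. norm (f j)) ` {..- int N}"
  have fb: "norm (f k) \<le> (\<Sum>\<^sub>\<infinity>k. norm (f k))" for k
    using sum_norm_le_infsum[OF f, of "{k}"] by simp
  have bdd: "bdd_above S" unfolding S_def by (rule bdd_aboveI2) (rule fb)
  have neS: "S \<noteq> {}" by (auto simp: S_def)
  have up: "norm (f k) \<le> Sup S" if "k \<le> - int N" for k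
    by (rule cSup_upper[OF _ bdd]) (use that in \<open>auto simp: S_def\<close>)
  have S0: "0 \<le> Sup S" using up[of "- int N"] norm_ge_zero[of "f (- int N)"] by linarith
  have "real N * Sup S \<le> C * Sup S"
  proof -
    have "Sup S \<le> C * Sup S / real N"
    proof (rule cSup_least[OF neS])
      fix x assume "x \<in> S"
      then obtain j where j: "j \<le> - int N" "x = norm (f j)" by (auto simp: S_def)
      have "real N * x \<le> \<bar>of_int j\<bar> * x"
        using j by (intro mult_right_mono) auto
      also have "\<dots> = norm (of_int j * f j)" by (simp add: norm_mult j)
      also have "\<dots> \<le> C * Sup S" by (rule bound[OF up S0]) (use j in auto)
      finally show "x \<le> C * Sup S / real N"
        using N C by (simp add: field_simps)
    qed
    then show ?thesis using N C by (simp add: field_simps)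
  qed
  then have "(real N - C) * Sup S \<le> 0" by (simp add: left_diff_distrib)
  with N S0 have "Sup S = 0" by (simp add: mult_le_0_iff)
  then have far: "f k = 0" if "k \<le> - int N" for k using up[OF that] by simp
  show "f j = 0" if "j < 0"
  proof (cases "j \<le> - int N")
    case False
    then have "- int N \<le> j" by simp
    then have "j < 0 \<longrightarrow> (\<forall>k\<le>j. f k = 0)"
    proof (induction j rule: int_ge_induct)
      case base
      then show ?case using far by auto
    next
      case (step i)
      show ?case
      proof (intro impI allI)
        fix k assume i: "i + 1 < 0" and k: "k \<le> i + 1"
        then have z: "f k = 0" if "k \<le> i" for k using step that by auto
        have "norm (of_int (i + 1) * f (i + 1)) \<le> C * 0"
          by (rule bound) (use z in auto)
        then have "of_int (i + 1) * f (i + 1) = 0" by simp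
        then have "f (i + 1) = 0" using i by (simp only: mult_eq_0_iff of_int_eq_0_iff) auto
        with z k show "f k = 0" by (cases "k = i + 1") auto
      qed
    qed
    with that show ?thesis by simp
  qed (rule far)
qed

text \<open>Divided by the imaginary unit, F' = g' F is the recursion of
  \<open>recursion_support\<close> with coefficients m g_m, which live on m > 0. Hence
  \<open>toep f\<close> is lower triangular.\<close>

lemma exp_laurent_support_nonneg:
  assumes f: "wsummable f" and g: "wsummable g" and rec: "dcoef f = conv (dcoef g) f"
    and g0: "\<And>m. m \<le> 0 \<Longrightarrow> g m = 0" and "j < 0"
  shows "f j = 0"
proof (rule recursion_support[OF _ wsummable_imp_abs_summable[OF f] _ _ \<open>j < 0\<close>])
  show "(\<lambda>m. of_int m * g m) abs_summable_on UNIV" using g by (simp add: wsummable_def)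
  show "of_int m * g m = 0" if "m \<le> 0" for m using g0[OF that] by simp
  show "of_int j * f j = conv (\<lambda>m. of_int m * g m) f j" for j
  proof -
    have "\<i> * (of_int j * f j) = conv (dcoef g) f j"
      using fun_cong[OF rec, of j] by (simp add: dcoef_def mult.assoc)
    also have "\<dots> = (\<Sum>\<^sub>\<infinity>k. \<i> * (of_int (j - k) * g (j - k) * f k))"
      unfolding conv_def dcoef_def by (simp add: mult.assoc)
    also have "\<dots> = \<i> * conv (\<lambda>m. of_int m * g m) f j"
      unfolding conv_def by (rule infsum_cmult_right')
    finally show ?thesis by simp
  qed
qed

text \<open>Reflecting indices reduces this to the previous case; \<open>dcoef\<close> changes sign
  on both sides of the recursion.\<close>

lemma exp_laurent_support_nonpos:
  assumes f: "wsummable f" and g: "wsummable g" and rec: "dcoef f = conv (dcoef g) f"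
    and g0: "\<And>m. 0 \<le> m \<Longrightarrow> g m = 0" and "0 < j"
  shows "f j = 0"
proof -
  have b: "bij_betw uminus (UNIV :: int set) UNIV" by (rule bij_betwI[of _ _ _ uminus]) auto
  have w: "wsummable (\<lambda>j. h (- j))" if "wsummable h" for h
    using summable_on_reindex_bij_betw[OF b, of "\<lambda>j. norm (of_int j * h j)"] that
    by (simp add: wsummable_def)
  have "dcoef (\<lambda>j. f (- j)) = conv (dcoef (\<lambda>m. g (- m))) (\<lambda>j. f (- j))"
  proof
    fix j
    have "dcoef (\<lambda>j. f (- j)) j = - dcoef f (- j)" by (simp add: dcoef_def)
    also have "\<dots> = - (\<Sum>\<^sub>\<infinity>k. dcoef g (- j - k) * f k)" unfolding rec conv_def ..
    also have "(\<Sum>\<^sub>\<infinity>k. dcoef g (- j - k) * f k) = (\<Sum>\<^sub>\<infinity>k. dcoef g (- j - - k) * f (- k))"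
      by (rule infsum_reindex_bij_betw[OF b, symmetric])
    also have "- \<dots> = (\<Sum>\<^sub>\<infinity>k. - (dcoef g (- j - - k) * f (- k)))"
      by (rule infsum_uminus[symmetric])
    also have "\<dots> = conv (dcoef (\<lambda>m. g (- m))) (\<lambda>j. f (- j)) j"
      unfolding conv_def by (rule infsum_cong) (simp add: dcoef_def algebra_simps)
    finally show "dcoef (\<lambda>j. f (- j)) j = conv (dcoef (\<lambda>m. g (- m))) (\<lambda>j. f (- j)) j" .
  qed
  from exp_laurent_support_nonneg[OF w[OF f] w[OF g] this, of "- j"] show ?thesis
    using g0 \<open>0 < j\<close> by simp
qed

section \<open>Winding numbers and the multiplicative commutator\<close>

lemma circlepath_cis: "circlepath 0 1 t = cis (2 * pi * t)"
  by (simp add: circlepath cis_conv_exp mult_ac)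

lemma contour_integral_circlepath_cis:
  assumes "continuous_on (sphere 0 1) f"
  shows "contour_integral (circlepath 0 1) f = integral {0..2*pi} (\<lambda>t. f (cis t) * \<i> * cis t)"
proof -
  have "((\<lambda>t. f (cis t) * \<i> * cis t) has_integral integral {0..2*pi} (\<lambda>t. f (cis t) * \<i> * cis t)) {0..2*pi}"
    by (intro integrable_integral integrable_continuous_real continuous_intros continuous_on_circle assms)
  then have "(f has_contour_integral integral {0..2*pi} (\<lambda>t. f (cis t) * \<i> * cis t)) (part_circlepath 0 1 0 (2*pi))"
    by (subst has_contour_integral_part_circlepath_iff) simp_all
  then show ?thesis
    by (simp add: circlepath_def contour_integral_unique)
qed

text \<open>The winding number is the integral of dw/w along the image path over 2 pi i. Here
  \<open>f'\<close> is the derivative in the angle, so it becomes the mean of f'/f over the circle,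
  divided by i; integrality resolves the \<open>THE\<close> in \<open>windnum\<close>.\<close>

lemma winding_number_logarithmic_derivative:
  assumes f: "continuous_on (sphere 0 1) f" and f': "continuous_on (sphere 0 1) f'"
    and nz: "\<And>z. z \<in> sphere 0 1 \<Longrightarrow> f z \<noteq> 0"
    and d: "\<And>t. ((\<lambda>t. f (cis t)) has_vector_derivative f' (cis t)) (at t)"
  shows "of_int (windnum f) = fcoef (\<lambda>z. f' z / f z) 0 / \<i>"
proof -
  let ?g = "f \<circ> circlepath 0 1"
  have g: "?g = (\<lambda>t. f (cis (2 * pi * t)))" by (simp add: fun_eq_iff circlepath_cis)
  have dg: "(?g has_vector_derivative 2 * pi * f' (cis (2 * pi * t))) (at t)" for t
  proof -
    have "((\<lambda>t. 2 * pi * t) has_vector_derivative 2 * pi) (at t)"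
      by (auto intro!: derivative_eq_intros)
    from vector_diff_chain_at[OF this d] show ?thesis
      unfolding g by (simp add: o_def scaleR_conv_of_real)
  qed
  have cg: "continuous_on {0..1} (\<lambda>t. 2 * pi * f' (cis (2 * pi * t)))"
    by (intro continuous_intros continuous_on_compose2[OF f']) auto
  have vp: "valid_path ?g"
    unfolding valid_path_def
    by (rule C1_differentiable_imp_piecewise, unfold C1_differentiable_on_def)
       (intro exI[of _ "\<lambda>t. 2 * pi * f' (cis (2 * pi * t))"] conjI ballI dg cg)
  have path: "path ?g" by (rule valid_path_imp_path[OF vp])
  have zero: "0 \<notin> path_image ?g"
    using nz by (auto simp: path_image_def circlepath_cis)
  have closed: "pathfinish ?g = pathstart ?g"
    by (simp add: pathfinish_def pathstart_def circlepath_cis flip: cis_2pi)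
  \<comment> \<open>The contour integral of this function mediates between the parameter interval
    \<open>{0..1}\<close> of the path and \<open>{0..2*pi}\<close> of \<open>fcoef\<close>; the
    divisor i z comes from dz = i z dt.\<close>
  have cq: "continuous_on (sphere 0 1) (\<lambda>z. f' z / (\<i> * z * f z))"
    by (intro continuous_intros f f') (use nz in auto)
  have "contour_integral ?g (\<lambda>w. 1 / (w - 0)) =
      integral {0..1} (\<lambda>t. 1 / ?g t * (2 * pi * f' (cis (2 * pi * t))))"
    unfolding contour_integral_integral vector_derivative_at[OF dg] by simp
  also have "\<dots> = contour_integral (circlepath 0 1) (\<lambda>z. f' z / (\<i> * z * f z))"
    unfolding contour_integral_integral vector_derivative_circlepath
  proof (rule integral_cong, goal_cases)
    case (1 t)
    have "exp (2 * of_real pi * \<i> * of_real t) = cis (2 * pi * t)"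
      by (simp add: cis_conv_exp mult_ac)
    then show ?case
      using nz[of "cis (2 * pi * t)"] by (simp add: g circlepath_cis field_simps)
  qed
  also have "\<dots> = integral {0..2*pi} (\<lambda>t. f' (cis t) / f (cis t))"
    unfolding contour_integral_circlepath_cis[OF cq]
    by (rule integral_cong) (simp add: field_simps)
  also have "\<dots> = 2 * pi * fcoef (\<lambda>z. f' z / f z) 0"
    by (simp add: fcoef_def)
  finally have w: "winding_number ?g 0 = fcoef (\<lambda>z. f' z / f z) 0 / \<i>"
    unfolding winding_number_valid_path[OF vp zero] by (simp add: field_simps)
  have "winding_number ?g 0 \<in> \<int>"
    by (rule integer_winding_number[OF path closed zero])
  then obtain k where k: "winding_number ?g 0 = of_int k" by (auto elim: Ints_cases)
  then have "windnum f = k"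
    unfolding windnum_def by (intro the_equality) auto
  then show ?thesis using k w by simp
qed

lemma inverse_coefficients:
  assumes a: "a abs_summable_on UNIV" and b: "b abs_summable_on UNIV"
    and ab: "\<And>z. z \<in> sphere 0 1 \<Longrightarrow> laurent a z * laurent b z = 1"
  shows "toep a * toep b = 1"
proof -
  have "conv a b = delta 0"
    by (rule laurent_inject[OF abs_summable_conv[OF a b] abs_summable_delta])
       (simp add: laurent_conv[OF a b] ab laurent_delta)
  then show ?thesis by (simp add: toep_mult[OF a b] toep_delta_0)
qed

lemma toep_laurent_mult:
  assumes a: "a abs_summable_on UNIV" and b: "b abs_summable_on UNIV" and c: "c abs_summable_on UNIV"
    and "\<And>z. z \<in> sphere 0 1 \<Longrightarrow> laurent c z = laurent a z * laurent b z"
  shows "toep c = toep a * toep b"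
proof -
  have "c = conv a b"
    by (rule laurent_inject[OF c abs_summable_conv[OF a b]]) (simp add: laurent_conv[OF a b] assms(4))
  then show ?thesis by (simp add: toep_mult[OF a b])
qed

text \<open>The winding number is removed by the monomial \<open>z\<^sup>k\<close>; what remains has the logarithm with
  Fourier coefficients \<open>L j / (i j)\<close>, where \<open>L\<close> are the coefficients of \<open>\<phi>'/\<phi>\<close>.\<close>

lemma logarithm_factorization:
  assumes f: "continuous_on (sphere 0 1) f" and nz: "\<And>z. z \<in> sphere 0 1 \<Longrightarrow> f z \<noteq> 0"
    and w: "wsummable (fcoef f)"
  obtains g c where "wsummable g" "g 0 = 0" "c \<noteq> 0"
    "\<And>z. z \<in> sphere 0 1 \<Longrightarrow> f z = c * z powi windnum f * exp (laurent g z)"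
proof -
  define a b where "a = fcoef f" and "b = fcoef (\<lambda>z. inverse (f z))"
  have as: "a abs_summable_on UNIV" unfolding a_def by (rule wsummable_imp_abs_summable[OF w])
  have ds: "dcoef a abs_summable_on UNIV" unfolding a_def by (rule abs_summable_dcoef[OF w])
  have bs: "b abs_summable_on UNIV" unfolding b_def
    by (rule wsummable_imp_abs_summable[OF inverse_laurent[OF f nz w]])
  have ci: "continuous_on (sphere 0 1) (\<lambda>z. inverse (f z))"
    by (intro continuous_intros f) (use nz in auto)
  have fa: "laurent a z = f z" if "z \<in> sphere 0 1" for z
    unfolding a_def by (rule laurent_fcoef[OF f as[unfolded a_def] that])
  have fb: "laurent b z = inverse (f z)" if "z \<in> sphere 0 1" for z
    unfolding b_def by (rule laurent_fcoef[OF ci bs[unfolded b_def] that])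
  have d: "((\<lambda>t. f (cis t)) has_vector_derivative laurent (dcoef a) (cis t)) (at t)" for t
    using laurent_has_vector_derivative[OF w[folded a_def], of t] by (simp add: fa)
  define L where "L = conv (dcoef a) b"
  have Ls: "L abs_summable_on UNIV" unfolding L_def by (rule abs_summable_conv[OF ds bs])
  have lL: "laurent L z = laurent (dcoef a) z / f z" if "z \<in> sphere 0 1" for z
    unfolding L_def laurent_conv[OF ds bs that] fb[OF that] by (simp add: divide_inverse)
  have "fcoef (\<lambda>z. laurent (dcoef a) z / f z) 0 = L 0"
    using fcoef_cong[OF lL] fcoef_laurent[OF Ls, of 0] by simp
  then have L0: "L 0 = \<i> * of_int (windnum f)"
    using winding_number_logarithmic_derivative[OF f continuous_on_laurent[OF ds] nz d] by simp
  define g where "g j = (if j = 0 then 0 else L j / (\<i> * of_int j))" for j :: int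
  have dg: "dcoef g j + L 0 * delta 0 j = L j" for j
    by (simp add: dcoef_def g_def delta_def)
  have dgs: "dcoef g abs_summable_on UNIV"
    by (rule abs_summable_le[OF Ls]) (auto simp: dcoef_def g_def)
  have g: "wsummable g" by (rule wsummable_dcoef[OF dgs])
  have lg: "laurent (dcoef g) z = laurent (dcoef a) z / f z - L 0" if "z \<in> sphere 0 1" for z
  proof -
    have "laurent L z = laurent (\<lambda>j. dcoef g j + L 0 * delta 0 j) z" by (simp add: dg)
    also have "\<dots> = laurent (dcoef g) z + L 0"
      using laurent_add[OF dgs abs_summable_cmult[OF abs_summable_delta, of "L 0" 0] that]
      by (simp add: laurent_cmult laurent_delta)
    finally show ?thesis using lL[OF that] by simp
  qed
  let ?k = "windnum f"
  let ?e = "\<lambda>t. exp (- laurent g (cis t))" and ?c = "\<lambda>t. cis (of_int (- ?k) * t)"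
  \<comment> \<open>This is f exp(-g) z^(-k). Its logarithmic derivative f'/f - g' - i k vanishes
    because i k is the mean \<open>L 0\<close> that was left out of g', so \<open>?H\<close> is
    constant.\<close>
  let ?H = "\<lambda>t. f (cis t) * ?e t * ?c t"
  have H: "(?H has_vector_derivative 0) (at t)" for t
  proof -
    have de: "(?e has_vector_derivative - laurent (dcoef g) (cis t) * ?e t) (at t)"
      using field_vector_diff_chain_at[OF has_vector_derivative_minus[OF laurent_has_vector_derivative[OF g]] DERIV_exp, of t]
      by (simp add: o_def)
    have "(?H has_vector_derivative
        f (cis t) * ?e t * (\<i> * of_int (- ?k) * ?c t) +
        (f (cis t) * (- laurent (dcoef g) (cis t) * ?e t) + laurent (dcoef a) (cis t) * ?e t) * ?c t) (at t)"
      by (rule has_vector_derivative_mult[OF has_vector_derivative_mult[OF d de] has_vector_derivative_cis])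
    moreover have "f (cis t) * laurent (dcoef g) (cis t) = laurent (dcoef a) (cis t) - f (cis t) * L 0"
      using nz[of "cis t"] by (simp add: lg field_simps)
    then have "laurent (dcoef a) (cis t) = f (cis t) * laurent (dcoef g) (cis t) + f (cis t) * L 0" by simp
    ultimately show ?thesis by (simp add: L0 algebra_simps)
  qed
  then have "\<exists>c. \<forall>t\<in>UNIV. ?H t = c"
    by (intro has_derivative_zero_constant) (auto simp: has_vector_derivative_def)
  then obtain c where c: "\<And>t. ?H t = c" by auto
  have eq: "f z = c * z powi ?k * exp (laurent g z)" if z: "z \<in> sphere 0 1" for z
  proof -
    obtain t where t: "z = cis t" using sphere_cis[OF z] by blast
    have "c * z powi ?k * exp (laurent g z) =
        f (cis t) * (?e t * exp (laurent g (cis t))) * (?c t * cis (of_int ?k * t))"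
      unfolding c[of t, symmetric] t by (simp add: cis_power_int)
    also have "?c t * cis (of_int ?k * t) = 1" by (simp add: cis_mult)
    also have "?e t * exp (laurent g (cis t)) = 1" by (simp flip: exp_add)
    finally show ?thesis by (simp add: t)
  qed
  moreover have "c \<noteq> 0" using eq[of 1] nz[of 1] by auto
  moreover have "g 0 = 0" by (simp add: g_def)
  ultimately show ?thesis using that g by blast
qed

text \<open>Both exp g and its inverse exp(-g) have coefficients only at nonnegative indices, so the
  Laurent matrix and its inverse are lower triangular.\<close>

lemma Wdet_exp_lower:
  assumes g: "wsummable g" and g0: "\<And>m. m \<le> 0 \<Longrightarrow> g m = 0" and q: "q \<noteq> 0"
  obtains f h where "wsummable f" "h abs_summable_on UNIV" "toep h * toep f = 1" "toep f * toep h = 1"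
    "\<And>z. z \<in> sphere 0 1 \<Longrightarrow> laurent f z = exp (laurent g z)" "Wdet q 0 (toep f) (toep h) = 1"
proof -
  have g': "wsummable (\<lambda>j. - g j)" using g by (simp add: wsummable_def)
  have lg': "laurent (\<lambda>j. - g j) z = - laurent g z" for z
    using laurent_cmult[of "-1" g z] by simp
  obtain f where f: "wsummable f" "\<And>z. z \<in> sphere 0 1 \<Longrightarrow> laurent f z = exp (laurent g z)"
    "dcoef f = conv (dcoef g) f" by (rule exp_laurent[OF g]) (rule that)
  obtain h where h: "wsummable h" "\<And>z. z \<in> sphere 0 1 \<Longrightarrow> laurent h z = exp (laurent (\<lambda>j. - g j) z)"
    "dcoef h = conv (dcoef (\<lambda>j. - g j)) h" by (rule exp_laurent[OF g']) (rule that)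
  note fs = wsummable_imp_abs_summable[OF f(1)] and hs = wsummable_imp_abs_summable[OF h(1)]
  have hf: "toep h * toep f = 1" "toep f * toep h = 1"
    by (rule inverse_coefficients; simp add: fs hs f h lg' flip: exp_add)+
  have low: "f j = 0" "h j = 0" if "j < 0" for j
    using exp_laurent_support_nonneg[OF f(1) g f(3) g0 that]
      exp_laurent_support_nonneg[OF h(1) g' h(3) _ that] g0 by auto
  have "Wdet q 0 (toep f) (toep h) = 1"
    by (rule Wdet_lower_triangular[OF _ _ hf(1) q]) (simp_all add: entry_toep[OF fs] entry_toep[OF hs] low)
  then show ?thesis using that f(1,2) hs hf by blast
qed

lemma Wdet_exp_upper:
  assumes g: "wsummable g" and g0: "\<And>m. 0 \<le> m \<Longrightarrow> g m = 0" and q: "q \<noteq> 0"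
  obtains f h where "wsummable f" "h abs_summable_on UNIV" "toep h * toep f = 1" "toep f * toep h = 1"
    "\<And>z. z \<in> sphere 0 1 \<Longrightarrow> laurent f z = exp (laurent g z)" "Wdet q 0 (toep f) (toep h) = 1"
proof -
  have g': "wsummable (\<lambda>j. - g j)" using g by (simp add: wsummable_def)
  have lg': "laurent (\<lambda>j. - g j) z = - laurent g z" for z
    using laurent_cmult[of "-1" g z] by simp
  obtain f where f: "wsummable f" "\<And>z. z \<in> sphere 0 1 \<Longrightarrow> laurent f z = exp (laurent g z)"
    "dcoef f = conv (dcoef g) f" by (rule exp_laurent[OF g]) (rule that)
  obtain h where h: "wsummable h" "\<And>z. z \<in> sphere 0 1 \<Longrightarrow> laurent h z = exp (laurent (\<lambda>j. - g j) z)"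
    "dcoef h = conv (dcoef (\<lambda>j. - g j)) h" by (rule exp_laurent[OF g']) (rule that)
  note fs = wsummable_imp_abs_summable[OF f(1)] and hs = wsummable_imp_abs_summable[OF h(1)]
  have hf: "toep h * toep f = 1" "toep f * toep h = 1"
    by (rule inverse_coefficients; simp add: fs hs f h lg' flip: exp_add)+
  have up: "f j = 0" "h j = 0" if "0 < j" for j
    using exp_laurent_support_nonpos[OF f(1) g f(3) g0 that]
      exp_laurent_support_nonpos[OF h(1) g' h(3) _ that] g0 by auto
  have "Wdet q 0 (toep f) (toep h) = 1"
    by (rule Wdet_upper_triangular[OF _ _ hf(1) q]) (simp_all add: entry_toep[OF fs] entry_toep[OF hs] up)
  then show ?thesis using that f(1,2) hs hf by blast
qed

lemma nuclear_toep_step: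
  "wsummable a \<Longrightarrow> nuclear (toep a * step_mat 1 0 0 - step_mat 1 0 0 * toep a)"
  by (rule nuclear_toep_commutator) (simp_all add: wsummable_imp_abs_summable, simp add: wsummable_def)

text \<open>A Wiener-Hopf factorization: since \<open>g 0 = 0\<close>, the parts \<open>gp\<close>
  and \<open>gm\<close> exhaust \<open>g\<close>, the constant being absorbed in \<open>c\<close>.
  The monomial is placed last because the offset \<open>n\<close> stays with the right factor of
  \<open>Wdet_mult\<close>. By uniqueness of inverses \<open>B\<close> is the product of the
  explicit ones.\<close>

lemma Wdet_winding:
  assumes f: "continuous_on (sphere 0 1) f" and nz: "\<And>z. z \<in> sphere 0 1 \<Longrightarrow> f z \<noteq> 0"
    and w: "wsummable (fcoef f)" and q: "q \<noteq> 0"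
    and B: "B * toep (fcoef f) = 1"
  shows "Wdet q n (toep (fcoef f)) B = q powi (n + windnum f)"
proof -
  let ?k = "windnum f"
  obtain g c where g: "wsummable g" "g 0 = 0" "c \<noteq> 0"
    and fg: "\<And>z. z \<in> sphere 0 1 \<Longrightarrow> f z = c * z powi ?k * exp (laurent g z)"
    using logarithm_factorization[OF f nz w] by blast
  define gp gm where "gp j = (if 0 < j then g j else 0)" and "gm j = (if j < 0 then g j else 0)" for j
  have "wsummable gp" "wsummable gm"
    unfolding wsummable_def gp_def gm_def
    by (rule summable_on_comparison_test[OF g(1)[unfolded wsummable_def]]; auto)+
  note gp = this(1) and gm = this(2)
  have g_split: "g = (\<lambda>j. gp j + gm j)"
    using g(2) by (auto simp: gp_def gm_def fun_eq_iff)
  have lg: "laurent g z = laurent gp z + laurent gm z" if "z \<in> sphere 0 1" for z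
    unfolding g_split by (intro laurent_add wsummable_imp_abs_summable gp gm that)
  obtain f1 h1 where f1: "wsummable f1" "h1 abs_summable_on UNIV" "toep h1 * toep f1 = 1" "toep f1 * toep h1 = 1"
    "\<And>z. z \<in> sphere 0 1 \<Longrightarrow> laurent f1 z = exp (laurent gp z)" "Wdet q 0 (toep f1) (toep h1) = 1"
    by (rule Wdet_exp_lower[OF gp _ q]) (auto simp: gp_def)
  obtain f2 h2 where f2: "wsummable f2" "h2 abs_summable_on UNIV" "toep h2 * toep f2 = 1" "toep f2 * toep h2 = 1"
    "\<And>z. z \<in> sphere 0 1 \<Longrightarrow> laurent f2 z = exp (laurent gm z)" "Wdet q 0 (toep f2) (toep h2) = 1"
    by (rule Wdet_exp_upper[OF gm _ q]) (auto simp: gm_def)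
  note s1 = wsummable_imp_abs_summable[OF f1(1)] and s2 = wsummable_imp_abs_summable[OF f2(1)]
  let ?a = "\<lambda>m. c * delta ?k m" and ?b = "\<lambda>m. 1 / c * delta (- ?k) m"
  have sab: "?a abs_summable_on UNIV" "?b abs_summable_on UNIV"
    by (intro abs_summable_cmult abs_summable_delta)+
  have wa: "wsummable ?a"
    by (rule wsummable_dcoef, rule abs_summable_finite_support[of "{?k}"]) (auto simp: dcoef_def delta_def)
  have ab: "toep ?a * toep ?b = 1" "toep ?b * toep ?a = 1"
  proof -
    have 1: "laurent ?a z * laurent ?b z = 1" if "z \<in> sphere 0 1" for z :: complex
    proof -
      have "z powi ?k * z powi (- ?k) = 1"
        using that by (subst power_int_add[symmetric]) auto
      then show ?thesis
        unfolding laurent_cmult laurent_delta using g(3) by (simp add: mult.left_commute)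
    qed
    then have 2: "laurent ?b z * laurent ?a z = 1" if "z \<in> sphere 0 1" for z :: complex
      using that by (simp only: mult.commute)
    show "toep ?a * toep ?b = 1" by (rule inverse_coefficients[OF sab 1])
    show "toep ?b * toep ?a = 1" by (rule inverse_coefficients[OF sab(2,1) 2])
  qed
  have s12: "conv f1 f2 abs_summable_on UNIV" by (rule abs_summable_conv[OF s1 s2])
  have "toep (fcoef f) = toep (conv f1 f2) * toep ?a"
  proof (rule toep_laurent_mult[OF s12 sab(1) wsummable_imp_abs_summable[OF w]])
    fix z :: complex assume z: "z \<in> sphere 0 1"
    have "laurent (fcoef f) z = f z"
      by (rule laurent_fcoef[OF f wsummable_imp_abs_summable[OF w] z])
    then show "laurent (fcoef f) z = laurent (conv f1 f2) z * laurent ?a z"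
      by (simp add: laurent_conv[OF s1 s2 z] f1(5)[OF z] f2(5)[OF z] laurent_cmult laurent_delta fg[OF z]
          lg[OF z] exp_add)
  qed
  then have A: "toep (fcoef f) = (toep f1 * toep f2) * toep ?a"
    by (simp add: toep_mult[OF s1 s2])
  let ?B = "toep ?b * (toep h2 * toep h1)"
  have "toep (fcoef f) * ?B = toep f1 * (toep f2 * (toep ?a * toep ?b) * toep h2) * toep h1"
    by (simp only: A mult.assoc)
  also have "\<dots> = 1" unfolding ab(1) by (simp add: f1 f2)
  finally have "B = ?B" using B by (metis mult.assoc mult.left_neutral mult.right_neutral)
  moreover have c12: "nuclear (toep f1 * toep f2 * step_mat 1 0 0 - step_mat 1 0 0 * (toep f1 * toep f2))"
  proof -
    \<comment> \<open>The Leibniz rule for commutators.\<close>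
    have "toep f1 * toep f2 * step_mat 1 0 0 - step_mat 1 0 0 * (toep f1 * toep f2) =
        toep f1 * (toep f2 * step_mat 1 0 0 - step_mat 1 0 0 * toep f2) +
        (toep f1 * step_mat 1 0 0 - step_mat 1 0 0 * toep f1) * toep f2"
      by (simp add: algebra_simps)
    then show ?thesis
      by (simp only: nuclear_add nuclear_mult_left nuclear_mult_right nuclear_toep_step f1(1) f2(1))
  qed
  have "toep h2 * toep h1 * (toep f1 * toep f2) = toep h2 * (toep h1 * toep f1) * toep f2"
    by (simp only: mult.assoc)
  then have i12: "toep h2 * toep h1 * (toep f1 * toep f2) = 1" by (simp add: f1 f2)
  have "Wdet q n (toep (fcoef f)) ?B = Wdet q 0 (toep f1 * toep f2) (toep h2 * toep h1) * Wdet q n (toep ?a) (toep ?b)"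
    unfolding A by (rule Wdet_mult[OF c12 i12 nuclear_toep_step[OF wa] ab(2,1) q])
  also have "Wdet q 0 (toep f1 * toep f2) (toep h2 * toep h1) = 1"
    using Wdet_mult[OF nuclear_toep_step[OF f1(1)] f1(3) nuclear_toep_step[OF f2(1)] f2(3,4) q]
    by (simp add: f1(6) f2(6))
  also have "Wdet q n (toep ?a) (toep ?b) = q powi (n + ?k)"
    by (rule Wdet_shift[OF g(3) q])
  finally show ?thesis using \<open>B = ?B\<close> by simp
qed

section \<open>The kernel and its matrix\<close>

lemma hilbert_schmidt_diagonal:
  assumes r: "r summable_on I" and r0: "\<And>i. i \<in> I \<Longrightarrow> 0 \<le> r i"
  shows "hilbert_schmidt I (\<lambda>i k. if i = k then of_real (sqrt (r i)) else 0)"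
  unfolding hilbert_schmidt_def
proof (rule summable_on_SigmaI)
  fix i assume i: "i \<in> I"
  show "((\<lambda>k. case (i, k) of (i, k) \<Rightarrow> (norm (if i = k then of_real (sqrt (r i)) else 0 :: complex))\<^sup>2) has_sum r i) I"
    by (rule has_sum_finite_neutralI[of "{i}"]) (use i r0[OF i] in auto)
qed (use r in auto)

text \<open>With the row sums \<open>r i\<close>, an absolutely summable \<open>T\<close> is the product of the diagonal matrix of
  \<open>sqrt (r i)\<close> and the matrix \<open>T i j / sqrt (r i)\<close> (rows with \<open>r i = 0\<close> vanish, where \<open>x / 0 = 0\<close>).\<close>

lemma trace_class_abs_summable:
  assumes T: "(\<lambda>(i, j). norm (T i j)) summable_on I \<times> I"
  shows "trace_class I T"
proof -
  define r where "r i = (\<Sum>\<^sub>\<infinity>j\<in>I. norm (T i j))" for i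
  have s: "(\<lambda>j. norm (T i j)) summable_on I" if "i \<in> I" for i
    using summable_on_SigmaD1[OF T that] by simp
  have le: "norm (T i j) \<le> r i" if "i \<in> I" "j \<in> I" for i j
    using finite_sum_le_infsum[OF s[OF that(1)], of "{j}"] that by (simp add: r_def)
  have r0: "0 \<le> r i" for i unfolding r_def by (rule infsum_nonneg) simp
  have r: "r summable_on I"
    unfolding r_def using summable_on_SigmaD[OF T] s by simp
  let ?A = "\<lambda>i k. if i = k then of_real (sqrt (r i)) else 0 :: complex"
  let ?B = "\<lambda>k j. T k j / of_real (sqrt (r k))"
  have "hilbert_schmidt I ?A" by (rule hilbert_schmidt_diagonal[OF r r0])
  moreover have "hilbert_schmidt I ?B"
    unfolding hilbert_schmidt_def
  proof (rule summable_on_comparison_test[OF T])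
    fix p assume "p \<in> I \<times> I"
    then obtain k j where p: "p = (k, j)" "k \<in> I" "j \<in> I" by auto
    have "(norm (T k j))\<^sup>2 / r k \<le> norm (T k j)"
    proof (cases "r k = 0")
      case False
      then have "0 < r k" using r0[of k] by simp
      then show ?thesis
        using mult_left_mono[OF le[OF p(2,3)] norm_ge_zero, of "T k j"]
        by (simp add: power2_eq_square field_simps)
    qed simp
    then show "(\<lambda>(i, j). (norm (?B i j))\<^sup>2) p \<le> (\<lambda>(i, j). norm (T i j)) p"
      using r0[of k] by (simp add: p norm_divide power_divide)
  qed (auto simp: case_prod_unfold)
  moreover have "((\<lambda>k. ?A i k * ?B k j) has_sum T i j) I" if "i \<in> I" "j \<in> I" for i j
  proof (rule has_sum_finite_neutralI[of "{i}"])
    have "T i j = 0" if "r i = 0" using le[OF \<open>i \<in> I\<close> \<open>j \<in> I\<close>] that by simp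
    then show "T i j = (\<Sum>k\<in>{i}. ?A i k * ?B k j)" by simp
  qed (use that in auto)
  ultimately show ?thesis unfolding trace_class_def by blast
qed

lemma trace_class_nuclear:
  assumes "nuclear X" "\<And>i j. i \<in> I \<Longrightarrow> j \<in> I \<Longrightarrow> T i j = entry X i j"
  shows "trace_class I T"
proof (rule trace_class_abs_summable)
  have "(\<lambda>(i, j). norm (entry X i j)) summable_on I \<times> I"
    by (rule summable_on_subset_banach[OF assms(1)[unfolded nuclear_def]]) simp
  then show "(\<lambda>(i, j). norm (T i j)) summable_on I \<times> I"
    by (rule summable_on_cong[THEN iffD1, rotated]) (use assms(2) in auto)
qed

section \<open>The integral operator of a divided difference\<close>

lemma sum_telescope_int:
  fixes g :: "int \<Rightarrow> complex"
  assumes "l \<le> u"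
  shows "(\<Sum>r\<in>{l..<u}. g (r + 1) - g r) = g u - g l"
  using assms
proof (induction u rule: int_ge_induct)
  case (step i)
  have "{l..<i + 1} = insert i {l..<i}" using step.hyps by auto
  then show ?case using step.IH by simp
qed simp

text \<open>The divided difference \<open>(z\<^sup>m - w\<^sup>m) / (z - w)\<close>, extended continuously to \<open>w = z\<close>.\<close>

definition powi_quotient :: "int \<Rightarrow> complex \<Rightarrow> complex \<Rightarrow> complex" where
  "powi_quotient m z w = (\<Sum>r\<in>{0..<m}. z powi r * w powi (m - 1 - r)) - (\<Sum>r\<in>{m..<0}. z powi r * w powi (m - 1 - r))"

lemma powi_quotient:
  assumes "z \<noteq> 0" "w \<noteq> 0"
  shows "(z - w) * powi_quotient m z w = z powi m - w powi m"
proof -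
  define g where "g r = z powi r * w powi (m - r)" for r
  have t: "(z - w) * (z powi r * w powi (m - 1 - r)) = g (r + 1) - g r" for r
  proof -
    have "z powi (r + 1) = z powi r * z" using assms by (simp add: power_int_add)
    moreover have "w powi (m - r) = w powi (m - 1 - r) * w"
      using assms power_int_add[of w "m - 1 - r" 1] by simp
    moreover have "m - (r + 1) = m - 1 - r" by simp
    ultimately show ?thesis by (simp only: g_def) (simp add: algebra_simps)
  qed
  have "(z - w) * powi_quotient m z w = (\<Sum>r\<in>{0..<m}. g (r + 1) - g r) - (\<Sum>r\<in>{m..<0}. g (r + 1) - g r)"
    by (simp only: powi_quotient_def right_diff_distrib sum_distrib_left t)
  also have "\<dots> = g m - g 0"
  proof (cases "0 \<le> m")
    case True
    then show ?thesis by (simp add: sum_telescope_int)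
  next
    case False
    then show ?thesis using sum_telescope_int[of m 0 g] by simp
  qed
  finally show ?thesis by (simp add: g_def)
qed

text \<open>There are |m| terms of modulus 1. The weight |m| in \<open>wsummable\<close> is thus
  what makes the series of divided differences converge uniformly.\<close>

lemma norm_powi_quotient_le:
  assumes "z \<in> sphere 0 1" "w \<in> sphere 0 1"
  shows "norm (powi_quotient m z w) \<le> \<bar>of_int m\<bar>"
proof -
  have "norm (\<Sum>r\<in>A. z powi r * w powi (m - 1 - r)) \<le> real (card A)" for A
  proof -
    have "norm (\<Sum>r\<in>A. z powi r * w powi (m - 1 - r)) \<le> (\<Sum>r\<in>A. 1)"
      by (rule sum_norm_le) (use assms in \<open>simp add: norm_mult norm_power_int\<close>)
    then show ?thesis by simp
  qed
  from this[of "{0..<m}"] this[of "{m..<0}"] show ?thesis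
    unfolding powi_quotient_def
    by (cases "0 \<le> m") auto
qed

text \<open>By orthogonality only r = m + k survives. It lies in \<open>{0..<m}\<close> iff k < 0
  and m + k >= 0, and in \<open>{m..<0}\<close> iff k >= 0 and m + k < 0; the difference of
  indicators is the matrix entry of the commutator of P_0 with multiplication by z^m.\<close>

lemma integral_powi_quotient:
  fixes z :: complex
  assumes z: "z \<in> sphere 0 1"
  shows "integral {0..2*pi} (\<lambda>t. powi_quotient m z (cis t) * cis t powi k * cis t) =
    2 * pi * (z powi (m + k) * ((if 0 \<le> m + k then 1 else 0) - (if 0 \<le> k then 1 else 0)))"
proof -
  let ?I = "{0..2*pi}"
  let ?v = "\<lambda>r. if m + k - r = 0 then 2 * pi else 0 :: complex"
  have c: "cis t powi (m - 1 - r) * cis t powi k * cis t = cis (of_int (m + k - r) * t)" for t r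
    by (simp add: cis_power_int cis_mult algebra_simps)
  have i: "((\<lambda>t. \<Sum>r\<in>A. z powi r * cis (of_int (m + k - r) * t)) has_integral (\<Sum>r\<in>A. z powi r * ?v r)) ?I"
    if "finite A" for A
    unfolding integral_cis[symmetric]
    by (intro has_integral_sum that has_integral_mult_right integrable_integral integrable_continuous_real continuous_intros)
  have v: "(\<Sum>r\<in>A. z powi r * ?v r) = 2 * pi * (z powi (m + k) * (if m + k \<in> A then 1 else 0))" if "finite A" for A
  proof -
    have "(\<Sum>r\<in>A. z powi r * ?v r) = (\<Sum>r\<in>A. if m + k = r then 2 * pi * z powi (m + k) else 0)"
      by (rule sum.cong) auto
    then show ?thesis using that by simp
  qed
  have "(\<lambda>t. powi_quotient m z (cis t) * cis t powi k * cis t) =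
      (\<lambda>t. (\<Sum>r\<in>{0..<m}. z powi r * cis (of_int (m + k - r) * t)) - (\<Sum>r\<in>{m..<0}. z powi r * cis (of_int (m + k - r) * t)))"
    by (simp only: powi_quotient_def left_diff_distrib sum_distrib_right mult.assoc c[unfolded mult.assoc])
  then have "integral ?I (\<lambda>t. powi_quotient m z (cis t) * cis t powi k * cis t) =
      (\<Sum>r\<in>{0..<m}. z powi r * ?v r) - (\<Sum>r\<in>{m..<0}. z powi r * ?v r)"
    by (simp only:) (intro integral_unique has_integral_diff i, simp_all)
  also have "\<dots> = 2 * pi * (z powi (m + k) * ((if 0 \<le> m + k then 1 else 0) - (if 0 \<le> k then 1 else 0)))"
    by (simp only: v finite_atLeastLessThan_int) (auto simp: algebra_simps)
  finally show ?thesis .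
qed

lemma finite_cis_eq:
  assumes "z \<in> sphere 0 1"
  shows "finite {t \<in> {0..2*pi}. cis t = z}"
proof (rule finite_subset)
  show "{t \<in> {0..2*pi}. cis t = z} \<subseteq> {Arg2pi z, 2 * pi}"
  proof
    fix t assume t: "t \<in> {t \<in> {0..2*pi}. cis t = z}"
    then have "Arg2pi z = t" if "t < 2 * pi"
      by (intro Arg2pi_unique[of 1]) (use that in \<open>auto simp: cis_conv_exp\<close>)
    with t show "t \<in> {Arg2pi z, 2 * pi}" by fastforce
  qed
qed simp

text \<open>The kernel is undefined on the diagonal (the division yields \<open>0\<close> there), which is a finite
  set of parameters for each \<open>z\<close>.\<close>

lemma contour_integral_quotient_kernel:
  fixes d :: "int \<Rightarrow> complex"
  assumes d: "wsummable d" and z: "z \<in> sphere 0 1"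
  shows "contour_integral (circlepath 0 1) (\<lambda>w. (laurent d z - laurent d w) / (2 * pi * \<i> * (z - w)) * w powi k) =
    laurent (\<lambda>r. d (r - k) * ((if 0 \<le> r then 1 else 0) - (if 0 \<le> k then 1 else 0))) z"
proof -
  note ds = wsummable_imp_abs_summable[OF d]
  let ?I = "{0..2*pi}"
  let ?G = "\<lambda>w. (laurent d z - laurent d w) / (2 * pi * \<i> * (z - w)) * w powi k"
  let ?u = "\<lambda>m t. d m * (powi_quotient m z (cis t) * cis t powi k * cis t) / (2 * pi)"
  let ?e = "\<lambda>r. d (r - k) * ((if 0 \<le> r then 1 else 0) - (if 0 \<le> k then 1 else 0))"
  have cont: "continuous_on ?I (?u m)" for m
    unfolding powi_quotient_def by (intro continuous_intros) auto
  have bound: "norm (?u m t) \<le> norm (of_int m * d m)" for m t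
  proof -
    have "norm (?u m t) = norm (d m) * norm (powi_quotient m z (cis t)) / (2 * pi)"
      by (simp add: norm_mult norm_divide norm_power_int)
    also have "\<dots> \<le> norm (d m) * \<bar>of_int m\<bar> / 1"
      by (intro frac_le mult_left_mono norm_powi_quotient_le z) (use pi_ge_two in auto)
    finally show ?thesis by (simp add: norm_mult mult.commute)
  qed
  note hs = has_integral_infsum[OF cont bound d[unfolded wsummable_def]]
  have iu: "integral ?I (?u m) = d m * (z powi (m + k) * ((if 0 \<le> m + k then 1 else 0) - (if 0 \<le> k then 1 else 0)))" for m
  proof -
    have "integral ?I (?u m) = d m * integral ?I (\<lambda>t. powi_quotient m z (cis t) * cis t powi k * cis t) / (2 * pi)"
      by (simp only: integral_divide integral_mult_right)
    then show ?thesis unfolding integral_powi_quotient[OF z] by simp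
  qed
  have "integral ?I (\<lambda>t. \<Sum>\<^sub>\<infinity>m. ?u m t) = (\<Sum>\<^sub>\<infinity>m. integral ?I (?u m))"
    using infsumI[OF hs(1)] by simp
  also have "\<dots> = (\<Sum>\<^sub>\<infinity>r. integral ?I (?u (r - k)))"
    by (rule infsum_reindex_bij_betw[symmetric]) (rule bij_betwI[of _ _ _ "\<lambda>m. m + k"], auto)
  also have "\<dots> = laurent ?e z"
    unfolding laurent_def iu by (rule infsum_cong) (simp add: mult_ac)
  finally have int: "integral ?I (\<lambda>t. \<Sum>\<^sub>\<infinity>m. ?u m t) = laurent ?e z" .
  have eq: "?G (cis t) * 1 * \<i> * cis t = (\<Sum>\<^sub>\<infinity>m. ?u m t)" if "cis t \<noteq> z" for t
  proof -
    let ?w = "cis t"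
    have zw: "z \<noteq> 0" "z - ?w \<noteq> 0" using z that by auto
    have q: "powi_quotient m z ?w = (z powi m - ?w powi m) / (z - ?w)" for m
      using powi_quotient[OF zw(1), of ?w m] zw(2) by (simp add: field_simps)
    have "((\<lambda>m. d m * z powi m + - (d m * ?w powi m)) has_sum laurent d z + - laurent d ?w) UNIV"
      by (intro has_sum_add has_sum_uminusI laurent_has_sum ds z) simp
    then have "((\<lambda>m. (d m * z powi m + - (d m * ?w powi m)) * (?w powi k * ?w / (2 * pi * (z - ?w)))) has_sum
        (laurent d z + - laurent d ?w) * (?w powi k * ?w / (2 * pi * (z - ?w)))) UNIV"
      by (rule has_sum_cmult_left)
    moreover have "(d m * z powi m + - (d m * ?w powi m)) * (?w powi k * ?w / (2 * pi * (z - ?w))) = ?u m t" for m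
      unfolding q by (simp add: field_simps)
    ultimately have "(\<Sum>\<^sub>\<infinity>m. ?u m t) = (laurent d z + - laurent d ?w) * (?w powi k * ?w / (2 * pi * (z - ?w)))"
      by (simp add: infsumI)
    also have "\<dots> = ?G ?w * 1 * \<i> * ?w"
      using zw(2) by (simp add: field_simps)
    finally show ?thesis by simp
  qed
  have "((\<lambda>t. \<Sum>\<^sub>\<infinity>m. ?u m t) has_integral laurent ?e z) ?I"
    unfolding int[symmetric] by (intro integrable_integral integrable_continuous_real hs(2))
  then have "((\<lambda>t. ?G (cis t) * 1 * \<i> * cis t) has_integral laurent ?e z) ?I"
    by (rule has_integral_spike_finite[OF finite_cis_eq[OF z], rotated]) (use eq in auto)
  then have "(?G has_contour_integral laurent ?e z) (part_circlepath 0 1 0 (2*pi))"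
    by (subst has_contour_integral_part_circlepath_iff) simp_all
  then show ?thesis
    by (simp add: circlepath_def contour_integral_unique)
qed

section \<open>Identification of the three matrices\<close>

lemma wsummable_shift:
  assumes "wsummable a" shows "wsummable (\<lambda>m. a (m + n))"
proof -
  have b: "bij_betw (\<lambda>m. m + n) UNIV UNIV" by (rule bij_betwI[of _ _ _ "\<lambda>m. m - n"]) auto
  have s: "(\<lambda>m. h (m + n)) summable_on UNIV" if "h summable_on UNIV" for h :: "int \<Rightarrow> real"
    using summable_on_reindex_bij_betw[OF b, of h] that by simp
  have "(\<lambda>m. norm (of_int (m + n) * a (m + n)) + \<bar>of_int n\<bar> * norm (a (m + n))) summable_on UNIV"
    using s[OF assms[unfolded wsummable_def]] s[OF wsummable_imp_abs_summable[OF assms]]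
    by (intro summable_on_add summable_on_cmult_right)
  then show ?thesis
    unfolding wsummable_def
  proof (rule summable_on_comparison_test)
    fix m
    have "\<bar>of_int m\<bar> * norm (a (m + n)) \<le> (\<bar>of_int (m + n)\<bar> + \<bar>of_int n\<bar>) * norm (a (m + n))"
      by (rule mult_right_mono) auto
    then show "norm (of_int m * a (m + n)) \<le> norm (of_int (m + n) * a (m + n)) + \<bar>of_int n\<bar> * norm (a (m + n))"
      by (simp only: norm_mult norm_of_int distrib_right)
  qed simp
qed

lemma laurent_shift:
  assumes "z \<noteq> 0"
  shows "laurent (\<lambda>m. a (m + n)) z = laurent a z * z powi (- n)"
proof -
  have "laurent a z * z powi (- n) = (\<Sum>\<^sub>\<infinity>j. a j * z powi j * z powi (- n))"
    unfolding laurent_def by (rule infsum_cmult_left'[symmetric])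
  also have "\<dots> = (\<Sum>\<^sub>\<infinity>m. a (m + n) * z powi (m + n) * z powi (- n))"
    by (rule infsum_reindex_bij_betw[symmetric]) (rule bij_betwI[of _ _ _ "\<lambda>m. m - n"], auto)
  also have "\<dots> = laurent (\<lambda>m. a (m + n)) z"
    unfolding laurent_def
    by (rule infsum_cong) (use assms in \<open>simp add: mult.assoc flip: power_int_add\<close>)
  finally show ?thesis ..
qed

text \<open>With a(z) = z^n f(z) and d = 1/a, the numerator 1 - a(z) d(w) equals a(z) (d(z) - d(w)).
  The operator is therefore multiplication by a after the commutator of P_0 with multiplication by
  d.\<close>

lemma Kmat_eq_entry:
  fixes n :: int
  assumes f: "continuous_on (sphere 0 1) f" and nz: "\<And>z. z \<in> sphere 0 1 \<Longrightarrow> f z \<noteq> 0"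
    and w: "wsummable (fcoef f)"
  defines "a \<equiv> \<lambda>m. fcoef f (m + - n)" and "d \<equiv> \<lambda>m. fcoef (\<lambda>z. inverse (f z)) (m + n)"
  shows "Kmat f n j k = entry (toep a * (step_mat 1 0 0 * toep d - toep d * step_mat 1 0 0)) j k"
proof -
  let ?b = "fcoef (\<lambda>z. inverse (f z))"
  have wb: "wsummable ?b" by (rule inverse_laurent[OF f nz w])
  have ci: "continuous_on (sphere 0 1) (\<lambda>z. inverse (f z))"
    by (intro continuous_intros f) (use nz in auto)
  have wa: "wsummable a" unfolding a_def by (rule wsummable_shift[OF w])
  have wd: "wsummable d" unfolding d_def by (rule wsummable_shift[OF wb])
  note as = wsummable_imp_abs_summable[OF wa] and ds = wsummable_imp_abs_summable[OF wd]
  have la: "laurent a z = z powi n * f z" if "z \<in> sphere 0 1" for z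
    using that laurent_shift[of z "fcoef f" "- n"] laurent_fcoef[OF f wsummable_imp_abs_summable[OF w] that]
    by (cases "z = 0") (auto simp: a_def mult.commute)
  have ld: "laurent d z = z powi (- n) * inverse (f z)" if "z \<in> sphere 0 1" for z
    using that laurent_shift[of z ?b n] laurent_fcoef[OF ci wsummable_imp_abs_summable[OF wb] that]
    by (cases "z = 0") (auto simp: d_def mult.commute)
  have lad: "laurent a z * laurent d z = 1" if z: "z \<in> sphere 0 1" for z
  proof -
    have "z powi n * z powi (- n) = 1" using z by (subst power_int_add[symmetric]) auto
    moreover have "z powi n * f z * (z powi (- n) * inverse (f z)) =
        (z powi n * z powi (- n)) * (f z * inverse (f z))" by (simp only: mult_ac)
    ultimately show ?thesis
      using nz[OF z] by (simp add: la[OF z] ld[OF z])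
  qed
  let ?e = "\<lambda>r. d (r - k) * ((if 0 \<le> r then 1 else 0) - (if 0 \<le> k then 1 else 0))"
  have es: "?e abs_summable_on UNIV"
  proof (rule abs_summable_mult_bounded[where c = 1])
    have "bij_betw (\<lambda>m. m - k) UNIV UNIV" by (rule bij_betwI[of _ _ _ "\<lambda>m. m + k"]) auto
    then show "(\<lambda>r. d (r - k)) abs_summable_on UNIV"
      using summable_on_reindex_bij_betw[of "\<lambda>m. m - k" UNIV UNIV "\<lambda>m. norm (d m)"] ds by simp
  qed auto
  have inner: "contour_integral (circlepath 0 1) (\<lambda>w. Kker f n z w * w powi k) = laurent (conv a ?e) z"
    if z: "z \<in> sphere 0 1" for z
  proof -
    have "contour_integral (circlepath 0 1) (\<lambda>w. Kker f n z w * w powi k) =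
        contour_integral (circlepath 0 1) (\<lambda>w. laurent a z * ((laurent d z - laurent d w) / (2 * pi * \<i> * (z - w)) * w powi k))"
    proof (rule contour_integral_cong[OF refl])
      fix w :: complex assume "w \<in> path_image (circlepath 0 1)"
      then have w: "w \<in> sphere 0 1" by simp
      have "1 - z powi n * f z * w powi (- n) * inverse (f w) = laurent a z * (laurent d z - laurent d w)"
        by (simp add: right_diff_distrib lad[OF z]) (simp add: la[OF z] ld[OF w] mult.assoc)
      then show "Kker f n z w * w powi k =
          laurent a z * ((laurent d z - laurent d w) / (2 * pi * \<i> * (z - w)) * w powi k)"
        by (simp add: Kker_def)
    qed
    also have "\<dots> = laurent a z * laurent ?e z"
      unfolding contour_integral_quotient_kernel[OF wd z, symmetric]
      by (simp only: contour_integral_integral mult.assoc integral_mult_right)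
    also have "\<dots> = laurent (conv a ?e) z"
      by (rule laurent_conv[OF as es z, symmetric])
    finally show ?thesis .
  qed
  have "Kmat f n j k = fcoef (laurent (conv a ?e)) j"
    unfolding Kmat_def fcoef_def inner[OF cis_in_sphere]
    by (rule arg_cong2[where f = "(*)", OF refl], rule integral_cong, rule mult.commute)
  also have "\<dots> = conv a ?e j"
    by (rule fcoef_laurent[OF abs_summable_conv[OF as es]])
  also have "\<dots> = entry (toep a * (step_mat 1 0 0 * toep d - toep d * step_mat 1 0 0)) j k"
    unfolding conv_def entry_mult[of "toep a"]
    by (rule infsum_cong)
       (simp add: entry_step_mat_mult entry_mult_step_mat entry_toep[OF as] entry_toep[OF ds] algebra_simps)
  finally show ?thesis .
qed

lemma suminf_eq_infsum_nat:
  fixes f :: "nat \<Rightarrow> complex"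
  assumes "f summable_on UNIV"
  shows "(\<Sum>m. f m) = (\<Sum>\<^sub>\<infinity>m. f m)"
  using has_sum_imp_sums[OF has_sum_infsum[OF assms]] by (rule sums_unique[symmetric])

text \<open>The summation index \<open>m\<close> corresponds to the intermediate index -m - 1 of the
  matrix product, so it runs over the negative integers kept by 1 - P_0.\<close>

lemma Smat_eq_entry:
  assumes a: "fcoef f abs_summable_on UNIV" and b: "fcoef (\<lambda>z. inverse (f z)) abs_summable_on UNIV"
  shows "Smat f i j = entry (toep (fcoef (\<lambda>z. inverse (f z))) * step_mat 0 1 0 * toep (fcoef f)) i j"
proof -
  let ?b = "fcoef (\<lambda>z. inverse (f z))" and ?a = "fcoef f"
  let ?h = "\<lambda>k. ?b (i - k) * ?a (k - j)"
  have e: "entry (toep ?b * step_mat 0 1 0 * toep ?a) i j = (\<Sum>\<^sub>\<infinity>k. ?b (i - k) * (if 0 \<le> k then 0 else 1) * ?a (k - j))"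
    unfolding entry_mult[of "_ * _"] by (simp only: entry_mult_step_mat entry_toep[OF a] entry_toep[OF b])
  have s: "?h summable_on UNIV"
    using abs_summable_summable[OF summable_bmat_mult[of "toep ?b" i "toep ?a" j]]
    by (simp add: entry_toep[OF a] entry_toep[OF b])
  have r: "range (\<lambda>m. - int m - 1) = {..<0}"
  proof -
    have "k \<in> range (\<lambda>m. - int m - 1)" if "k < 0" for k
      by (rule image_eqI[of _ _ "nat (- k - 1)"]) (use that in auto)
    then show ?thesis by auto
  qed
  have inj: "inj (\<lambda>m. - int m - 1)" by (auto simp: inj_on_def)
  have "(\<Sum>\<^sub>\<infinity>k. ?b (i - k) * (if 0 \<le> k then 0 else 1) * ?a (k - j)) = infsum ?h {..<0}"
    by (rule infsum_cong_neutral) auto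
  also have "\<dots> = (\<Sum>\<^sub>\<infinity>m. ?h (- int m - 1))"
    unfolding r[symmetric] by (subst infsum_reindex[OF inj]) (simp add: o_def)
  also have "\<dots> = (\<Sum>m. ?h (- int m - 1))"
  proof (rule suminf_eq_infsum_nat[symmetric])
    have "?h summable_on range (\<lambda>m. - int m - 1)"
      by (rule summable_on_subset_banach[OF s]) simp
    then show "(\<lambda>m. ?h (- int m - 1)) summable_on UNIV"
      by (subst (asm) summable_on_reindex[OF inj]) (simp add: o_def)
  qed
  also have "\<dots> = Smat f i j"
  proof -
    have "i - (- int m - 1) = i + int m + 1" "- int m - 1 - j = - j - int m - 1" for m by simp_all
    then show ?thesis unfolding Smat_def by (simp only:)
  qed
  finally show ?thesis using e by simp
qed

lemma Rmat_eq_entry: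
  assumes a: "fcoef f abs_summable_on UNIV" and b: "fcoef (\<lambda>z. inverse (f z)) abs_summable_on UNIV"
  shows "Rmat f i j = entry (toep (fcoef (\<lambda>z. inverse (f z))) * step_mat 1 0 0 * toep (fcoef f)) i j"
proof -
  let ?b = "fcoef (\<lambda>z. inverse (f z))" and ?a = "fcoef f"
  let ?h = "\<lambda>k. ?b (i - k) * ?a (k - j)"
  have e: "entry (toep ?b * step_mat 1 0 0 * toep ?a) i j = (\<Sum>\<^sub>\<infinity>k. ?b (i - k) * (if 0 \<le> k then 1 else 0) * ?a (k - j))"
    unfolding entry_mult[of "_ * _"] by (simp only: entry_mult_step_mat entry_toep[OF a] entry_toep[OF b])
  have s: "?h summable_on UNIV"
    using abs_summable_summable[OF summable_bmat_mult[of "toep ?b" i "toep ?a" j]]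
    by (simp add: entry_toep[OF a] entry_toep[OF b])
  have r: "range int = {0..}" by (auto intro: image_eqI[of _ _ "nat _"])
  have "(\<Sum>\<^sub>\<infinity>k. ?b (i - k) * (if 0 \<le> k then 1 else 0) * ?a (k - j)) = infsum ?h {0..}"
    by (rule infsum_cong_neutral) auto
  also have "\<dots> = (\<Sum>\<^sub>\<infinity>m. ?h (int m))"
    unfolding r[symmetric] by (subst infsum_reindex) (simp_all add: o_def)
  also have "\<dots> = (\<Sum>m. ?h (int m))"
  proof (rule suminf_eq_infsum_nat[symmetric])
    have "?h summable_on range int"
      by (rule summable_on_subset_banach[OF s]) simp
    then show "(\<lambda>m. ?h (int m)) summable_on UNIV"
      by (subst (asm) summable_on_reindex) (simp_all add: o_def)
  qed
  also have "\<dots> = Rmat f i j"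
    unfolding Rmat_def by (rule arg_cong[where f = suminf]) (simp add: fun_eq_iff algebra_simps)
  finally show ?thesis using e by simp
qed

theorem theorem2p1:
  fixes \<phi> :: "complex \<Rightarrow> complex" and n :: int and s :: complex
  assumes cont: "continuous_on (sphere 0 1) \<phi>"
    and nz: "\<And>z. z \<in> sphere 0 1 \<Longrightarrow> \<phi> z \<noteq> 0"
    and summ: "(\<lambda>j::int. norm (of_int j * fcoef \<phi> j)) summable_on UNIV"
  shows "trace_class UNIV (Kmat \<phi> n)
    \<and> trace_class {n..} (Smat \<phi>)
    \<and> trace_class {..n-1} (Rmat \<phi>)
    \<and> (s \<noteq> -1 \<longrightarrow>
         fredholm_det UNIV (\<lambda>i j. - s * Kmat \<phi> n i j)
           = (1 + s) powi (n + windnum \<phi>) * fredholm_det {n..} (\<lambda>i j. - (s\<^sup>2) * Smat \<phi> i j))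
    \<and> (s \<noteq> 1 \<longrightarrow>
         fredholm_det UNIV (\<lambda>i j. - s * Kmat \<phi> n i j)
           = (1 - s) powi (- n - windnum \<phi>) * fredholm_det {..n-1} (\<lambda>i j. - (s\<^sup>2) * Rmat \<phi> i j))"
proof -
  define a b where "a = fcoef \<phi>" and "b = fcoef (\<lambda>z. inverse (\<phi> z))"
  have wa: "wsummable a" using summ by (simp add: a_def wsummable_def)
  have wb: "wsummable b" unfolding b_def by (rule inverse_laurent[OF cont nz wa[unfolded a_def]])
  note as = wsummable_imp_abs_summable[OF wa] and bs = wsummable_imp_abs_summable[OF wb]
  have ci: "continuous_on (sphere 0 1) (\<lambda>z. inverse (\<phi> z))"
    by (intro continuous_intros cont) (use nz in auto)
  have ab: "laurent a z * laurent b z = 1" "laurent b z * laurent a z = 1" if "z \<in> sphere 0 1" for z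
    using laurent_fcoef[OF cont as[unfolded a_def] that] laurent_fcoef[OF ci bs[unfolded b_def] that] nz[OF that]
    by (simp_all add: a_def b_def)
  let ?A = "toep a" and ?B = "toep b"
  let ?S = "?B * step_mat 0 1 0 * ?A" and ?R = "?B * step_mat 1 0 0 * ?A"
  let ?K' = "step_mat 1 0 n - ?R"
  have BA: "?B * ?A = 1" and AB: "?A * ?B = 1"
    by (rule inverse_coefficients[OF bs as ab(2)], assumption, rule inverse_coefficients[OF as bs ab(1)])
  have comm: "nuclear (?A * step_mat 1 0 0 - step_mat 1 0 0 * ?A)" by (rule nuclear_toep_step[OF wa])
  have K': "nuclear ?K'" by (rule nuclear_step_minus_conj[OF comm BA])
  define K where "K = ?A * ?K' * ?B"
  have K: "nuclear K" unfolding K_def by (intro nuclear_mult_left nuclear_mult_right K')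
  have entry_K: "Kmat \<phi> n i j = entry K i j" for i j
  proof -
    \<comment> \<open>Multiplication by z^n and z^(-n), left unsimplified to match
      \<open>toep_shift_conj\<close> with c = 1 and shift -n.\<close>
    let ?Z = "toep (\<lambda>m. 1 / 1 * delta (- (- n)) m)" and ?Z' = "toep (\<lambda>m. 1 * delta (- n) m)"
    have sh: "(\<lambda>m. c * delta k m) abs_summable_on UNIV" for c k
      by (intro abs_summable_cmult abs_summable_delta)
    have Aa: "toep (\<lambda>m. a (m + - n)) = ?A * ?Z"
    proof (rule toep_laurent_mult[OF as sh wsummable_imp_abs_summable[OF wsummable_shift[OF wa]]])
      fix z :: complex assume "z \<in> sphere 0 1"
      then have "z \<noteq> 0" by auto
      then show "laurent (\<lambda>m. a (m + - n)) z = laurent a z * laurent (\<lambda>m. 1 / 1 * delta (- (- n)) m) z"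
        unfolding laurent_cmult laurent_delta by (subst laurent_shift) simp_all
    qed
    have Bb: "toep (\<lambda>m. b (m + n)) = ?Z' * ?B"
    proof (rule toep_laurent_mult[OF sh bs wsummable_imp_abs_summable[OF wsummable_shift[OF wb]]])
      fix z :: complex assume "z \<in> sphere 0 1"
      then have "z \<noteq> 0" by auto
      then show "laurent (\<lambda>m. b (m + n)) z = laurent (\<lambda>m. 1 * delta (- n) m) z * laurent b z"
        unfolding laurent_cmult laurent_delta by (subst laurent_shift) (simp_all add: mult.commute)
    qed
    have Z: "?Z * step_mat p q 0 * ?Z' = step_mat p q n" for p q
      using toep_shift_conj[of 1 "- n" p q] by simp
    have ZZ: "?Z * ?Z' = 1"
      using Z[of 1 1] by (simp only: step_mat_1 mult_1_right)
    have "toep (\<lambda>m. a (m + - n)) * (step_mat 1 0 0 * toep (\<lambda>m. b (m + n)) - toep (\<lambda>m. b (m + n)) * step_mat 1 0 0) =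
        ?A * (?Z * step_mat 1 0 0 * ?Z') * ?B - ?A * (?Z * ?Z') * ?B * step_mat 1 0 0"
      unfolding Aa Bb by (simp only: right_diff_distrib mult.assoc)
    \<comment> \<open>Conjugation by z^n has moved P_0 to P_n; since P_0 = A R B, the result is the
      conjugate of P_n - R.\<close>
    also have "\<dots> = ?A * step_mat 1 0 n * ?B - step_mat 1 0 0"
      unfolding Z ZZ by (simp add: AB)
    also have "\<dots> = K"
    proof -
      have "?A * ?R * ?B = (?A * ?B) * step_mat 1 0 0 * (?A * ?B)" by (simp only: mult.assoc)
      then show ?thesis by (simp add: K_def right_diff_distrib left_diff_distrib AB)
    qed
    finally show ?thesis
      using Kmat_eq_entry[OF cont nz wa[unfolded a_def], of n i j] by (simp only: a_def b_def)
  qed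
  have det_K: "fredholm_det UNIV (\<lambda>i j. - s * Kmat \<phi> n i j) = Det (1 - sc s * ?K')"
  proof -
    have "fredholm_det UNIV (\<lambda>i j. - s * Kmat \<phi> n i j) = Det (1 - sc s * K)"
      unfolding entry_K by (rule Det_eq_fredholm_det[symmetric]) simp
    also have "1 - sc s * K = ?A * (1 - sc s * ?K') * ?B"
      unfolding K_def by (simp only: right_diff_distrib[of ?A] left_diff_distrib[of _ _ ?B] mult_1_right AB sc_left_commute mult.assoc)
    also have "Det \<dots> = Det (1 - sc s * ?K')"
      by (rule Det_conj[OF _ BA AB]) (simp add: nuclear_uminus nuclear_mult_left K')
    finally show ?thesis .
  qed
  have S: "Smat \<phi> i j = entry ?S i j" and R: "Rmat \<phi> i j = entry ?R i j" for i j
    unfolding a_def b_def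
    by (intro Smat_eq_entry Rmat_eq_entry as[unfolded a_def] bs[unfolded b_def])+
  have W: "Wdet q n ?A ?B = q powi (n + windnum \<phi>)" if "q \<noteq> 0" for q
    using Wdet_winding[OF cont nz wa[unfolded a_def] that] BA by (simp add: a_def)
  note PS = nuclear_complement_products[OF K' conj_step_sum[OF BA]]
  have "trace_class UNIV (Kmat \<phi> n)"
    by (rule trace_class_nuclear[OF K]) (rule entry_K)
  \<comment> \<open>On this half-line \<open>Smat\<close> agrees with the nuclear matrix P_n S; on
    the other, \<open>Rmat\<close> agrees with (1 - P_n) R.\<close>
  moreover have "trace_class {n..} (Smat \<phi>)"
    by (rule trace_class_nuclear[OF PS(1)]) (simp only: S entry_step_mat_mult atLeast_iff, simp)
  moreover have "trace_class {..n-1} (Rmat \<phi>)"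
    by (rule trace_class_nuclear[OF PS(2)]) (simp only: R entry_step_mat_mult atMost_iff, simp)
  moreover have "fredholm_det UNIV (\<lambda>i j. - s * Kmat \<phi> n i j) =
      (1 + s) powi (n + windnum \<phi>) * fredholm_det {n..} (\<lambda>i j. - (s\<^sup>2) * Smat \<phi> i j)" if "s \<noteq> -1"
  proof -
    have q: "1 + s \<noteq> 0" using that by (simp add: add_eq_0_iff)
    show ?thesis
      unfolding det_K Det_projections(1)[OF comm BA AB that] S W[OF q] by (rule mult.commute)
  qed
  moreover have "fredholm_det UNIV (\<lambda>i j. - s * Kmat \<phi> n i j) =
      (1 - s) powi (- n - windnum \<phi>) * fredholm_det {..n-1} (\<lambda>i j. - (s\<^sup>2) * Rmat \<phi> i j)" if "s \<noteq> 1"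
  proof -
    \<comment> \<open>The second identity enters \<open>Wdet\<close> with the reciprocal of 1 - s,
      which reverses the sign of the exponent.\<close>
    have q: "1 / (1 - s) \<noteq> 0" using that by simp
    have "(1 / (1 - s)) powi (n + windnum \<phi>) = (1 - s) powi (- (n + windnum \<phi>))"
      by (subst power_int_minus) (simp add: divide_inverse power_int_inverse)
    also have "- (n + windnum \<phi>) = - n - windnum \<phi>" by simp
    finally have "Wdet (1 / (1 - s)) n ?A ?B = (1 - s) powi (- n - windnum \<phi>)"
      unfolding W[OF q] .
    then show ?thesis
      unfolding det_K Det_projections(2)[OF comm BA AB that] R by (simp only: mult.commute)
  qed
  ultimately show ?thesis by blast
qed

end
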